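(* Let $X=X_0\cup\dots\cup X_r$ be a connected nodal curve over $\mathbb{K}$ of arithmetic genus $g$, all of whose irreducible components are rational, let $p\in X_0$ be a smooth point of $X$, and let $D$ be a divisor of degree $g-1$ supported on smooth points of $X$, with everything defined over $\mathbb{K}$. With the notation $X_0',D_0,D_0',Z,q_j,\kappa_j,\kappa_{j,1},\kappa_{j,2},a,b,P,K$ of the context, let $Q_1,\dots,Q_\ell$ be a basis of $H^0(X_0',D_0')$. Then the following procedure is correct: (i) If $\ell\neq\deg D_0'+1-p_a(X_0')$, it reports that condition ($**$) fails and terminates; indeed $\ell=\deg D_0'+1-p_a(X_0')$ holds if and only if condition ($**$) holds. (ii) Otherwise, if $H^0(X_0',D_0'-Z)\ne0$, it reports that condition ($*$) fails and terminates; indeed $H^0(X_0',D_0'-Z)=0$ holds if and only if condition ($*$) holds. (iii) Otherwise, it defines the $\ell\times a$ matrix $A$ and the $b\times 2b$ matrix $B$ by $$A_{i,j}=\frac{Q_i(q_j)\,P(\kappa_j)}{K'(\kappa_j)},\qquad B_{j,2j-1}=\frac{P(\kappa_{j,1})}{K'(\kappa_{j,1})},\quad B_{j,2j}=\frac{P(\kappa_{j,2})}{K'(\kappa_{j,2})},\quad B_{i,j}=0\text{ otherwise},$$ and outputs the $(\ell+b)\times(a+2b)$ matrix $M=\begin{pmatrix}A&0\\0&B\end{pmatrix}$. This matrix, together with the parameters $(\kappa_1,\dots,\kappa_a,\kappa_{1,1},\kappa_{1,2},\dots,\kappa_{b,1},\kappa_{b,2})$, represents the soliton solution for the point $U=\iota(H^0(X,D+\infty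 p))$ of the Sato Grassmannian, after a gauge transformation; that is, $U$ is related by a gauge transformation to the soliton point of the Sato Grassmannian defined by $M$ and these parameters.
   Context: $\mathbb{K}$ is a field of characteristic zero. For a divisor $E$ supported on smooth points of a nodal curve $Y$, $H^i(Y,E)=H^i(Y,\mathcal{O}_Y(E))$; elements of $H^0(Y,E)$ are tuples of rational functions on the normalizations of the components, with poles bounded by $E$, taking equal values at the two points over every node of $Y$. $p_a$ denotes arithmetic genus. Notation. $X_0$ is the component of $X$ containing $p$; $X_0'=\overline{X\setminus X_0}$; $D_0,D_0'$ are the restrictions of $D$ to $X_0,X_0'$; $Z=X_0\cap X_0'=\{q_1,\dots,q_a\}$, also regarded as a reduced divisor on $X_0'$; $n_1,\dots,n_b$ are the nodes of $X_0$. (If $X_0'=\emptyset$, then $a=\ell=0$, and by convention $\deg D_0'=0$, $p_a(X_0')=1$.) Let $\nu:\mathbb{P}^1\to X_0$ be the normalization, $\kappa_j=\nu^{-1}(q_j)$ and $\{\kappa_{j,1},\kappa_{j,2}\}=\nu^{-1}(n_j)$. Fix an affine coordinate $x$ on $\mathbb{P}^1$ with $p=\infty$, and write $D_0=m_1p_1+\dots+m_sp_s+mp$ with $p_i\ne p$. Set $$P(x)=\prod_{j=1}^s(x-p_j)^{m_j},\qquad K(x)=\prod_{j=1}^a(x-\kappa_j)\cdot\prod_{j=1}^b(x-\kappa_{j,1})(x-\kappa_{j,2}),$$ and let $K'(x)$ be the derivative of $K(x)$. Conditions. ($*$): a rational function in $H^0(X,D+np)$ is uniquely determined by its Laurent series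 at $p$ (for every $n$). ($**$): $h^1(X,D+np)=0$ for $n\gg0$. Sato Grassmannian. Let $V=\mathbb{K}((z))$ with natural projection $\pi:V\to\mathbb{K}[z^{-1}]$. Points of the Sato Grassmannian are the $\mathbb{K}$-subspaces $U\subset V$ such that the kernel and cokernel of $\pi|_U$ have the same finite dimension. Let $z=1/x$ be the local coordinate at $p$, and let $H^0(X,D+\infty p)=\bigcup_nH^0(X,D+np)$. The map $\iota:H^0(X,D+\infty p)\to V$ sends $s$ to $z^{m+1}$ times its Laurent series expansion in $z$ at $p$, where $m=\mathrm{ord}_p(D)$. Soliton points. For a $k\times n$ matrix $M=(a_{ji})$ of rank $k$ and distinct parameters $\kappa_1,\dots,\kappa_n\in\mathbb{K}$, the associated soliton point of the Sato Grassmannian is the subspace of $V$ with basis $$f_j=\frac1{z^{k-1}}\sum_{i=1}^n\frac{a_{ji}}{1-\kappa_iz}\ (1\le j\le k),\qquad f_j=\frac1{z^{j-1}}\ (j\ge k+1).$$ It corresponds to the $(k,n)$-soliton $\tau(x,y,t)=\sum_{I\in\binom{[n]}{k}}p_I\prod_{i<j\in I}(\kappa_j-\kappa_i)\exp\left[x\sum_{i\in I}\kappa_i+y\sum_{i\in I}\kappa_i^2+t\sum_{i\in I}\kappa_i^3\right]$, where $p_I$ is the $k\times k$ minor of $M$ with column set $I$ (in this formula $x,y,t$ are the KP variables). A gauge transformation replaces $U$ by $h(z)\,U$ for an invertible power series $h\in\mathbb{K}[[z]]^\times$. *)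

theory Defs
  imports
    Complex_Main
    "HOL-Library.Function_Algebras"
    "HOL-Computational_Algebra.Fraction_Field"
    "HOL-Computational_Algebra.Formal_Laurent_Series"
    "Jordan_Normal_Form.DL_Rank"
begin

section \<open>Closed points and rational functions of the projective line\<close>

text \<open>
  Rational functions are elements of \<open>'k poly fract\<close>.  The closed points of the projective line
  over the field are \<open>Infty\<close> and \<open>Fin q\<close> for \<open>q\<close> monic irreducible; the rational point with
  affine coordinate \<open>c\<close> is \<open>Fin [:-c, 1:]\<close>.
\<close>

datatype 'q place = Fin 'q | Infty

definition closed_places :: "'k::field_char_0 poly place set" where
  "closed_places = insert Infty (Fin ` {q. irreducible q \<and> lead_coeff q = 1})"

definition aff :: "'k::field_char_0 \<Rightarrow> 'k poly place" where
  "aff c = Fin [:-c, 1:]"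

definition rational_places :: "'k::field_char_0 poly place set" where
  "rational_places = insert Infty (range aff)"

fun place_degree :: "'k::field_char_0 poly place \<Rightarrow> nat" where
  "place_degree (Fin q) = degree q"
| "place_degree Infty = 1"

fun local_ring :: "'k::field_char_0 poly place \<Rightarrow> 'k poly fract set" where
  "local_ring (Fin q) = {Fract n d | n d. \<not> q dvd d}"
| "local_ring Infty = {Fract n d | n d. d \<noteq> 0 \<and> degree n \<le> degree d}"

fun uniformizer :: "'k::field_char_0 poly place \<Rightarrow> 'k poly fract" where
  "uniformizer (Fin q) = Fract q 1"
| "uniformizer Infty = Fract 1 [:0, 1:]"

text \<open>The stalk at \<open>y\<close> of the invertible sheaf of a divisor with multiplicity \<open>e\<close> at \<open>y\<close>.\<close>

definition stalk :: "int \<Rightarrow> 'k::field_char_0 poly place \<Rightarrow> 'k poly fract set" where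
  "stalk e y = {(uniformizer y powi (- e)) * u | u. u \<in> local_ring y}"

definition const :: "'k::field_char_0 \<Rightarrow> 'k poly fract" where
  "const c = Fract [:c:] 1"

text \<open>\<open>f\<close> is regular at \<open>y\<close> with residue class \<open>c\<close>, i.e. \<open>f - c\<close> lies in the maximal ideal.\<close>

definition has_value :: "'k::field_char_0 poly place \<Rightarrow> 'k poly fract \<Rightarrow> 'k \<Rightarrow> bool" where
  "has_value y f c \<longleftrightarrow> f - const c \<in> stalk (- 1) y"

definition value_at :: "'k::field_char_0 poly place \<Rightarrow> 'k poly fract \<Rightarrow> 'k" where
  "value_at y f = (THE c. has_value y f c)"

text \<open>Laurent expansion at \<open>Infty\<close> in the local coordinate \<open>z = 1/x\<close>; \<open>fls_X\<close> plays the role of \<open>z\<close>.\<close>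

definition poly_at_inf :: "'k::field_char_0 poly \<Rightarrow> 'k fls" where
  "poly_at_inf n = poly (map_poly fls_const n) fls_X_inv"

definition laurent_at_inf :: "'k::field_char_0 poly fract \<Rightarrow> 'k fls" where
  "laurent_at_inf f =
     (THE s. \<exists>n d. d \<noteq> 0 \<and> f = Fract n d \<and> s = poly_at_inf n / poly_at_inf d)"

lemma poly_at_inf_0: "poly_at_inf 0 = 0" by (simp add: poly_at_inf_def)

lemma poly_at_inf_pCons: "poly_at_inf (pCons c n) = fls_const c + fls_X_inv * poly_at_inf n"
  by (simp add: poly_at_inf_def map_poly_pCons)

lemma poly_at_inf_add: "poly_at_inf (m + n) = poly_at_inf m + poly_at_inf n"
  by (induction m n rule: poly_induct2) (simp_all add: poly_at_inf_pCons algebra_simps poly_at_inf_0 flip: fls_plus_const)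

lemma poly_at_inf_smult: "poly_at_inf (Polynomial.smult c n) = fls_const c * poly_at_inf n"
  by (induction n) (simp_all add: poly_at_inf_pCons algebra_simps poly_at_inf_0 flip: fls_const_mult_const)

lemma poly_at_inf_mult: "poly_at_inf (m * n) = poly_at_inf m * poly_at_inf n"
  by (induction m) (simp_all add: poly_at_inf_pCons algebra_simps poly_at_inf_0 poly_at_inf_add poly_at_inf_smult)

lemma fls_nth_poly_at_inf: "fls_nth (poly_at_inf n) (- int k) = coeff n k"
proof (induction n arbitrary: k)
  case 0 then show ?case by (simp add: poly_at_inf_0)
next
  case (pCons c n)
  have pos: "fls_nth (poly_at_inf m) j = 0" if "j > 0" for m :: "'a poly" and j
    using that by (induction m arbitrary: j) (auto simp: poly_at_inf_0 poly_at_inf_pCons fls_X_inv_times_conv_shift)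
  show ?case
  proof (cases k)
    case 0 then show ?thesis by (simp add: poly_at_inf_pCons fls_X_inv_times_conv_shift pos)
  next
    case (Suc k')
    then have "- int k + 1 = - int k'" by simp
    then show ?thesis using Suc pCons.IH[of k'] by (simp add: poly_at_inf_pCons fls_X_inv_times_conv_shift)
  qed
qed

lemma poly_at_inf_eq_0_iff: "poly_at_inf n = 0 \<longleftrightarrow> n = 0"
  by (metis fls_nth_poly_at_inf poly_at_inf_0 poly_eqI fls_zero_nth coeff_0)

lemma laurent_at_inf_Fract:
  assumes "d \<noteq> 0"
  shows "laurent_at_inf (Fract n d) = poly_at_inf n / poly_at_inf d"
  unfolding laurent_at_inf_def
proof (rule the_equality)
  show "\<exists>n' d'. d' \<noteq> 0 \<and> Fract n d = Fract n' d' \<and> poly_at_inf n / poly_at_inf d = poly_at_inf n' / poly_at_inf d'"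
    using assms by blast
next
  fix s assume "\<exists>n' d'. d' \<noteq> 0 \<and> Fract n d = Fract n' d' \<and> s = poly_at_inf n' / poly_at_inf d'"
  then obtain n' d' where *: "d' \<noteq> 0" "n * d' = n' * d" "s = poly_at_inf n' / poly_at_inf d'"
    using assms by (auto simp: eq_fract)
  from *(2) have "poly_at_inf n * poly_at_inf d' = poly_at_inf n' * poly_at_inf d"
    by (simp flip: poly_at_inf_mult)
  then show "s = poly_at_inf n / poly_at_inf d"
    using * assms by (simp add: frac_eq_eq poly_at_inf_eq_0_iff)
qed

lemma const_in_stalk:
  assumes "y \<in> closed_places" and "const c \<in> stalk (- 1) y"
  shows "c = 0"
proof (rule ccontr)
  assume c: "c \<noteq> 0"
  obtain u where u: "const c = uniformizer y * u" "u \<in> local_ring y" using assms(2) by (auto simp: stalk_def)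
  show False
  proof (cases y)
    case Infty
    then obtain n d where nd: "u = Fract n d" "d \<noteq> 0" "degree n \<le> degree d" using u by auto
    from u(1) have "[:c:] * ([:0,1:] * d) = n" using nd Infty by (simp add: const_def eq_fract)
    moreover have "degree ([:c:] * ([:0,1:] * d)) = degree d + 1" using c nd by (simp add: degree_pCons_eq)
    ultimately show False using nd by simp
  next
    case (Fin p)
    then obtain n d where nd: "u = Fract n d" "\<not> p dvd d" using u by auto
    have "d \<noteq> 0" using nd by auto
    then have "Polynomial.smult c d = p * n" using nd Fin u(1) by (simp add: const_def eq_fract)
    then have "p dvd Polynomial.smult c d" by simp
    then show False using c nd by (simp add: dvd_smult_iff)
  qed
qed

lemma has_value_unique:
  assumes *: "has_value y f c" "y \<in> closed_places" "has_value y f c'"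
  shows "c = c'"
proof -
  have diff: "f - g \<in> stalk (-1) y" if fg: "f \<in> stalk (-1) y" "g \<in> stalk (-1) y" and cl: "y \<in> closed_places" for f g :: "'a poly fract" and y
  proof -
    obtain u v where uv: "f = uniformizer y * u" "u \<in> local_ring y" "g = uniformizer y * v" "v \<in> local_ring y" using fg by (auto simp: stalk_def)
    have "u - v \<in> local_ring y"
    proof (cases y)
      case Infty
      then obtain n d n' d' where nd: "u = Fract n d" "d \<noteq> 0" "degree n \<le> degree d" "v = Fract n' d'" "d' \<noteq> 0" "degree n' \<le> degree d'" using uv by auto
      have "degree (n * d' - n' * d) \<le> degree (d * d')"
        using nd by (intro degree_diff_le) (auto simp: degree_mult_eq intro: degree_mult_le[THEN order_trans])
      then show ?thesis using nd Infty by (auto simp: diff_fract intro!: exI)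
    next
      case (Fin p)
      then have p: "prime_elem p" using cl by (auto simp: closed_places_def intro: field_poly_irreducible_imp_prime)
      obtain n d n' d' where nd: "u = Fract n d" "\<not> p dvd d" "v = Fract n' d'" "\<not> p dvd d'" using uv Fin by auto
      have "d \<noteq> 0" "d' \<noteq> 0" "\<not> p dvd d * d'" using nd p by (auto simp: prime_elem_dvd_mult_iff)
      then show ?thesis using nd Fin by (auto simp: diff_fract)
    qed
    then show ?thesis using uv by (auto simp: stalk_def algebra_simps intro!: exI[of _ "u - v"])
  qed
  have "(f - const c') - (f - const c) \<in> stalk (-1) y" using * diff unfolding has_value_def by blast
  moreover have "(f - const c') - (f - const c) = const (c - c')" by (simp add: const_def)
  ultimately show ?thesis using const_in_stalk[OF *(2), of "c - c'"] by simp
qed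


section \<open>Vector spaces\<close>

definition sec_scale :: "'k::field_char_0 \<Rightarrow> ('c \<Rightarrow> 'k poly fract) \<Rightarrow> 'c \<Rightarrow> 'k poly fract" where
  "sec_scale k f = (\<lambda>c. const k * f c)"

definition adele_scale ::
  "'k::field_char_0 \<Rightarrow> ('p \<Rightarrow> 'c \<Rightarrow> 'k poly fract) \<Rightarrow> 'p \<Rightarrow> 'c \<Rightarrow> 'k poly fract" where
  "adele_scale k r = (\<lambda>x. sec_scale k (r x))"

definition fls_scale :: "'k::field_char_0 \<Rightarrow> 'k fls \<Rightarrow> 'k fls" where
  "fls_scale k f = fls_const k * f"

lemma const_simps: "const (a + b) = const a + const b" "const (a * b) = const a * const b"
  "const 1 = 1"
  by (simp_all add: const_def One_fract_def one_pCons mult.commute)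

global_interpretation sec: vector_space sec_scale
  by unfold_locales (auto simp: sec_scale_def fun_eq_iff algebra_simps const_simps)

global_interpretation adele: vector_space adele_scale
  by unfold_locales (auto simp: adele_scale_def sec_scale_def fun_eq_iff algebra_simps const_simps)

global_interpretation fls: vector_space fls_scale
  by unfold_locales (auto simp: fls_scale_def algebra_simps
      simp flip: fls_const_mult_const fls_plus_const)

text \<open>
  For subspaces \<open>W \<subseteq> V\<close>: the elements of \<open>B\<close> represent a basis of the quotient \<open>V / W\<close>, the last
  two conditions being independence modulo \<open>W\<close> and generation modulo \<open>W\<close>.
\<close>

definition quotient_basis ::
  "('k::field \<Rightarrow> 'v::ab_group_add \<Rightarrow> 'v) \<Rightarrow> 'v set \<Rightarrow> 'v set \<Rightarrow> 'v set \<Rightarrow> bool" where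
  "quotient_basis scale V W B \<longleftrightarrow>
     B \<subseteq> V \<and> \<not> Modules.module.dependent scale B \<and>
     Modules.module.span scale B \<inter> W = {0} \<and>
     V \<subseteq> Modules.module.span scale (B \<union> W)"


section \<open>Nodal curves with rational components\<close>

text \<open>
  A nodal curve with rational components is given by its normalization, a disjoint union of
  projective lines indexed by \<open>comps\<close>, and its nodes, each encoded as the two-element set of the
  points of the normalization lying over it.  Points of the normalization are pairs of a component
  and a place.  The nodes and their branches are rational over the ground field.
\<close>

type_synonym 'k pnt = "nat \<times> 'k poly place"
type_synonym 'k divisor = "'k pnt \<Rightarrow> int"

record (overloaded) 'k curve =
  comps :: "nat set"
  nodes :: "'k pnt set set"

definition nodal_curve :: "'k::field_char_0 curve \<Rightarrow> bool" where
  "nodal_curve Y \<longleftrightarrow>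
     finite (comps Y) \<and> finite (nodes Y) \<and>
     (\<forall>x\<in>nodes Y. card x = 2 \<and> x \<subseteq> comps Y \<times> rational_places) \<and>
     pairwise disjnt (nodes Y)"

definition connected_curve :: "'k::field_char_0 curve \<Rightarrow> bool" where
  "connected_curve Y \<longleftrightarrow> comps Y \<noteq> {} \<and>
     (\<forall>c\<in>comps Y. \<forall>c'\<in>comps Y. (c, c') \<in> {(fst u, fst v) | u v. {u, v} \<in> nodes Y}\<^sup>*)"

text \<open>The union of the components in \<open>C\<close>: only nodes with both branches on \<open>C\<close> survive.\<close>

definition subcurve :: "'k::field_char_0 curve \<Rightarrow> nat set \<Rightarrow> 'k curve" where
  "subcurve Y C = \<lparr>comps = C, nodes = {x \<in> nodes Y. fst ` x \<subseteq> C}\<rparr>"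

definition smooth_points :: "'k::field_char_0 curve \<Rightarrow> 'k pnt set" where
  "smooth_points Y = comps Y \<times> closed_places - \<Union>(nodes Y)"

text \<open>Points of the curve, each as its fibre in the normalization.\<close>

definition points :: "'k::field_char_0 curve \<Rightarrow> 'k pnt set set" where
  "points Y = nodes Y \<union> (\<lambda>u. {u}) ` smooth_points Y"

definition divisor_on :: "'k::field_char_0 curve \<Rightarrow> 'k divisor \<Rightarrow> bool" where
  "divisor_on Y E \<longleftrightarrow> finite {u. E u \<noteq> 0} \<and> {u. E u \<noteq> 0} \<subseteq> smooth_points Y"

definition div_degree :: "'k::field_char_0 divisor \<Rightarrow> int" where
  "div_degree E = (\<Sum>u | E u \<noteq> 0. E u * int (place_degree (snd u)))"

definition restrict_div :: "'k::field_char_0 divisor \<Rightarrow> nat set \<Rightarrow> 'k divisor" where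
  "restrict_div E C = (\<lambda>u. if fst u \<in> C then E u else 0)"

definition add_multiple :: "'k::field_char_0 divisor \<Rightarrow> nat \<Rightarrow> 'k pnt \<Rightarrow> 'k divisor" where
  "add_multiple E n p = (\<lambda>u. E u + (if u = p then int n else 0))"


section \<open>Cohomology\<close>

definition rational_functions :: "'k::field_char_0 curve \<Rightarrow> (nat \<Rightarrow> 'k poly fract) set" where
  "rational_functions Y = {f. \<forall>c. c \<notin> comps Y \<longrightarrow> f c = 0}"

text \<open>
  Membership in the stalk at the point \<open>x\<close> of the sheaf of the divisor \<open>E\<close>; only the components
  through \<open>x\<close> are constrained.
\<close>

definition germs ::
  "'k::field_char_0 curve \<Rightarrow> 'k divisor \<Rightarrow> 'k pnt set \<Rightarrow> (nat \<Rightarrow> 'k poly fract) set" where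
  "germs Y E x = {f.
     (\<forall>(c, y)\<in>x. f c \<in> stalk (E (c, y)) y) \<and>
     (x \<in> nodes Y \<longrightarrow> (\<exists>v. \<forall>(c, y)\<in>x. has_value y (f c) v))}"

definition H0 :: "'k::field_char_0 curve \<Rightarrow> 'k divisor \<Rightarrow> (nat \<Rightarrow> 'k poly fract) set" where
  "H0 Y E = {f \<in> rational_functions Y. \<forall>x\<in>points Y. f \<in> germs Y E x}"

definition h0 :: "'k::field_char_0 curve \<Rightarrow> 'k divisor \<Rightarrow> nat" where
  "h0 Y E = sec.dim (H0 Y E)"

text \<open>
  The first cohomology is computed by repartitions (Weil, Serre), that is, from the flasque
  resolution of the sheaf of \<open>E\<close> by the sheaf of rational functions and its quotient:
  it is \<open>adeles Y\<close> modulo \<open>coboundaries Y E\<close>.  The entries of \<open>r x\<close> on components not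
  passing through \<open>x\<close> are arbitrary in \<open>adeles Y\<close> and in \<open>adeles_bounded Y E\<close>, so they do not
  affect the quotient.
\<close>

definition adeles ::
  "'k::field_char_0 curve \<Rightarrow> ('k pnt set \<Rightarrow> nat \<Rightarrow> 'k poly fract) set" where
  "adeles Y = {r. finite {x \<in> points Y. r x \<notin> germs Y (\<lambda>_. 0) x}}"

definition adeles_bounded ::
  "'k::field_char_0 curve \<Rightarrow> 'k divisor \<Rightarrow> ('k pnt set \<Rightarrow> nat \<Rightarrow> 'k poly fract) set" where
  "adeles_bounded Y E = {r. \<forall>x\<in>points Y. r x \<in> germs Y E x}"

definition coboundaries ::
  "'k::field_char_0 curve \<Rightarrow> 'k divisor \<Rightarrow> ('k pnt set \<Rightarrow> nat \<Rightarrow> 'k poly fract) set" where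
  "coboundaries Y E = {(\<lambda>x. f) + r | f r. f \<in> rational_functions Y \<and> r \<in> adeles_bounded Y E}"

definition h1 :: "'k::field_char_0 curve \<Rightarrow> 'k divisor \<Rightarrow> nat" where
  "h1 Y E = card (SOME B. quotient_basis adele_scale (adeles Y) (coboundaries Y E) B)"

text \<open>
  Vanishing is stated for the space itself, because \<open>card\<close> is also \<open>0\<close> on infinite sets.
\<close>

definition H1_vanishes :: "'k::field_char_0 curve \<Rightarrow> 'k divisor \<Rightarrow> bool" where
  "H1_vanishes Y E \<longleftrightarrow> adeles Y \<subseteq> coboundaries Y E"

text \<open>
  One minus the Euler characteristic of the structure sheaf; this is \<open>1\<close> for the empty curve.
\<close>

definition arith_genus :: "'k::field_char_0 curve \<Rightarrow> int" where
  "arith_genus Y = 1 - (int (h0 Y (\<lambda>_. 0)) - int (h1 Y (\<lambda>_. 0)))"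


section \<open>The two conditions\<close>

definition determined_by_laurent ::
  "'k::field_char_0 curve \<Rightarrow> 'k divisor \<Rightarrow> bool" where
  "determined_by_laurent X D \<longleftrightarrow>
     (\<forall>n. inj_on (\<lambda>f. laurent_at_inf (f 0)) (H0 X (add_multiple D n (0, Infty))))"

definition eventually_nonspecial ::
  "'k::field_char_0 curve \<Rightarrow> 'k divisor \<Rightarrow> bool" where
  "eventually_nonspecial X D \<longleftrightarrow>
     (\<forall>\<^sub>F n in sequentially. H1_vanishes X (add_multiple D n (0, Infty)))"


section \<open>Sato Grassmannian\<close>

definition polar_part :: "'k::field_char_0 fls \<Rightarrow> 'k fls" where
  "polar_part f = Abs_fls (\<lambda>n. if n \<le> 0 then fls_nth f n else 0)"

definition sato_grassmannian :: "'k::field_char_0 fls set set" where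
  "sato_grassmannian = {U. fls.subspace U \<and>
     (\<exists>B C. finite B \<and> finite C \<and> card B = card C \<and>
        quotient_basis fls_scale {f \<in> U. polar_part f = 0} {0} B \<and>
        quotient_basis fls_scale (range polar_part) (polar_part ` U) C)}"

text \<open>The image of the sections of \<open>D + n p\<close>, \<open>n \<ge> 0\<close>, with \<open>p = (0, Infty)\<close>.\<close>

definition sato_point :: "'k::field_char_0 curve \<Rightarrow> 'k divisor \<Rightarrow> 'k fls set" where
  "sato_point X D = (\<lambda>f. fls_X_intpow (D (0, Infty) + 1) * laurent_at_inf (f 0)) `
     (\<Union>n. H0 X (add_multiple D n (0, Infty)))"

definition gauge_equivalent :: "'k::field_char_0 fls set \<Rightarrow> 'k fls set \<Rightarrow> bool" where
  "gauge_equivalent U U' \<longleftrightarrow> (\<exists>h::'k fps. h dvd 1 \<and> U = (\<lambda>f. fps_to_fls h * f) ` U')"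

text \<open>Indices start at \<open>0\<close>: \<open>soliton_basis M \<kappa>s j\<close> is the basis vector usually numbered \<open>j + 1\<close>.\<close>

definition soliton_basis :: "'k::field_char_0 mat \<Rightarrow> 'k list \<Rightarrow> nat \<Rightarrow> 'k fls" where
  "soliton_basis M \<kappa>s j =
     (if j < dim_row M
      then fls_X_intpow (1 - int (dim_row M)) *
             (\<Sum>i<dim_col M. fls_const (M $$ (j, i)) / (1 - fls_const (\<kappa>s ! i) * fls_X))
      else fls_X_intpow (- int j))"

definition soliton_point :: "'k::field_char_0 mat \<Rightarrow> 'k list \<Rightarrow> 'k fls set" where
  "soliton_point M \<kappa>s = fls.span (range (soliton_basis M \<kappa>s))"

text \<open>
  \<open>M\<close> and \<open>\<kappa>s\<close> are admissible data for a soliton point, and this point is gauge equivalent to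
  the point \<open>U\<close> of the Sato Grassmannian.
\<close>

definition represents_soliton ::
  "'k::field_char_0 mat \<Rightarrow> 'k list \<Rightarrow> 'k fls set \<Rightarrow> bool" where
  "represents_soliton M \<kappa>s U \<longleftrightarrow>
     length \<kappa>s = dim_col M \<and> distinct \<kappa>s \<and> vec_space.rank (dim_row M) M = dim_row M \<and>
     U \<in> sato_grassmannian \<and> gauge_equivalent U (soliton_point M \<kappa>s)"


section \<open>The soliton data of a curve\<close>

text \<open>
  \<open>\<kappa>\<close> lists the parameters of the intersection points with the rest of the curve, \<open>\<mu>\<close> and \<open>\<nu>\<close>
  those of the two branches of the nodes of the component \<open>0\<close>.
\<close>

definition soliton_params ::
  "nat \<Rightarrow> nat \<Rightarrow> (nat \<Rightarrow> 'k) \<Rightarrow> (nat \<Rightarrow> 'k) \<Rightarrow> (nat \<Rightarrow> 'k) \<Rightarrow> 'k::field_char_0 list" where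
  "soliton_params a b \<kappa> \<mu> \<nu> = map \<kappa> [0..<a] @ concat (map (\<lambda>j. [\<mu> j, \<nu> j]) [0..<b])"

definition node_poly ::
  "nat \<Rightarrow> nat \<Rightarrow> (nat \<Rightarrow> 'k) \<Rightarrow> (nat \<Rightarrow> 'k) \<Rightarrow> (nat \<Rightarrow> 'k) \<Rightarrow> 'k::field_char_0 poly" where
  "node_poly a b \<kappa> \<mu> \<nu> = (\<Prod>j<a. [:- \<kappa> j, 1:]) * (\<Prod>j<b. [:- \<mu> j, 1:] * [:- \<nu> j, 1:])"

text \<open>
  Value at \<open>t\<close> of the product of the \<open>(x - p\<^sub>i)\<^bsup>m\<^sub>i\<^esup>\<close> over the finite part of the divisor on the
  component \<open>0\<close>; a conjugate set of geometric points contributes its minimal polynomial.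
\<close>

definition div_fun :: "'k::field_char_0 divisor \<Rightarrow> 'k \<Rightarrow> 'k" where
  "div_fun D t = (\<Prod>q | D (0, Fin q) \<noteq> 0. poly q t powi D (0, Fin q))"

definition matA ::
  "(nat \<Rightarrow> 'k poly fract) list \<Rightarrow> (nat \<Rightarrow> 'k pnt) \<Rightarrow> 'k divisor \<Rightarrow> 'k poly \<Rightarrow> nat \<Rightarrow> (nat \<Rightarrow> 'k) \<Rightarrow>
    'k::field_char_0 mat" where
  "matA Q q D K a \<kappa> = mat (length Q) a (\<lambda>(i, j).
     value_at (snd (q j)) ((Q ! i) (fst (q j))) * div_fun D (\<kappa> j) / poly (pderiv K) (\<kappa> j))"

definition matB ::
  "'k divisor \<Rightarrow> 'k poly \<Rightarrow> nat \<Rightarrow> (nat \<Rightarrow> 'k) \<Rightarrow> (nat \<Rightarrow> 'k) \<Rightarrow> 'k::field_char_0 mat" where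
  "matB D K b \<mu> \<nu> = mat b (2 * b) (\<lambda>(i, j).
     if j = 2 * i then div_fun D (\<mu> i) / poly (pderiv K) (\<mu> i)
     else if j = 2 * i + 1 then div_fun D (\<nu> i) / poly (pderiv K) (\<nu> i)
     else 0)"

definition soliton_matrix ::
  "(nat \<Rightarrow> 'k poly fract) list \<Rightarrow> (nat \<Rightarrow> 'k pnt) \<Rightarrow> 'k divisor \<Rightarrow> nat \<Rightarrow> nat \<Rightarrow>
    (nat \<Rightarrow> 'k) \<Rightarrow> (nat \<Rightarrow> 'k) \<Rightarrow> (nat \<Rightarrow> 'k) \<Rightarrow> 'k::field_char_0 mat" where
  "soliton_matrix Q q D a b \<kappa> \<mu> \<nu> =
     (let K = node_poly a b \<kappa> \<mu> \<nu> in
      four_block_mat (matA Q q D K a \<kappa>) (0\<^sub>m (length Q) (2 * b)) (0\<^sub>m b a) (matB D K b \<mu> \<nu>))"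

end

theory Submission
  imports Defs
begin

text \<open>
  The curve enters through its normalization: a section is a tuple of rational functions on
  projective lines, with bounded poles and equal values at the two branches of every node.

  The first cohomology is accessible because a repartition on the projective line can be
  approximated to any divisor of degree at least \<open>-1\<close> (\<open>repartition_approximation\<close>, by partial
  fractions), while a divisor of negative degree has no sections (\<open>no_sections_of_negative_degree\<close>).
  Suppose that on every component the degree is one less than the number of branches of nodes. Then
  both facts apply, in degree \<open>-1\<close>, to sections that vanish at all branches: \<open>H1\<close> is zero, and a
  section is determined by arbitrary common values at the nodes (\<open>riemann_roch_balanced\<close>).
  Changing a divisor by a rational point changes \<open>h0 - h1\<close> by one (\<open>riemann_roch_step\<close>), so the
  Riemann--Roch formula holds for all divisors, and the arithmetic genus is one minus the number of
  components plus the number of nodes.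

  For large \<open>n\<close> the divisor \<open>D + n p\<close> has so large a degree on the component of \<open>p\<close> that the values
  at all branches can be corrected there. So the obstruction to \<open>H1(X, D + n p) = 0\<close> is \<open>H1(X', D')\<close>
  (\<open>eventually_nonspecial_iff\<close>), and by Riemann--Roch on \<open>X'\<close> it vanishes exactly if
  \<open>length Q\<close> is the Euler characteristic of \<open>D'\<close>. A section with zero expansion at \<open>p\<close> vanishes on the
  component of \<open>p\<close>; it is a section on \<open>X'\<close> which is zero at the points of \<open>Z\<close>. This is the second
  equivalence (\<open>determined_by_laurent_iff\<close>).

  For the third part, multiply the restriction of a section to the component of \<open>p\<close> by the function
  whose divisor is the finite part of \<open>D\<close>. This gives a polynomial, and the conditions at the nodes
  say that its values at the parameters, divided by those of \<open>K'\<close>, form a vector in the row space of the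
  soliton matrix (\<open>component_sections_eq\<close>). On the other side, Lagrange interpolation shows that
  the soliton point consists of the same polynomials multiplied by \<open>x\<^sup>k / K\<close>
  (\<open>soliton_point_eq\<close>), where \<open>k\<close> is the number of rows and \<open>K\<close> vanishes at the parameters. So the
  two points differ by a Laurent series. By the genus formula its order is zero, so it is a gauge
  transformation (\<open>represents_soliton_if_degree\<close>). Finally, gauge transforms of soliton points are
  points of the Sato Grassmannian when the rows are independent, by comparing dimensions in
  the space of series with poles of order less than \<open>k\<close> (\<open>sato_grassmannian_criterion\<close>).
\<close>

section \<open>Quotients of vector spaces\<close>

context vector_space
begin

text \<open>
  A linear map with kernel \<open>W\<close> replaces the quotient by \<open>W\<close>: bases of \<open>V / W\<close> become bases of the
  image of \<open>V\<close>, to which the exchange lemma applies.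
\<close>

lemma exists_linear_with_kernel:
  assumes "subspace W"
  shows "\<exists>p. Vector_Spaces.linear scale scale p \<and> (\<forall>x. p x = 0 \<longleftrightarrow> x \<in> W)"
proof -
  interpret vp: vector_space_pair scale scale ..
  obtain B where B: "B \<subseteq> W" "independent B" "W \<subseteq> span B"
    using maximal_independent_subset[of W] by blast
  obtain C where C: "B \<subseteq> C" "independent C" "UNIV \<subseteq> span C"
    using maximal_independent_subset_extend[of B UNIV] B by auto
  have spanB: "span B = W" using B assms by (simp add: span_minimal subset_antisym)
  define f where "f x = (if x \<in> B then 0 else x)" for x
  define p where "p = vp.construct C f"
  have lin: "Vector_Spaces.linear scale scale p" unfolding p_def by (rule vp.linear_construct[OF C(2)])
  interpret p: Vector_Spaces.linear scale scale p by (rule lin)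
  have pb: "p x = f x" if "x \<in> C" for x unfolding p_def using vp.construct_basis[OF C(2) that] .
  have pC: "p x = x" if "x \<in> span (C - B)" for x
    using that by (induction rule: span_induct_alt) (auto simp: p.add p.scale p.zero pb f_def)
  have pB: "p x = 0" if "x \<in> span B" for x
    using that C(1) by (induction rule: span_induct_alt) (auto simp: p.add p.scale p.zero pb f_def subset_iff)
  have "p x = 0 \<longleftrightarrow> x \<in> W" for x
  proof
    assume x: "p x = 0"
    have "x \<in> span (B \<union> (C - B))" using C by (auto simp: Un_absorb1)
    then obtain u v where uv: "x = u + v" "u \<in> span B" "v \<in> span (C - B)"
      unfolding span_Un by blast
    then have "v = 0" using x pB pC by (simp add: p.add)
    then show "x \<in> W" using uv spanB by simp
  qed (use pB spanB in auto)
  then show ?thesis using lin by blast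
qed

lemma span_insert_scaled_sum:
  "span (insert a S) = {x. \<exists>k. \<exists>y\<in>span S. x = scale k a + y}"
  (is "?L = ?R")
proof (intro equalityI subsetI)
  fix x assume "x \<in> ?L"
  then obtain k where "x - scale k a \<in> span S" by (auto simp: span_insert)
  then show "x \<in> ?R" by (auto intro!: exI[of _ k] bexI[of _ "x - scale k a"])
next
  fix x assume "x \<in> ?R"
  then obtain k y where "y \<in> span S" "x = scale k a + y" by blast
  then have "x - scale k a \<in> span S" by simp
  then show "x \<in> ?L" by (auto simp: span_insert)
qed

lemma quotient_basis_iff_image:
  assumes lin: "Vector_Spaces.linear scale scale p" and ker: "\<And>x. p x = 0 \<longleftrightarrow> x \<in> W" and W: "subspace W"
  shows "quotient_basis scale V W B \<longleftrightarrow>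
    B \<subseteq> V \<and> inj_on p B \<and> independent (p ` B) \<and> p ` V \<subseteq> span (p ` B)"
proof -
  interpret p: Vector_Spaces.linear scale scale p by (rule lin)
  have sp: "V \<subseteq> span (B \<union> W) \<longleftrightarrow> p ` V \<subseteq> span (p ` B)" for V B
  proof -
    have "v \<in> span (B \<union> W) \<longleftrightarrow> p v \<in> span (p ` B)" for v
    proof
      assume "v \<in> span (B \<union> W)"
      then obtain u w where "v = u + w" "u \<in> span B" "w \<in> W" using W by (auto simp: span_Un span_eq_iff[THEN iffD2])
      then show "p v \<in> span (p ` B)" using ker[of w] by (simp add: p.add p.span_image)
    next
      assume "p v \<in> span (p ` B)"
      then obtain u where u: "u \<in> span B" "p v = p u" by (auto simp: p.span_image)
      then have "v - u \<in> W" using ker[of "v - u"] by (simp add: p.diff)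
      then have "u + (v - u) \<in> span (B \<union> W)"
        by (meson u(1) span_add span_mono span_superset Un_upper1 Un_upper2 subsetD)
      then show "v \<in> span (B \<union> W)" by simp
    qed
    then show ?thesis by auto
  qed
  have ind: "independent B \<and> span B \<inter> W = {0} \<longleftrightarrow> inj_on p B \<and> independent (p ` B)"
  proof
    assume *: "independent B \<and> span B \<inter> W = {0}"
    have inj: "inj_on p (span B)"
    proof (rule inj_onI)
      fix x y assume "x \<in> span B" "y \<in> span B" "p x = p y"
      then have "x - y \<in> span B \<inter> W" using ker[of "x-y"] by (simp add: p.diff span_diff)
      then show "x = y" using * by auto
    qed
    then show "inj_on p B \<and> independent (p ` B)"
      using * p.independent_injective_image inj_on_subset[OF inj span_superset] by blast
  next
    assume *: "inj_on p B \<and> independent (p ` B)"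
    have i: "independent B"
    proof
      assume "dependent B"
      then obtain b where b: "b \<in> B" "b \<in> span (B - {b})" by (auto simp: dependent_def)
      have "p ` (B - {b}) = p ` B - {p b}" using * b(1) by (auto simp: inj_on_def)
      then have "p b \<in> span (p ` B - {p b})" using b(2) p.span_image by (metis imageI)
      then show False using * b(1) by (auto simp: dependent_def)
    qed
    have inj: "inj_on p (span B)" using * p.inj_on_span_independent_image[of B] by simp
    have "x = 0" if "x \<in> span B" "x \<in> W" for x
      using inj_onD[OF inj, of x 0] that ker[of x] p.zero span_zero by simp
    then show "independent B \<and> span B \<inter> W = {0}" using i W by (auto simp: span_zero subspace_0)
  qed
  show ?thesis unfolding quotient_basis_def using sp[of V B] ind by (simp only: conj_assoc[symmetric])
qed

lemma quotient_basis_exists: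
  assumes W: "subspace W"
  shows "\<exists>B. quotient_basis scale V W B"
proof -
  obtain p where p: "Vector_Spaces.linear scale scale p" "\<And>x. p x = 0 \<longleftrightarrow> x \<in> W"
    using exists_linear_with_kernel[OF W] by blast
  obtain C where C: "C \<subseteq> p ` V" "independent C" "p ` V \<subseteq> span C"
    using maximal_independent_subset[of "p ` V"] by blast
  obtain B where "B \<subseteq> V" "inj_on p B" "C = p ` B" using C(1) subset_image_inj[of C p V] by metis
  then have "quotient_basis scale V W B" unfolding quotient_basis_iff_image[OF p W] using C by simp
  then show ?thesis ..
qed

lemma quotient_basis_card:
  assumes W: "subspace W" and B: "quotient_basis scale V W B" "finite B"
    and B': "quotient_basis scale V W B'"
  shows "finite B' \<and> card B' = card B"
proof -
  obtain p where p: "Vector_Spaces.linear scale scale p" "\<And>x. p x = 0 \<longleftrightarrow> x \<in> W"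
    using exists_linear_with_kernel[OF W] by blast
  note * = B(1)[unfolded quotient_basis_iff_image[OF p W]] B'[unfolded quotient_basis_iff_image[OF p W]]
  have "p ` B' \<subseteq> span (p ` B)" "p ` B \<subseteq> span (p ` B')"
    using * by (meson image_mono order_trans)+
  moreover have "finite (p ` B)" using B by simp
  ultimately have 1: "finite (p ` B') \<and> card (p ` B') \<le> card (p ` B)" 
    using independent_span_bound[of "p ` B" "p ` B'"] * by simp
  have "card (p ` B) \<le> card (p ` B')"
    using independent_span_bound[of "p ` B'" "p ` B"] 1 * \<open>p ` B \<subseteq> span (p ` B')\<close> by simp
  with 1 show ?thesis using * by (simp add: card_image finite_image_iff)
qed

lemma quotient_basis_empty_iff: 
  assumes "subspace W" shows "quotient_basis scale V W {} \<longleftrightarrow> V \<subseteq> W"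
proof -
  have sp: "span W = W" and "0 \<in> W" using assms subspace_0 by simp_all
  then show ?thesis unfolding quotient_basis_def by (simp add: independent_empty sp del: span_eq_iff)
qed

text \<open>
  This follows the first cohomology when the divisor changes by one point: a line added to the
  coboundaries takes one vector out of a basis of the quotient.
\<close>

lemma quotient_basis_insert:
  assumes W: "subspace W" and W': "W' = {x. \<exists>k. \<exists>y\<in>W. x = scale k s + y}"
    and s: "s \<notin> W" "s \<in> V" and B: "quotient_basis scale V W' B"
  shows "s \<notin> B \<and> quotient_basis scale V W (insert s B)"
proof -
  have W'sp: "W' = span (insert s W)"
  proof -
    have "span W = W" using W by simp
    then show ?thesis unfolding W' span_insert_scaled_sum by (rule ssubst) (rule refl)
  qed
  have sW': "s \<in> W'" using W'sp by (simp add: span_base)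
  have B1: "B \<subseteq> V" "independent B" "span B \<inter> W' = {0}" "V \<subseteq> span (B \<union> W')"
    using B by (auto simp: quotient_basis_def)
  have s0: "s \<noteq> 0" using s W subspace_0 by blast
  have sB: "s \<notin> span B" using B1(3) sW' s0 by blast
  have WW': "W \<subseteq> W'" using W'sp span_superset by blast
  have "x = 0" if x: "x \<in> span (insert s B)" "x \<in> W" for x
  proof -
    obtain k y where y: "x = scale k s + y" "y \<in> span B" using x by (auto simp: span_insert_scaled_sum)
    have "x - scale k s \<in> W'"
      using x(2) WW' sW' unfolding W'sp by (intro span_diff span_scale) auto
    then have y0: "y = 0" using y B1(3) by auto
    have "k = 0"
    proof (rule ccontr)
      assume "k \<noteq> 0"
      then have "s = scale (1/k) x" using y y0 by simp
      then show False using x(2) W s subspace_scale by metis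
    qed
    then show ?thesis using y y0 by simp
  qed
  moreover have "span (B \<union> W') \<subseteq> span (insert s B \<union> W)"
  proof (intro span_minimal subspace_span Un_least)
    show "B \<subseteq> span (insert s B \<union> W)" by (auto intro: span_base)
    show "W' \<subseteq> span (insert s B \<union> W)" unfolding W'sp by (intro span_mono) auto
  qed
  ultimately show ?thesis
    unfolding quotient_basis_def
    using B1 sB s W by (auto simp: independent_insertI span_superset[THEN subsetD] span_zero subspace_0)
qed

text \<open>
  Bases below come as families indexed by nodes or by rows; injectivity turns the size of the index
  set into a dimension.
\<close>

lemma independent_family:
  assumes "finite I" "\<And>k. (\<Sum>i\<in>I. scale (k i) (f i)) = 0 \<Longrightarrow> \<forall>i\<in>I. k i = 0"
  shows "inj_on f I \<and> independent (f ` I)"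
proof -
  have inj: "inj_on f I"
  proof (rule inj_onI, rule ccontr)
    fix i j assume ij: "i \<in> I" "j \<in> I" "f i = f j" "i \<noteq> j"
    define k where "k l = (if l = i then 1 else if l = j then -1 else 0 :: 'a)" for l
    have "(\<Sum>l\<in>I. scale (k l) (f l)) = (\<Sum>l\<in>{i,j}. scale (k l) (f l))"
      using assms(1) ij by (intro sum.mono_neutral_right) (auto simp: k_def)
    also have "\<dots> = 0" using ij by (auto simp: k_def)
    finally show False using assms(2)[of k] ij by (auto simp: k_def)
  qed
  have "independent (f ` I)"
  proof (rule independent_if_scalars_zero)
    fix k x assume *: "(\<Sum>x\<in>f ` I. scale (k x) x) = 0" "x \<in> f ` I"
    then have "(\<Sum>i\<in>I. scale (k (f i)) (f i)) = 0" using inj by (simp add: sum.reindex)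
    then show "k x = 0" using assms(2)[of "\<lambda>i. k (f i)"] * by auto
  qed (simp add: assms)
  with inj show ?thesis by simp
qed

lemma basis_card_unique:
  assumes "independent B" "finite B" "independent B'" "span B' = span B"
  shows "finite B' \<and> card B' = card B"
proof -
  have "B' \<subseteq> span B" "B \<subseteq> span B'" using assms(4) span_superset by blast+
  then have 1: "finite B' \<and> card B' \<le> card B" using independent_span_bound[of B B'] assms by simp
  then show ?thesis using independent_span_bound[of B' B] assms \<open>B \<subseteq> span B'\<close> by simp
qed

lemma independent_Un_if_spans_disjoint:
  assumes "finite B1" "independent B" "independent B1" "span B \<inter> span B1 = {0}"
  shows "independent (B \<union> B1)"
  using assms
proof (induction B1 rule: finite_induct)
  case (insert b C)
  have bC: "b \<notin> span C" "independent C" using insert.prems(2) insert.hyps(2) by (auto simp: independent_insert)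
  have sub: "span C \<subseteq> span (insert b C)" by (intro span_mono) auto
  have "span B \<inter> span C = {0}" using insert.prems(3) sub span_zero by blast
  then have ind: "independent (B \<union> C)" using insert bC by blast
  have "b \<notin> span (B \<union> C)"
  proof
    assume "b \<in> span (B \<union> C)"
    then obtain x y where xy: "b = x + y" "x \<in> span B" "y \<in> span C" unfolding span_Un by blast
    have "x = b - y" using xy by simp
    then have "x \<in> span (insert b C)" using xy(3) sub span_base[of b "insert b C"] span_diff by blast
    then have "x = 0" using xy(2) insert.prems(3) by blast
    then show False using xy bC by simp
  qed
  then show ?case using independent_insertI[OF _ ind] by simp
qed simp

end

section \<open>Local rings of the projective line\<close>

lemma const_0 [simp]: "const 0 = 0" by (simp add: const_def fract_collapse)
lemma const_1 [simp]: "const 1 = 1" by (simp add: const_simps)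
lemma const_diff: "const (a - b) = const a - const b"
  by (metis const_simps(1) diff_add_cancel add_diff_cancel_right')
lemma const_uminus: "const (- a) = - const a"
  by (metis const_diff const_0 diff_0)

lemma closed_places_Fin: "Fin q \<in> closed_places \<longleftrightarrow> irreducible q \<and> lead_coeff q = 1"
  by (auto simp: closed_places_def)

lemma closed_places_Fin_prime: "Fin q \<in> closed_places \<Longrightarrow> prime_elem q"
  by (auto simp: closed_places_Fin intro: field_poly_irreducible_imp_prime)

lemma Infty_closed [simp]: "Infty \<in> closed_places"
  by (simp add: closed_places_def)

lemma irreducible_linear: "irreducible [:- c, 1 :: 'a::field:]"
proof (rule irreducibleI)
  fix a b assume *: "[:- c, 1:] = a * b"
  then have "a \<noteq> 0" "b \<noteq> 0" by auto
  then have "degree a + degree b = 1" using arg_cong[OF *, of degree] by (simp add: degree_mult_eq)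
  then have "degree a = 0 \<or> degree b = 0" by linarith
  then show "a dvd 1 \<or> b dvd 1" using \<open>a \<noteq> 0\<close> \<open>b \<noteq> 0\<close> by (auto simp: is_unit_iff_degree)
qed (auto simp: is_unit_pCons_iff)

lemma aff_closed [simp]: "aff c \<in> closed_places"
  by (simp add: closed_places_Fin aff_def irreducible_linear)

lemma rational_places_closed: "y \<in> rational_places \<Longrightarrow> y \<in> closed_places"
  by (auto simp: rational_places_def)

lemma rational_places_degree: "y \<in> rational_places \<Longrightarrow> place_degree y = 1"
  by (auto simp: rational_places_def aff_def)

lemma uniformizer_nonzero: "y \<in> closed_places \<Longrightarrow> uniformizer y \<noteq> 0"
  by (cases y) (auto simp: closed_places_Fin Zero_fract_def eq_fract)

lemma Fract_in_local_ring_Fin: "\<not> q dvd d \<Longrightarrow> Fract n d \<in> local_ring (Fin q)"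
  by auto

lemma Fract_in_local_ring_Infty: "d \<noteq> 0 \<Longrightarrow> degree n \<le> degree d \<Longrightarrow> Fract n d \<in> local_ring Infty"
  by auto

lemma const_in_local_ring: "y \<in> closed_places \<Longrightarrow> const c \<in> local_ring y"
proof (cases y)
  case (Fin q)
  assume "y \<in> closed_places"
  then have "\<not> q dvd 1" using Fin by (auto simp: closed_places_Fin irreducible_def)
  then show ?thesis unfolding Fin local_ring.simps const_def by blast
qed (auto simp: const_def simp del: local_ring.simps intro: Fract_in_local_ring_Infty)

lemma local_ring_mult:
  assumes "y \<in> closed_places" "f \<in> local_ring y" "g \<in> local_ring y"
  shows "f * g \<in> local_ring y"
proof (cases y)
  case (Fin q)
  then obtain n d n' d' where *: "f = Fract n d" "\<not> q dvd d" "g = Fract n' d'" "\<not> q dvd d'"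
    using assms by auto
  then have "\<not> q dvd d * d'" using closed_places_Fin_prime[of q] assms(1) Fin by (simp add: prime_elem_dvd_mult_iff)
  then show ?thesis using * Fin by auto
next
  case Infty
  then obtain n d n' d' where *: "f = Fract n d" "d \<noteq> 0" "degree n \<le> degree d"
    "g = Fract n' d'" "d' \<noteq> 0" "degree n' \<le> degree d'"
    using assms by auto
  then have "degree (n * n') \<le> degree (d * d')" 
    by (metis (no_types) add_mono degree_mult_eq degree_mult_le order_trans)
  then show ?thesis using * Infty by (simp add: Fract_in_local_ring_Infty del: local_ring.simps)
qed

lemma local_ring_add:
  assumes "y \<in> closed_places" "f \<in> local_ring y" "g \<in> local_ring y"
  shows "f + g \<in> local_ring y"
proof (cases y)
  case (Fin q)
  then obtain n d n' d' where *: "f = Fract n d" "\<not> q dvd d" "g = Fract n' d'" "\<not> q dvd d'"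
    using assms by auto
  then have "\<not> q dvd d * d'" using closed_places_Fin_prime[of q] assms(1) Fin by (simp add: prime_elem_dvd_mult_iff)
  moreover have "d \<noteq> 0" "d' \<noteq> 0" using * by auto
  ultimately show ?thesis using * Fin by (simp add: Fract_in_local_ring_Fin del: local_ring.simps)
next
  case Infty
  then obtain n d n' d' where *: "f = Fract n d" "d \<noteq> 0" "degree n \<le> degree d"
    "g = Fract n' d'" "d' \<noteq> 0" "degree n' \<le> degree d'"
    using assms by auto
  then have "degree (n * d' + n' * d) \<le> degree (d * d')" 
    by (intro degree_add_le) (auto simp: degree_mult_eq intro: degree_mult_le[THEN order_trans])
  moreover have "f + g = Fract (n * d' + n' * d) (d * d')" using * by (auto simp: add_fract)
  ultimately show ?thesis using Infty * by (simp add: Fract_in_local_ring_Infty del: local_ring.simps)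
qed

lemma local_ring_0: "y \<in> closed_places \<Longrightarrow> 0 \<in> local_ring y"
  using const_in_local_ring[of y 0] by simp
lemma local_ring_1: "y \<in> closed_places \<Longrightarrow> 1 \<in> local_ring y"
  using const_in_local_ring[of y 1] by simp

lemma uniformizer_in_local_ring: "y \<in> closed_places \<Longrightarrow> uniformizer y \<in> local_ring y"
proof (cases y)
  case (Fin q)
  assume "y \<in> closed_places"
  then have "\<not> q dvd 1" using Fin by (auto simp: closed_places_Fin irreducible_def)
  then show ?thesis using Fin by auto
qed (simp add: Fract_in_local_ring_Infty del: local_ring.simps)

lemma local_ring_power: 
  assumes "y \<in> closed_places" "f \<in> local_ring y" shows "f ^ n \<in> local_ring y"
  by (induction n) (auto simp: local_ring_1 local_ring_mult assms)

lemma stalk_iff: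
  assumes "y \<in> closed_places"
  shows "f \<in> stalk e y \<longleftrightarrow> f * uniformizer y powi e \<in> local_ring y"
proof -
  have u: "uniformizer y \<noteq> 0" using uniformizer_nonzero[OF assms] .
  show ?thesis
  proof
    assume "f \<in> stalk e y"
    then show "f * uniformizer y powi e \<in> local_ring y"
      using u by (auto simp: stalk_def power_int_minus field_simps)
  next
    assume *: "f * uniformizer y powi e \<in> local_ring y"
    have "f = uniformizer y powi (- e) * (f * uniformizer y powi e)"
      using u by (simp add: power_int_minus)
    then show "f \<in> stalk e y" using * unfolding stalk_def by blast
  qed
qed

lemma stalk_0 [simp]: "stalk 0 y = local_ring y"
  by (auto simp: stalk_def)

lemma stalk_mult:
  assumes "y \<in> closed_places" "f \<in> stalk e y" "g \<in> stalk e' y"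
  shows "f * g \<in> stalk (e + e') y"
proof -
  have "(f * uniformizer y powi e) * (g * uniformizer y powi e') \<in> local_ring y"
    using assms(2,3) unfolding stalk_iff[OF assms(1)] by (rule local_ring_mult[OF assms(1)])
  moreover have "(f * uniformizer y powi e) * (g * uniformizer y powi e') = f * g * uniformizer y powi (e + e')"
    using uniformizer_nonzero[OF assms(1)] by (simp add: power_int_add algebra_simps)
  ultimately show ?thesis using assms(1) by (simp add: stalk_iff)
qed

lemma stalk_add:
  assumes "y \<in> closed_places" "f \<in> stalk e y" "g \<in> stalk e y"
  shows "f + g \<in> stalk e y"
  using assms local_ring_add[OF assms(1)] by (simp add: stalk_iff algebra_simps)

lemma stalk_const_mult:
  assumes "y \<in> closed_places" "f \<in> stalk e y"
  shows "const k * f \<in> stalk e y"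
  using stalk_mult[of y "const k" 0 f e] assms const_in_local_ring[OF assms(1), of k] by simp

lemma stalk_uminus:
  assumes "y \<in> closed_places" "f \<in> stalk e y" shows "- f \<in> stalk e y"
  using stalk_const_mult[OF assms, of "-1"] by (simp add: const_uminus)

lemma stalk_diff:
  assumes "y \<in> closed_places" "f \<in> stalk e y" "g \<in> stalk e y" shows "f - g \<in> stalk e y"
  using stalk_add[OF assms(1,2) stalk_uminus[OF assms(1,3)]] by simp

lemma stalk_zero: "y \<in> closed_places \<Longrightarrow> 0 \<in> stalk e y"
  using local_ring_0[of y] by (simp add: stalk_iff)

lemma uniformizer_power_in_stalk:
  assumes "y \<in> closed_places" "e \<le> e'"
  shows "uniformizer y powi (- e) \<in> stalk e' y"
proof -
  have "uniformizer y powi (- e) * uniformizer y powi e' = uniformizer y powi (e' - e)"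
    using uniformizer_nonzero[OF assms(1)] by (simp add: power_int_diff power_int_minus field_simps)
  also have "\<dots> = uniformizer y ^ nat (e' - e)" using assms by (simp add: power_int_def)
  finally show ?thesis
    using assms local_ring_power[OF assms(1) uniformizer_in_local_ring[OF assms(1)]] by (simp add: stalk_iff)
qed

lemma stalk_mono:
  assumes "y \<in> closed_places" "e \<le> e'"
  shows "stalk e y \<subseteq> stalk e' y"
proof
  fix f assume "f \<in> stalk e y"
  then obtain u where u: "f = uniformizer y powi (- e) * u" "u \<in> stalk 0 y" by (auto simp: stalk_def)
  then show "f \<in> stalk e' y"
    using stalk_mult[OF assms(1) uniformizer_power_in_stalk[OF assms] u(2)] by simp
qed

text \<open>
  Local generators of the sheaf of a divisor are powers of the uniformizer up to such units.
\<close>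

definition unit_at :: "'k::field_char_0 poly place \<Rightarrow> 'k poly fract \<Rightarrow> bool" where
  "unit_at y v \<longleftrightarrow> v \<noteq> 0 \<and> v \<in> local_ring y \<and> inverse v \<in> local_ring y"

lemma unit_at_mult:
  assumes "y \<in> closed_places" "unit_at y v" "unit_at y w" shows "unit_at y (v * w)"
  using assms local_ring_mult[OF assms(1)] by (simp add: unit_at_def)

lemma unit_at_power_int:
  assumes "y \<in> closed_places" "unit_at y v" shows "unit_at y (v powi k)"
  using assms local_ring_power[OF assms(1)] by (auto simp: unit_at_def power_int_def simp flip: power_inverse)

lemma unit_at_1: "y \<in> closed_places \<Longrightarrow> unit_at y 1"
  by (simp add: unit_at_def local_ring_1)

lemma stalk_mult_unit:
  assumes y: "y \<in> closed_places" and v: "unit_at y v"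
  shows "f * (uniformizer y powi k * v) \<in> stalk e y \<longleftrightarrow> f \<in> stalk (e + k) y"
proof -
  have u: "uniformizer y \<noteq> 0" using uniformizer_nonzero[OF y] .
  have "f * (uniformizer y powi k * v) * uniformizer y powi e = (f * uniformizer y powi (e + k)) * v"
    using u by (simp add: power_int_add)
  moreover have "g * v \<in> local_ring y \<longleftrightarrow> g \<in> local_ring y" for g
  proof
    assume "g * v \<in> local_ring y"
    then have "(g * v) * inverse v \<in> local_ring y" using v by (auto simp: unit_at_def intro: local_ring_mult[OF y])
    moreover have "(g * v) * inverse v = g" using v by (simp add: unit_at_def mult.assoc)
    ultimately show "g \<in> local_ring y" by simp
  next
    assume "g \<in> local_ring y"
    then show "g * v \<in> local_ring y" using v y by (intro local_ring_mult) (auto simp: unit_at_def)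
  qed
  ultimately show ?thesis by (simp only: stalk_iff[OF y])
qed

section \<open>Values at rational points\<close>

lemma has_value_in_local_ring:
  assumes "y \<in> closed_places" "has_value y f c" shows "f \<in> local_ring y"
proof -
  have "f - const c \<in> stalk 0 y" using assms stalk_mono[OF assms(1), of "-1" 0] by (auto simp: has_value_def)
  then show ?thesis using local_ring_add[OF assms(1) _ const_in_local_ring[OF assms(1)], of "f - const c" c] by simp
qed

lemma has_value_const: "y \<in> closed_places \<Longrightarrow> has_value y (const c) c"
  by (simp add: has_value_def stalk_zero)

lemma has_value_0_iff: "has_value y f 0 \<longleftrightarrow> f \<in> stalk (-1) y"
  by (simp add: has_value_def)

lemma has_value_add:
  assumes "y \<in> closed_places" "has_value y f c" "has_value y g d" shows "has_value y (f + g) (c + d)"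
  using stalk_add[OF assms(1), of "f - const c" "-1" "g - const d"] assms
  by (simp add: has_value_def const_simps algebra_simps)

lemma has_value_const_mult:
  assumes "y \<in> closed_places" "has_value y f c" shows "has_value y (const k * f) (k * c)"
  using stalk_const_mult[OF assms(1), of "f - const c" "-1" k] assms
  by (simp add: has_value_def const_simps algebra_simps)

lemma has_value_diff:
  assumes "y \<in> closed_places" "has_value y f c" "has_value y g d" shows "has_value y (f - g) (c - d)"
  using stalk_diff[OF assms(1), of "f - const c" "-1" "g - const d"] assms
  by (simp add: has_value_def const_diff algebra_simps)

lemma has_value_sum:
  assumes "y \<in> closed_places" "\<And>i. i \<in> I \<Longrightarrow> has_value y (f i) (c i)"
  shows "has_value y (\<Sum>i\<in>I. f i) (\<Sum>i\<in>I. c i)"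
  using assms(2) 
  by (induction I rule: infinite_finite_induct) (auto simp: has_value_add has_value_0_iff stalk_zero assms(1))

lemma has_value_mult:
  assumes "y \<in> closed_places" "has_value y f c" "has_value y g d" shows "has_value y (f * g) (c * d)"
proof -
  have "(f - const c) * g + const c * (g - const d) \<in> stalk (-1) y"
    using stalk_mult[OF assms(1), of "f - const c" "-1" g 0] stalk_const_mult[OF assms(1), of "g - const d" "-1" c]
      assms has_value_in_local_ring[OF assms(1,3)] by (auto intro!: stalk_add simp: has_value_def)
  then show ?thesis by (simp add: has_value_def const_simps algebra_simps)
qed

lemma value_at_eqI: "y \<in> closed_places \<Longrightarrow> has_value y f c \<Longrightarrow> value_at y f = c"
  unfolding value_at_def using has_value_unique by blast

lemma has_value_aff:
  assumes "poly d c \<noteq> 0"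
  shows "has_value (aff c) (Fract n d) (poly n c / poly d c)"
proof -
  have d: "d \<noteq> 0" "\<not> [:-c,1:] dvd d" using assms by (auto simp: poly_eq_0_iff_dvd)
  let ?v = "poly n c / poly d c"
  have "poly (n - Polynomial.smult ?v d) c = 0" using assms by simp
  then obtain m where m: "n - Polynomial.smult ?v d = [:-c,1:] * m" unfolding poly_eq_0_iff_dvd by (rule dvdE)
  have "Fract n d - const ?v = Fract (n - Polynomial.smult ?v d) d" using d by (simp add: const_def diff_fract)
  also have "\<dots> = Fract [:-c,1:] 1 * Fract m d" unfolding m by simp
  finally have "Fract n d - const ?v = uniformizer (aff c) powi (- (-1)) * Fract m d"
    by (simp add: aff_def)
  moreover have "Fract m d \<in> local_ring (aff c)"
    using d unfolding aff_def by (intro Fract_in_local_ring_Fin)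
  ultimately show ?thesis unfolding has_value_def stalk_def by blast
qed

lemma has_value_Infty:
  assumes "d \<noteq> 0" "degree n \<le> degree d"
  shows "has_value Infty (Fract n d) (coeff n (degree d) / lead_coeff d)"
proof -
  let ?v = "coeff n (degree d) / lead_coeff d"
  let ?m = "n - Polynomial.smult ?v d"
  have "coeff ?m (degree d) = 0" using assms by simp
  moreover have "degree ?m \<le> degree d" using assms by (intro degree_diff_le) auto
  ultimately have "?m = 0 \<or> degree ?m < degree d"
    by (metis le_neq_implies_less leading_coeff_0_iff)
  then have "degree ([:0,1:] * ?m) \<le> degree d" 
    by (auto simp: degree_mult_eq)
  moreover have "Fract n d - const ?v = Fract 1 [:0,1:] * Fract ([:0,1:] * ?m) d" 
    using assms by (simp add: const_def diff_fract eq_fract)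
  ultimately show ?thesis using assms unfolding has_value_def stalk_def by force
qed

text \<open>
  The residue field of a rational place is the ground field. In a fraction regular at \<open>Infty\<close> the value
  is the quotient of the coefficients in the degree of the denominator.
\<close>

lemma has_value_exists:
  assumes "y \<in> rational_places" "f \<in> local_ring y"
  shows "\<exists>c. has_value y f c"
proof (cases "y = Infty")
  case True
  then show ?thesis using assms has_value_Infty by auto
next
  case False
  then obtain c where c: "y = aff c" using assms by (auto simp: rational_places_def)
  then obtain n d where "f = Fract n d" "\<not> [:-c,1:] dvd d" using assms by (auto simp: aff_def)
  then show ?thesis using c has_value_aff[of d c n] by (auto simp: poly_eq_0_iff_dvd)
qed

section \<open>Sections and repartitions on the projective line\<close>

definition place_div_degree :: "('k::field_char_0 poly place \<Rightarrow> int) \<Rightarrow> int" where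
  "place_div_degree e = (\<Sum>y | e y \<noteq> 0. e y * int (place_degree y))"

definition place_divisor :: "('k::field_char_0 poly place \<Rightarrow> int) \<Rightarrow> bool" where
  "place_divisor e \<longleftrightarrow> finite {y. e y \<noteq> 0} \<and> {y. e y \<noteq> 0} \<subseteq> closed_places"

text \<open>
  A function with divisor \<open>e\<close> on the affine line. For the divisor \<open>D\<close> on the component of the marked
  point it is the polynomial \<open>P\<close> of the algorithm, or a quotient of polynomials if \<open>D\<close> is not
  effective.
\<close>

definition finite_part_function :: "('k::field_char_0 poly place \<Rightarrow> int) \<Rightarrow> 'k poly fract" where
  "finite_part_function e = (\<Prod>q | e (Fin q) \<noteq> 0. Fract q 1 powi e (Fin q))"

lemma place_div_degree_superset:
  assumes "finite S" "{y. e y \<noteq> 0} \<subseteq> S"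
  shows "place_div_degree e = (\<Sum>y\<in>S. e y * int (place_degree y))"
  unfolding place_div_degree_def using assms by (intro sum.mono_neutral_left) auto

lemma place_div_degree_add:
  assumes "place_divisor e" "place_divisor e'"
  shows "place_div_degree (\<lambda>y. e y + e' y) = place_div_degree e + place_div_degree e'"
proof -
  let ?S = "{y. e y \<noteq> 0} \<union> {y. e' y \<noteq> 0}"
  have f: "finite ?S" using assms by (simp add: place_divisor_def)
  have "place_div_degree (\<lambda>y. e y + e' y) = (\<Sum>y\<in>?S. (e y + e' y) * int (place_degree y))"
    by (intro place_div_degree_superset f) auto
  also have "\<dots> = (\<Sum>y\<in>?S. e y * int (place_degree y)) + (\<Sum>y\<in>?S. e' y * int (place_degree y))"
    by (simp add: algebra_simps sum.distrib)
  also have "\<dots> = place_div_degree e + place_div_degree e'"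
    using place_div_degree_superset[OF f, of e] place_div_degree_superset[OF f, of e'] by simp
  finally show ?thesis .
qed

lemma finite_fin_part: "place_divisor e \<Longrightarrow> finite {q. e (Fin q) \<noteq> 0}"
proof -
  assume "place_divisor e"
  then have "finite {y. e y \<noteq> 0}" by (simp add: place_divisor_def)
  moreover have "Fin ` {q. e (Fin q) \<noteq> 0} \<subseteq> {y. e y \<noteq> 0}" by auto
  ultimately have "finite (Fin ` {q. e (Fin q) \<noteq> 0})" by (rule finite_subset[rotated])
  then show ?thesis by (rule finite_imageD) (simp add: inj_on_def)
qed

lemma place_div_degree_split:
  assumes "place_divisor e"
  shows "place_div_degree e = (\<Sum>q | e (Fin q) \<noteq> 0. e (Fin q) * int (degree q)) + e Infty"
proof -
  let ?S = "insert Infty (Fin ` {q. e (Fin q) \<noteq> 0})"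
  have "place_div_degree e = (\<Sum>y\<in>?S. e y * int (place_degree y))"
  proof (rule place_div_degree_superset)
    show "{y. e y \<noteq> 0} \<subseteq> ?S"
    proof
      fix y assume "y \<in> {y. e y \<noteq> 0}"
      then show "y \<in> ?S" by (cases y) auto
    qed
  qed (simp add: finite_fin_part[OF assms])
  also have "\<dots> = e Infty + (\<Sum>y\<in>Fin ` {q. e (Fin q) \<noteq> 0}. e y * int (place_degree y))"
    using finite_fin_part[OF assms] by (subst sum.insert) auto
  also have "(\<Sum>y\<in>Fin ` {q. e (Fin q) \<noteq> 0}. e y * int (place_degree y)) = 
     (\<Sum>q | e (Fin q) \<noteq> 0. e (Fin q) * int (degree q))"
    by (subst sum.reindex) (auto simp: inj_on_def)
  finally show ?thesis by simp
qed

lemma monic_irreducible_dvd_imp_eq: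
  fixes p q :: "'k::field_char_0 poly"
  assumes p: "irreducible p" "lead_coeff p = 1" and q: "irreducible q" "lead_coeff q = 1"
    and dvd: "p dvd q"
  shows "p = q"
proof -
  obtain c where c: "q = p * c" using dvd by auto
  have "c dvd 1" using irreducibleD[OF q(1) c] p(1) by (auto simp: irreducible_def)
  then obtain k where k: "c = [:k:]" using is_unit_polyE by metis
  then have "lead_coeff q = lead_coeff p * k" using c by simp
  then have "k = 1" using p(2) q(2) by simp
  then show ?thesis using c k by simp
qed

lemma unit_at_Fract_Fin:
  assumes "irreducible q" "lead_coeff q = 1" "irreducible q'" "lead_coeff q' = 1" "q \<noteq> q'"
  shows "unit_at (Fin q') (Fract q 1)"
proof -
  have "q \<noteq> 0" "q' \<noteq> 0" using assms by auto
  have "\<not> q' dvd q" using monic_irreducible_dvd_imp_eq[OF assms(3,4,1,2)] assms(5) by auto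
  moreover have "\<not> q' dvd 1" using assms by (simp add: irreducible_not_unit)
  ultimately show ?thesis using \<open>q \<noteq> 0\<close>
    by (simp add: unit_at_def Fract_in_local_ring_Fin Zero_fract_def eq_fract del: local_ring.simps)
qed

lemma unit_at_prod:
  assumes "y \<in> closed_places" "\<And>i. i \<in> I \<Longrightarrow> unit_at y (v i)" shows "unit_at y (\<Prod>i\<in>I. v i)"
  using assms(2) by (induction I rule: infinite_finite_induct) (auto simp: unit_at_1 unit_at_mult assms(1))

lemma finite_part_function_at_Fin:
  assumes e: "place_divisor e" and q: "Fin q \<in> closed_places"
  shows "\<exists>v. unit_at (Fin q) v \<and> finite_part_function e = uniformizer (Fin q) powi e (Fin q) * v"
proof -
  let ?S = "{q. e (Fin q) \<noteq> 0}"
  let ?v = "\<Prod>p\<in>?S - {q}. Fract p 1 powi e (Fin p)"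
  have "unit_at (Fin q) ?v"
    using e q by (intro unit_at_prod unit_at_power_int unit_at_Fract_Fin) 
      (auto simp: place_divisor_def closed_places_def)
  moreover have "finite_part_function e = uniformizer (Fin q) powi e (Fin q) * ?v"
  proof (cases "q \<in> ?S")
    case True
    then show ?thesis unfolding finite_part_function_def using finite_fin_part[OF e]
      by (subst prod.remove) auto
  next
    case False
    then show ?thesis unfolding finite_part_function_def by simp
  qed
  ultimately show ?thesis by blast
qed

lemma Fract_at_Infty:
  assumes "q \<noteq> 0"
  shows "\<exists>v. unit_at Infty v \<and> Fract q 1 = uniformizer Infty powi (- int (degree q)) * v"
proof -
  let ?v = "Fract q (monom 1 (degree q))"
  have m: "monom 1 (degree q) \<noteq> (0 :: 'a poly)" by simp
  have "unit_at Infty ?v"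
    using assms m by (simp add: unit_at_def Fract_in_local_ring_Infty degree_monom_eq Zero_fract_def eq_fract del: local_ring.simps)
  moreover have "uniformizer Infty powi (- int (degree q)) = Fract (monom 1 (degree q)) (1::'a poly)"
  proof -
    have "Fract [:0,1:] 1 ^ n = Fract (monom 1 n) (1::'a poly)" for n
      by (induction n) (auto simp: One_fract_def monom_Suc monom_0 one_pCons)
    then show ?thesis by (simp add: power_int_minus power_inverse[symmetric] del: power_inverse)
  qed
  ultimately show ?thesis using m by (intro exI[of _ ?v]) (auto simp: eq_fract mult.commute)
qed

lemma finite_part_function_at_Infty:
  assumes e: "place_divisor e"
  shows "\<exists>v. unit_at Infty v \<and> finite_part_function e =
    uniformizer Infty powi (e Infty - place_div_degree e) * v"
proof -
  have *: "\<exists>v. unit_at Infty v \<and> (\<Prod>q\<in>S. Fract q 1 powi m q) =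
    uniformizer Infty powi (- (\<Sum>q\<in>S. m q * int (degree q))) * v" if "finite S" "0 \<notin> S"
    for S and m :: "'a poly \<Rightarrow> int"
    using that
  proof (induction S rule: finite_induct)
    case empty
    show ?case by (intro exI[of _ 1]) (simp add: unit_at_1)
  next
    case (insert q S)
    obtain v where v: "unit_at Infty v" "(\<Prod>q\<in>S. Fract q 1 powi m q) =
      uniformizer Infty powi (- (\<Sum>q\<in>S. m q * int (degree q))) * v" using insert by auto
    obtain w where w: "unit_at Infty w" "Fract q 1 = uniformizer Infty powi (- int (degree q)) * w"
      using Fract_at_Infty[of q] insert by auto
    have u: "uniformizer Infty \<noteq> (0 :: 'a poly fract)" using uniformizer_nonzero[OF Infty_closed] .
    have "Fract q 1 powi m q = uniformizer Infty powi (- (m q * int (degree q))) * w powi m q"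
      unfolding w(2) by (simp add: power_int_mult_distrib mult.commute flip: power_int_mult)
    then have "(\<Prod>q\<in>insert q S. Fract q 1 powi m q) = uniformizer Infty powi (- (m q * int (degree q))) * w powi m q *
       (uniformizer Infty powi (- (\<Sum>q\<in>S. m q * int (degree q))) * v)"
      using insert v by simp
    also have "\<dots> = (uniformizer Infty powi (- (m q * int (degree q))) * uniformizer Infty powi (- (\<Sum>q\<in>S. m q * int (degree q)))) * (w powi m q * v)"
      by (simp add: algebra_simps)
    also have "\<dots> = uniformizer Infty powi (- (\<Sum>q\<in>insert q S. m q * int (degree q))) * (w powi m q * v)"
      using insert u by (simp add: power_int_add[symmetric])
    finally show ?case using unit_at_mult[OF Infty_closed unit_at_power_int[OF Infty_closed w(1)] v(1)] by blast
  qed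
  have "0 \<notin> {q. e (Fin q) \<noteq> 0}" using e by (auto simp: place_divisor_def closed_places_def)
  from *[OF finite_fin_part[OF e] this, of "\<lambda>q. e (Fin q)"] show ?thesis
    unfolding finite_part_function_def place_div_degree_split[OF e] by simp
qed

text \<open>
  Multiplication by this function moves the whole divisor to \<open>Infty\<close>, where its degree is left. So
  statements on the projective line need a proof only for multiples of \<open>Infty\<close>.
\<close>

lemma stalk_times_finite_part_function:
  assumes e: "place_divisor e" and y: "y \<in> closed_places"
  shows "f \<in> stalk (e y) y \<longleftrightarrow>
    f * finite_part_function e \<in> stalk (if y = Infty then place_div_degree e else 0) y"
proof (cases y)
  case (Fin q)
  obtain v where v: "unit_at y v" "finite_part_function e = uniformizer y powi e y * v"
    using finite_part_function_at_Fin[OF e y[unfolded Fin]] unfolding Fin by auto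
  show ?thesis unfolding v(2) stalk_mult_unit[OF y v(1)] using Fin by simp
next
  case Infty
  obtain v where v: "unit_at y v" "finite_part_function e = uniformizer y powi (e y - place_div_degree e) * v"
    using finite_part_function_at_Infty[OF e] unfolding Infty by auto
  show ?thesis unfolding v(2) stalk_mult_unit[OF y v(1)] using Infty by simp
qed

lemma finite_part_function_nonzero:
  assumes e: "place_divisor e" shows "finite_part_function e \<noteq> 0"
  using finite_part_function_at_Infty[OF e] uniformizer_nonzero[OF Infty_closed]
  by (auto simp: unit_at_def)

text \<open>
  The places are given by monic polynomials, so the factor is normalized.
\<close>

lemma exists_monic_irreducible_factor:
  fixes d :: "'k::field poly"
  assumes "degree d > 0"
  shows "\<exists>q. irreducible q \<and> lead_coeff q = 1 \<and> q dvd d"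
  using assms
proof (induction "degree d" arbitrary: d rule: less_induct)
  case less
  then have d0: "d \<noteq> 0" by auto
  show ?case
  proof (cases "irreducible d")
    case True
    let ?q = "Polynomial.smult (inverse (lead_coeff d)) d"
    have "irreducible ?q"
    proof (rule irreducibleI)
      fix a b assume "?q = a * b"
      then have "Polynomial.smult (lead_coeff d) ?q = Polynomial.smult (lead_coeff d) a * b" by simp
      then have "d = Polynomial.smult (lead_coeff d) a * b" using d0 by simp
      from irreducibleD[OF True this] show "a dvd 1 \<or> b dvd 1" using d0 by (simp add: smult_dvd_iff)
    qed (use True d0 in \<open>auto simp: smult_dvd_iff irreducible_def\<close>)
    then show ?thesis using d0 by (intro exI[of _ ?q]) (auto simp: smult_dvd_iff)
  next
    case False
    then obtain a b where ab: "d = a * b" "\<not> a dvd 1" "\<not> b dvd 1"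
      using d0 less.prems by (auto simp: irreducible_def is_unit_iff_degree)
    then have "a \<noteq> 0" "b \<noteq> 0" using d0 by auto
    then have "degree a > 0" "degree a < degree d"
      using ab by (auto simp: is_unit_iff_degree degree_mult_eq)
    then obtain q where "irreducible q" "lead_coeff q = 1" "q dvd a" using less.hyps by blast
    then show ?thesis using ab by (auto intro: dvd_mult2)
  qed
qed

text \<open>
  An irreducible factor of the denominator is a place at which the function is regular, so it also divides the
  numerator. The cancellation lowers the degree of the denominator.
\<close>

lemma polynomial_if_regular_at_finite_places:
  assumes "\<And>q. Fin q \<in> closed_places \<Longrightarrow> f \<in> local_ring (Fin q)"
  shows "\<exists>n. f = Fract n 1"
proof -
  have "\<exists>n'. Fract n d = Fract n' 1" if "d \<noteq> 0" "f = Fract n d" for n d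
    using that
  proof (induction "degree d" arbitrary: n d rule: less_induct)
    case less
    show ?case
    proof (cases "degree d = 0")
      case True
      then obtain c where c: "d = [:c:]" by (auto elim: degree_eq_zeroE)
      then have "Fract n d = Fract (Polynomial.smult (inverse c) n) 1" using less by (simp add: eq_fract)
      then show ?thesis by blast
    next
      case False
      then obtain q where q: "irreducible q" "lead_coeff q = 1" "q dvd d"
        using exists_monic_irreducible_factor[of d] by auto
      then have qc: "Fin q \<in> closed_places" by (simp add: closed_places_Fin)
      obtain n' d' where nd': "f = Fract n' d'" "\<not> q dvd d'" using assms[OF qc] by auto
      then have "d' \<noteq> 0" by auto
      then have "n * d' = n' * d" using nd' less by (simp add: eq_fract)
      then have "q dvd n * d'" using q by simp
      then have "q dvd n" using nd' closed_places_Fin_prime[OF qc] by (simp add: prime_elem_dvd_mult_iff)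
      then obtain m where m: "n = q * m" by auto
      obtain d1 where d1: "d = q * d1" using q by auto
      have nz: "q \<noteq> 0" "d1 \<noteq> 0" using d1 less by auto
      have "degree q > 0" using q nz by (auto simp: irreducible_def is_unit_iff_degree)
      then have "degree d1 < degree d" using d1 nz by (simp add: degree_mult_eq)
      moreover have "Fract n d = Fract m d1" using m d1 nz by (simp add: eq_fract)
      ultimately show ?thesis using less nz by metis
    qed
  qed
  then show ?thesis by (cases f) auto
qed

lemma local_ring_Fin_polynomial: "Fin q \<in> closed_places \<Longrightarrow> Fract n 1 \<in> local_ring (Fin q)"
  by (rule Fract_in_local_ring_Fin) (auto simp: closed_places_Fin irreducible_def)

lemma Fract_in_stalk_Infty:
  fixes n d :: "'a::field_char_0 poly"
  assumes "n \<noteq> 0" "d \<noteq> 0"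
  shows "Fract n d \<in> stalk e Infty \<longleftrightarrow> int (degree n) \<le> int (degree d) + e"
proof -
  obtain v where v: "unit_at Infty v" "Fract n 1 = uniformizer Infty powi (- int (degree n)) * v"
    using Fract_at_Infty[OF assms(1)] by blast
  obtain w where w: "unit_at Infty w" "Fract d 1 = uniformizer Infty powi (- int (degree d)) * w"
    using Fract_at_Infty[OF assms(2)] by blast
  have u: "uniformizer Infty \<noteq> (0 :: 'a poly fract)" using uniformizer_nonzero[OF Infty_closed] .
  have w': "unit_at Infty (inverse w)" using w by (simp add: unit_at_def)
  have "Fract n d = Fract n 1 / Fract d 1" using assms by (simp add: divide_fract)
  also have "\<dots> = uniformizer Infty powi (int (degree d) - int (degree n)) * (v * inverse w)"
    unfolding v(2) w(2) using u by (simp add: power_int_diff power_int_minus field_simps)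
  finally have nd: "Fract n d = 1 * (uniformizer Infty powi (int (degree d) - int (degree n)) * (v * inverse w))" by simp
  have "Fract n d \<in> stalk e Infty \<longleftrightarrow> (1 :: 'a poly fract) \<in> stalk (e + (int (degree d) - int (degree n))) Infty"
    unfolding nd by (rule stalk_mult_unit[OF Infty_closed unit_at_mult[OF Infty_closed v(1) w']])
  also have "\<dots> \<longleftrightarrow> e + (int (degree d) - int (degree n)) \<ge> 0"
  proof
    assume *: "(1 :: 'a poly fract) \<in> stalk (e + (int (degree d) - int (degree n))) Infty"
    show "e + (int (degree d) - int (degree n)) \<ge> 0"
    proof (rule ccontr)
      assume "\<not> ?thesis"
      then have "const (1::'a) \<in> stalk (-1) Infty" using * stalk_mono[OF Infty_closed, of "e + (int (degree d) - int (degree n))" "-1"] by auto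
      then show False using const_in_stalk[OF Infty_closed] by fastforce
    qed
  next
    assume "e + (int (degree d) - int (degree n)) \<ge> 0"
    then show "(1 :: 'a poly fract) \<in> stalk (e + (int (degree d) - int (degree n))) Infty"
      using stalk_mono[OF Infty_closed, of 0 "e + (int (degree d) - int (degree n))"] local_ring_1[OF Infty_closed]
      by (auto simp del: local_ring.simps)
  qed
  finally show ?thesis by linarith
qed

text \<open>
  With the divisor moved to \<open>Infty\<close>, a section is a polynomial of negative degree.
\<close>

lemma no_sections_of_negative_degree:
  assumes e: "place_divisor e" "place_div_degree e < 0"
    and f: "\<And>y. y \<in> closed_places \<Longrightarrow> f \<in> stalk (e y) y"
  shows "f = 0"
proof -
  let ?F = "finite_part_function e"
  have "f * ?F \<in> local_ring (Fin q)" if "Fin q \<in> closed_places" for q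
    using stalk_times_finite_part_function[OF e(1) that, of f] f[OF that] by simp
  then obtain n where n: "f * ?F = Fract n 1" using polynomial_if_regular_at_finite_places by blast
  have "Fract n 1 \<in> stalk (place_div_degree e) Infty"
    using stalk_times_finite_part_function[OF e(1) Infty_closed, of f] f[OF Infty_closed] n by simp
  then have "n = 0" using Fract_in_stalk_Infty[of n 1 "place_div_degree e"] e(2) by fastforce
  then show ?thesis using n finite_part_function_nonzero[OF e(1)] by (simp add: Zero_fract_def[symmetric])
qed

text \<open>
  The identity of Bezout: a nonzero element of least degree in the ideal generated by \<open>q\<close> and \<open>m\<close>
  divides both.
\<close>

lemma inverse_modulo_irreducible:
  fixes q :: "'k::field_char_0 poly"
  assumes q: "irreducible q" and m: "\<not> q dvd m"
  shows "\<exists>b. q dvd b * m - 1"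
proof -
  define I where "I = {a * q + b * m | a b. True}"
  have "q \<in> I" unfolding I_def by (rule CollectI, rule exI[of _ 1], rule exI[of _ 0]) simp
  moreover have "q \<noteq> 0" using q by auto
  ultimately have "\<exists>g. g \<in> I \<and> g \<noteq> 0" by blast
  then obtain g where g: "g \<in> I" "g \<noteq> 0" "\<And>h. h \<in> I \<Longrightarrow> h \<noteq> 0 \<Longrightarrow> degree g \<le> degree h"
    using ex_has_least_nat[of "\<lambda>g. g \<in> I \<and> g \<noteq> 0" _ degree] by blast
  have dv: "g dvd h" if h: "h \<in> I" for h
  proof -
    obtain a b where "h = a * q + b * m" using h by (auto simp: I_def)
    moreover obtain c d where "g = c * q + d * m" using g(1) by (auto simp: I_def)
    ultimately    have "h mod g = (a * q + b * m) - h div g * (c * q + d * m)"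
      by (metis minus_div_mult_eq_mod)
    then have "h mod g = (a - (h div g) * c) * q + (b - (h div g) * d) * m"
      by (simp add: algebra_simps)
    then have "h mod g \<in> I" unfolding I_def by blast
    then have "h mod g = 0" using g(3)[of "h mod g"] degree_mod_less[OF g(2), of h] by force
    then show ?thesis by (simp add: dvd_eq_mod_eq_0)
  qed
  have "m \<in> I" unfolding I_def by (rule CollectI, rule exI[of _ 0], rule exI[of _ 1]) simp
  then have "g dvd m" "g dvd q" using dv \<open>q \<in> I\<close> by auto
  then have "\<not> q dvd g" using m dvd_trans by blast
  then have "g dvd 1" using \<open>g dvd q\<close> q by (metis irreducibleD')
  then obtain h where h: "1 = g * h" by auto
  obtain a b where "g = a * q + b * m" using g(1) by (auto simp: I_def)
  then have "(b * h) * m - 1 = q * (- a * h)" using h by (simp add: algebra_simps)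
  then show ?thesis by (intro exI[of _ "b * h"]) simp
qed

text \<open>
  The pole order is lowered one step at a time. The leading term of a pole of order \<open>k\<close> is
  \<open>w / q\<^sup>k\<close> with \<open>w\<close> reduced modulo \<open>q\<close>; it is regular at the other finite places and, because of the
  reduction, vanishes at \<open>Infty\<close>.
\<close>

lemma principal_part_exists:
  assumes q: "Fin q \<in> closed_places" and r: "r \<in> stalk (int k) (Fin q)"
  shows "\<exists>g. g - r \<in> local_ring (Fin q) \<and> 
    (\<forall>y\<in>closed_places. y \<noteq> Fin q \<longrightarrow> g \<in> stalk (if y = Infty then -1 else 0) y)"
  using r
proof (induction k arbitrary: r)
  case 0
  then show ?case using stalk_uminus[OF q, of r 0] by (intro exI[of _ 0]) (auto simp: stalk_zero simp del: local_ring.simps)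
next
  case (Suc k)
  have qi: "irreducible q" "lead_coeff q = 1" using q by (auto simp: closed_places_Fin)
  then have q0: "q \<noteq> 0" by auto
  have qd: "degree q > 0" using qi q0 by (auto simp: irreducible_def is_unit_iff_degree)
  obtain u where u: "r = uniformizer (Fin q) powi (- int (Suc k)) * u" "u \<in> local_ring (Fin q)"
    using Suc.prems by (auto simp: stalk_def simp del: local_ring.simps)
  then obtain n m where nm: "u = Fract n m" "\<not> q dvd m" by auto
  obtain b where b: "q dvd b * m - 1" using inverse_modulo_irreducible[OF qi(1) nm(2)] by blast
  define w where "w = (n * b) mod q"
  have wd: "w = 0 \<or> degree w < degree q" using degree_mod_less[OF q0] by (auto simp: w_def)
  have "w - n * b = q * (- (n * b div q))" unfolding w_def by (simp add: minus_mult_div_eq_mod[symmetric])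
  then have "q dvd w - n * b" by (rule dvdI)
  then have "q dvd (w - n * b) * m + n * (b * m - 1)" using b by (intro dvd_add dvd_mult dvd_mult2) auto
  then have "q dvd w * m - n" by (simp add: algebra_simps)
  then obtain t where t: "w * m - n = q * t" by auto
  have m0: "m \<noteq> 0" using nm by auto
  define g1 where "g1 = uniformizer (Fin q) powi (- int (Suc k)) * Fract w 1"
  have "Fract w 1 - u = Fract q 1 * Fract t m" using nm m0 t by (simp add: diff_fract)
  then have "r - g1 = - (uniformizer (Fin q) powi (- int (Suc k)) * (Fract q 1 * Fract t m))"
    unfolding u(1) g1_def by (simp add: algebra_simps)
  also have "\<dots> = uniformizer (Fin q) powi (- int k) * (- Fract t m)"
  proof -
    have "uniformizer (Fin q) powi (- int (Suc k)) * Fract q 1 = uniformizer (Fin q) powi (- int (Suc k) + 1)"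
      using uniformizer_nonzero[OF q] by (subst power_int_add) auto
    then have "uniformizer (Fin q) powi (- int (Suc k)) * Fract q 1 = uniformizer (Fin q) powi (- int k)" by simp
    then have "uniformizer (Fin q) powi (- int (Suc k)) * (Fract q 1 * Fract t m) =
      uniformizer (Fin q) powi (- int k) * Fract t m" by (simp only: mult.assoc[symmetric])
    then show ?thesis by (simp only: mult_minus_right)
  qed
  also have "\<dots> = uniformizer (Fin q) powi (- int k) * Fract (- t) m" by simp
  finally have "r - g1 \<in> stalk (int k) (Fin q)" using nm unfolding stalk_def by auto
  from Suc.IH[OF this] obtain g2 where g2: "g2 - (r - g1) \<in> local_ring (Fin q)"
    "\<And>y. y\<in>closed_places \<Longrightarrow> y \<noteq> Fin q \<Longrightarrow> g2 \<in> stalk (if y = Infty then -1 else 0) y" by blast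
  have g1F: "g1 = Fract w (q ^ Suc k)"
  proof -
    have "Fract q 1 ^ j = Fract (q ^ j) 1" for j by (induction j) (auto simp: One_fract_def)
    then have "uniformizer (Fin q) powi (- int (Suc k)) = inverse (Fract (q ^ Suc k) 1)"
      by (simp only: power_int_minus power_int_of_nat uniformizer.simps)
    then show ?thesis unfolding g1_def using q0 by simp
  qed
  have "g1 \<in> stalk (if y = Infty then -1 else 0) y" if y: "y \<in> closed_places" "y \<noteq> Fin q" for y
  proof (cases y)
    case Infty
    show ?thesis
    proof (cases "w = 0")
      case True
      then show ?thesis using y by (simp add: g1F Zero_fract_def[symmetric] stalk_zero eq_fract fract_collapse)
    next
      case False
      then have "degree w < degree (q ^ Suc k)" using wd q0 by (simp add: degree_power_eq degree_mult_eq)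
      then show ?thesis unfolding g1F Infty using False q0 by (subst if_P) (auto simp: Fract_in_stalk_Infty simp del: power_Suc)
    qed
  next
    case (Fin p)
    have pq: "p \<noteq> q" using y Fin by auto
    have p: "irreducible p" "lead_coeff p = 1" using y Fin by (auto simp: closed_places_Fin)
    have "prime_elem p" using closed_places_Fin_prime y Fin by blast
    moreover have "\<not> p dvd q" using monic_irreducible_dvd_imp_eq[OF p qi] pq by auto
    ultimately have "\<not> p dvd q ^ Suc k" using prime_elem_dvd_power by blast
    then show ?thesis unfolding g1F Fin by (simp add: Fract_in_local_ring_Fin del: local_ring.simps)
  qed
  then have "g1 + g2 \<in> stalk (if y = Infty then -1 else 0) y" if "y \<in> closed_places" "y \<noteq> Fin q" for y
    using stalk_add g2(2) that by blast
  moreover have "g1 + g2 - r = g2 - (r - g1)" by simp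
  ultimately show ?case using g2(1) by (intro exI[of _ "g1 + g2"]) metis
qed

lemma poly_split_power:
  fixes d q :: "'k::field poly"
  assumes "degree q > 0" "d \<noteq> 0"
  shows "\<exists>k m. d = q ^ k * m \<and> \<not> q dvd m"
  using assms(2)
proof (induction "degree d" arbitrary: d rule: less_induct)
  case less
  show ?case
  proof (cases "q dvd d")
    case True
    then obtain c where c: "d = q * c" by auto
    then have "c \<noteq> 0" "q \<noteq> 0" using less.prems by auto
    then have "degree c < degree d" using c assms(1) by (simp add: degree_mult_eq)
    then obtain k m where "c = q ^ k * m" "\<not> q dvd m" using less.hyps \<open>c \<noteq> 0\<close> by blast
    then show ?thesis using c by (intro exI[of _ "Suc k"] exI[of _ m]) (simp add: mult.assoc)
  next
    case False
    then show ?thesis by (intro exI[of _ 0] exI[of _ d]) simp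
  qed
qed

lemma partial_fractions:
  assumes "finite S" "Fin ` S \<subseteq> closed_places"
  shows "\<exists>g. (\<forall>q\<in>S. g - r q \<in> local_ring (Fin q)) \<and> 
    (\<forall>y\<in>closed_places. y \<notin> Fin ` S \<longrightarrow> g \<in> stalk (if y = Infty then -1 else 0) y)"
  using assms
proof (induction S rule: finite_induct)
  case empty
  then show ?case by (intro exI[of _ 0]) (auto simp: stalk_zero)
next
  case (insert q S)
  then obtain g where g: "\<And>p. p \<in> S \<Longrightarrow> g - r p \<in> local_ring (Fin p)"
    "\<And>y. y\<in>closed_places \<Longrightarrow> y \<notin> Fin ` S \<Longrightarrow> g \<in> stalk (if y = Infty then -1 else 0) y"
    using insert.IH insert.prems by (metis (no_types, lifting) image_insert insert_subset)
  have q: "Fin q \<in> closed_places" using insert by simp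
  have "\<exists>k. r q \<in> stalk (int k) (Fin q)"
  proof -
    obtain n d where nd: "r q = Fract n d" "d \<noteq> 0" by (cases "r q") auto
    have qi: "irreducible q" using q by (auto simp: closed_places_Fin)
    then have "degree q > 0" by (auto simp: irreducible_def is_unit_iff_degree)
    then obtain k m where m: "d = q ^ k * m" "\<not> q dvd m"
      using poly_split_power nd(2) by blast
    have "q \<noteq> 0" using qi by auto
    have "Fract q 1 ^ j = Fract (q ^ j) 1" for j by (induction j) (auto simp: One_fract_def)
    then have "r q = uniformizer (Fin q) powi (- int k) * Fract n m"
      using nd m \<open>q \<noteq> 0\<close> by (simp add: power_int_minus)
    then show ?thesis using m unfolding stalk_def by auto
  qed
  then obtain k where "r q \<in> stalk (int k) (Fin q)" by blast
  from principal_part_exists[OF q this] obtain h where h: "h - r q \<in> local_ring (Fin q)"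
    "\<And>y. y\<in>closed_places \<Longrightarrow> y \<noteq> Fin q \<Longrightarrow> h \<in> stalk (if y = Infty then -1 else 0) y" by blast
  have "g + h - r p \<in> local_ring (Fin p)" if "p \<in> insert q S" for p
  proof (cases "p = q")
    case True
    have "g + (h - r q) \<in> local_ring (Fin q)" using g(2)[OF q] h(1) insert
      by (intro local_ring_add[OF q]) auto
    then show ?thesis using True by (simp add: algebra_simps del: local_ring.simps)
  next
    case False
    then have p: "p \<in> S" "Fin p \<in> closed_places" using that insert by auto
    then have "(g - r p) + h \<in> local_ring (Fin p)" using g(1)[OF p(1)] h(2)[OF p(2)] False
      by (intro local_ring_add[OF p(2)]) auto
    then show ?thesis by (simp add: algebra_simps del: local_ring.simps)
  qed
  moreover have "g + h \<in> stalk (if y = Infty then -1 else 0) y" if "y \<in> closed_places" "y \<notin> Fin ` insert q S" for y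
    using that g(2)[of y] h(2)[of y] by (intro stalk_add) auto
  ultimately show ?case by blast
qed

text \<open>
  The first cohomology of the projective line vanishes in degree at least \<open>-1\<close>. After moving the
  divisor to \<open>Infty\<close>, the sum of the principal parts takes care of the finite places, and adding a
  polynomial leaves an error at \<open>Infty\<close> that vanishes there, which degree \<open>-1\<close> tolerates.
\<close>

lemma repartition_approximation:
  fixes e :: "'k::field_char_0 poly place \<Rightarrow> int"
  assumes e: "place_divisor e" "place_div_degree e \<ge> -1"
    and r: "finite {y \<in> closed_places. r y \<notin> local_ring y}"
  shows "\<exists>f. \<forall>y\<in>closed_places. f - r y \<in> stalk (e y) y"
proof -
  let ?F = "finite_part_function e"
  define S where "S = {q. Fin q \<in> closed_places \<and> r (Fin q) * ?F \<notin> local_ring (Fin q)}"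
  have "Fin ` S \<subseteq> {y \<in> closed_places. r y \<notin> local_ring y} \<union> {y. e y \<noteq> 0}"
  proof
    fix y assume "y \<in> Fin ` S"
    then obtain q where q: "y = Fin q" "q \<in> S" by auto
    then have qc: "Fin q \<in> closed_places" by (simp add: S_def)
    have "r (Fin q) \<notin> local_ring (Fin q)" if "e (Fin q) = 0"
      using stalk_times_finite_part_function[OF e(1) qc, of "r (Fin q)"] q that by (simp add: S_def)
    then show "y \<in> {y \<in> closed_places. r y \<notin> local_ring y} \<union> {y. e y \<noteq> 0}" using qc q by blast
  qed
  then have "finite (Fin ` S)" by (rule finite_subset) (use r e(1) in \<open>simp add: place_divisor_def\<close>)
  then have "finite S" by (rule finite_imageD) (simp add: inj_on_def)
  moreover have "Fin ` S \<subseteq> closed_places" by (auto simp: S_def)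
  ultimately obtain g where g: "\<And>q. q \<in> S \<Longrightarrow> g - r (Fin q) * ?F \<in> local_ring (Fin q)"
    "\<And>y. y\<in>closed_places \<Longrightarrow> y \<notin> Fin ` S \<Longrightarrow> g \<in> stalk (if y = Infty then -1 else 0) y"
    using partial_fractions[of S "\<lambda>q. r (Fin q) * ?F"] by blast
  obtain n d where nd: "r Infty * ?F - g = Fract n d" "d \<noteq> 0" by (cases "r Infty * ?F - g") auto
  let ?h = "Fract (n div d) 1"
  have "Fract n d - ?h = Fract (n mod d) d" using nd(2)
    by (simp add: diff_fract minus_div_mult_eq_mod)
  moreover have "Fract (n mod d) d \<in> stalk (-1) Infty"
  proof (cases "n mod d = 0")
    case True
    then show ?thesis using stalk_zero[OF Infty_closed] by (simp add: fract_collapse)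
  next
    case False
    then show ?thesis using nd(2) degree_mod_less[OF nd(2), of n] by (simp add: Fract_in_stalk_Infty)
  qed
  ultimately have inf: "Fract n d - ?h \<in> stalk (-1) Infty" by simp
  define f where "f = (g + ?h) / ?F"
  have F0: "?F \<noteq> 0" using finite_part_function_nonzero[OF e(1)] .
  have fF: "(f - s) * ?F = g + ?h - s * ?F" for s unfolding f_def using F0 by (simp add: field_simps)
  have "f - r y \<in> stalk (e y) y" if y: "y \<in> closed_places" for y
  proof (cases y)
    case (Fin q)
    have "g - r y * ?F \<in> local_ring y"
    proof (cases "q \<in> S")
      case True
      then show ?thesis using g(1) Fin by simp
    next
      case False
      then have "r y * ?F \<in> local_ring y" using y Fin by (auto simp: S_def)
      moreover have "g \<in> local_ring y" using g(2)[OF y] False Fin by auto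
      ultimately show ?thesis using stalk_diff[OF y, of g 0 "r y * ?F"] by simp
    qed
    moreover have "?h \<in> local_ring y" using local_ring_Fin_polynomial y unfolding Fin by blast
    ultimately have "(g - r y * ?F) + ?h \<in> local_ring y" by (rule local_ring_add[OF y])
    then have "(f - r y) * ?F \<in> local_ring y" unfolding fF by (simp add: algebra_simps del: local_ring.simps)
    then show ?thesis using stalk_times_finite_part_function[OF e(1) y, of "f - r y"] Fin by simp
  next
    case Infty
    have "(f - r Infty) * ?F = - (Fract n d - ?h)" unfolding fF nd(1)[symmetric] by simp
    then have "(f - r Infty) * ?F \<in> stalk (-1) Infty" using stalk_uminus[OF Infty_closed inf] by simp
    then have "(f - r Infty) * ?F \<in> stalk (place_div_degree e) Infty"
      using stalk_mono[OF Infty_closed e(2)] by blast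
    then show ?thesis using stalk_times_finite_part_function[OF e(1) y, of "f - r y"] Infty by simp
  qed
  then show ?thesis by blast
qed

section \<open>Points, germs, and repartitions of a nodal curve\<close>

definition branches :: "'k::field_char_0 curve \<Rightarrow> nat \<Rightarrow> 'k poly place set" where
  "branches Y c = {y. (c, y) \<in> \<Union>(nodes Y)}"

lemma nodal_curveD:
  assumes "nodal_curve Y"
  shows "finite (comps Y)" "finite (nodes Y)" "x \<in> nodes Y \<Longrightarrow> card x = 2"
    "x \<in> nodes Y \<Longrightarrow> (c, y) \<in> x \<Longrightarrow> c \<in> comps Y \<and> y \<in> rational_places"
    "x \<in> nodes Y \<Longrightarrow> x' \<in> nodes Y \<Longrightarrow> u \<in> x \<Longrightarrow> u \<in> x' \<Longrightarrow> x = x'"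
  using assms unfolding nodal_curve_def pairwise_def disjnt_def by (auto, blast+)

lemma points_closed:
  assumes "nodal_curve Y" "x \<in> points Y" "(c, y) \<in> x"
  shows "c \<in> comps Y" "y \<in> closed_places"
  using assms nodal_curveD(4)[OF assms(1)] rational_places_closed[of y]
  unfolding points_def smooth_points_def by fastforce+

lemma smooth_point_in_points: "u \<in> smooth_points Y \<Longrightarrow> {u} \<in> points Y"
  by (auto simp: points_def)

lemma node_not_smooth: "x \<in> nodes Y \<Longrightarrow> u \<in> x \<Longrightarrow> u \<notin> smooth_points Y"
  by (auto simp: smooth_points_def)

lemma point_eq_singleton:
  assumes "x \<in> points Y" "u \<in> x" "u \<in> smooth_points Y" shows "x = {u}"
  using assms node_not_smooth unfolding points_def by fastforce

lemma singleton_not_node: "nodal_curve Y \<Longrightarrow> {u} \<notin> nodes Y"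
  using nodal_curveD(3) by fastforce

lemma divisor_on_node: "divisor_on Y E \<Longrightarrow> x \<in> nodes Y \<Longrightarrow> u \<in> x \<Longrightarrow> E u = 0"
  using node_not_smooth unfolding divisor_on_def by fastforce

lemma divisor_on_place_divisor:
  assumes "divisor_on Y E" shows "place_divisor (\<lambda>y. E (c, y))"
proof -
  have "finite (snd ` {u. E u \<noteq> 0})" using assms by (simp add: divisor_on_def)
  then have "finite {y. E (c, y) \<noteq> 0}" by (rule finite_subset[rotated]) force
  then show ?thesis using assms by (auto simp: place_divisor_def divisor_on_def smooth_points_def)
qed

lemma branches_finite: "nodal_curve Y \<Longrightarrow> finite (branches Y c)"
proof -
  assume Y: "nodal_curve Y"
  have "finite x" if "x \<in> nodes Y" for x using nodal_curveD(3)[OF Y that] card.infinite by fastforce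
  then have "finite (\<Union>(nodes Y))" using nodal_curveD(2)[OF Y] by blast
  then have "finite (snd ` \<Union>(nodes Y))" by simp
  then show ?thesis by (rule finite_subset[rotated]) (force simp: branches_def)
qed

lemma branches_rational: "nodal_curve Y \<Longrightarrow> branches Y c \<subseteq> rational_places"
  using nodal_curveD(4) by (fastforce simp: branches_def)

lemma smooth_iff_not_branch:
  "(c, y) \<in> smooth_points Y \<longleftrightarrow> c \<in> comps Y \<and> y \<in> closed_places \<and> y \<notin> branches Y c"
  by (auto simp: smooth_points_def branches_def)

text \<open>
  Sections that vanish at all branches of a component belong to this divisor.
\<close>

lemma divisor_minus_branches:
  fixes c :: nat
  assumes Y: "nodal_curve Y" and E: "divisor_on Y E"
  shows "place_divisor (\<lambda>y. E (c, y) - of_bool (y \<in> branches Y c))"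
    "place_div_degree (\<lambda>y. E (c, y) - of_bool (y \<in> branches Y c)) =
      place_div_degree (\<lambda>y. E (c, y)) - int (card (branches Y c))"
proof -
  let ?B = "branches Y c"
  define ind where "ind y = (if y \<in> ?B then -1 else 0 :: int)" for y
  have ind: "{y. ind y \<noteq> 0} = ?B" by (auto simp: ind_def)
  have pd: "place_divisor ind" unfolding place_divisor_def ind
    using branches_finite[OF Y] branches_rational[OF Y, of c] rational_places_closed by blast
  have "place_div_degree ind = (\<Sum>y\<in>?B. -1)"
    unfolding place_div_degree_def ind using branches_rational[OF Y, of c]
    by (intro sum.cong) (auto simp: ind_def rational_places_degree subset_iff)
  then have dind: "place_div_degree ind = - int (card ?B)" by simp
  have e: "(\<lambda>y. E (c, y) - of_bool (y \<in> ?B)) = (\<lambda>y. E (c, y) + ind y)" by (auto simp: ind_def)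
  note pE = divisor_on_place_divisor[OF E, of c]
  have "{y. E (c, y) + ind y \<noteq> 0} \<subseteq> {y. E (c, y) \<noteq> 0} \<union> {y. ind y \<noteq> 0}" by auto
  then show "place_divisor (\<lambda>y. E (c, y) - of_bool (y \<in> ?B))"
    unfolding e using pE pd unfolding place_divisor_def by (meson Un_least finite_UnI finite_subset order_trans)
  show "place_div_degree (\<lambda>y. E (c, y) - of_bool (y \<in> ?B)) = place_div_degree (\<lambda>y. E (c, y)) - int (card ?B)"
    unfolding e place_div_degree_add[OF pE pd] dind by simp
qed

lemma germs_add:
  assumes Y: "nodal_curve Y" "x \<in> points Y" and "f \<in> germs Y E x" "g \<in> germs Y E x"
  shows "f + g \<in> germs Y E x"
proof -
  have cl: "y \<in> closed_places" if "(c, y) \<in> x" for c y using points_closed[OF Y that] by simp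
  have "(f + g) c \<in> stalk (E (c, y)) y" if "(c, y) \<in> x" for c y
    using assms(3,4) that cl[OF that] by (auto simp: germs_def intro!: stalk_add)
  moreover have "\<exists>v. \<forall>(c, y)\<in>x. has_value y ((f + g) c) v" if "x \<in> nodes Y"
  proof -
    obtain v w where "\<forall>(c, y)\<in>x. has_value y (f c) v" "\<forall>(c, y)\<in>x. has_value y (g c) w"
      using assms(3,4) \<open>x \<in> nodes Y\<close> by (auto simp: germs_def)
    then have "\<forall>(c, y)\<in>x. has_value y ((f + g) c) (v + w)" using cl has_value_add by fastforce
    then show ?thesis by blast
  qed
  ultimately show ?thesis by (auto simp: germs_def)
qed

lemma germs_scale:
  assumes Y: "nodal_curve Y" "x \<in> points Y" and "f \<in> germs Y E x"
  shows "sec_scale k f \<in> germs Y E x"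
proof -
  have cl: "y \<in> closed_places" if "(c, y) \<in> x" for c y using points_closed[OF Y that] by simp
  have "sec_scale k f c \<in> stalk (E (c, y)) y" if "(c, y) \<in> x" for c y
    using assms(3) that cl[OF that] by (auto simp: germs_def sec_scale_def intro!: stalk_const_mult)
  moreover have "\<exists>v. \<forall>(c, y)\<in>x. has_value y (sec_scale k f c) v" if "x \<in> nodes Y"
  proof -
    obtain v where "\<forall>(c, y)\<in>x. has_value y (f c) v"
      using assms(3) \<open>x \<in> nodes Y\<close> by (auto simp: germs_def)
    then have "\<forall>(c, y)\<in>x. has_value y (sec_scale k f c) (k * v)" using cl has_value_const_mult 
      by (fastforce simp: sec_scale_def)
    then show ?thesis by blast
  qed
  ultimately show ?thesis by (auto simp: germs_def)
qed

lemma germs_0: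
  assumes Y: "nodal_curve Y" "x \<in> points Y" shows "0 \<in> germs Y E x"
proof -
  have cl: "y \<in> closed_places" if "(c, y) \<in> x" for c y using points_closed[OF Y that] by simp
  then have "\<forall>(c, y)\<in>x. has_value y 0 0" by (auto simp: has_value_0_iff stalk_zero)
  then show ?thesis using cl by (auto simp: germs_def stalk_zero)
qed

lemma subspace_adeles_bounded: "nodal_curve Y \<Longrightarrow> adele.subspace (adeles_bounded Y E)"
  by (auto simp: adele.subspace_def adeles_bounded_def germs_add germs_scale germs_0 adele_scale_def)

lemma subspace_adeles:
  assumes "nodal_curve Y" shows "adele.subspace (adeles Y)"
proof (rule adele.subspaceI)
  show "0 \<in> adeles Y" using assms by (simp add: adeles_def germs_0 cong: conj_cong)
next
  fix r s assume "r \<in> adeles Y" "s \<in> adeles Y"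
  then have "finite ({x \<in> points Y. r x \<notin> germs Y (\<lambda>_. 0) x} \<union> {x \<in> points Y. s x \<notin> germs Y (\<lambda>_. 0) x})"
    by (simp add: adeles_def)
  then have "finite {x \<in> points Y. (r + s) x \<notin> germs Y (\<lambda>_. 0) x}"
    by (rule finite_subset[rotated]) (auto simp: germs_add[OF assms])
  then show "r + s \<in> adeles Y" by (simp add: adeles_def)
next
  fix k r assume "r \<in> adeles Y"
  then have "finite {x \<in> points Y. r x \<notin> germs Y (\<lambda>_. 0) x}" by (simp add: adeles_def)
  then have "finite {x \<in> points Y. adele_scale k r x \<notin> germs Y (\<lambda>_. 0) x}"
    by (rule finite_subset[rotated]) (auto simp: germs_scale[OF assms] adele_scale_def)
  then show "adele_scale k r \<in> adeles Y" by (simp add: adeles_def)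
qed

lemma subspace_rational_functions: "sec.subspace (rational_functions Y)"
  by (auto simp: sec.subspace_def rational_functions_def sec_scale_def)

lemma H0_eq: "H0 Y E = {f \<in> rational_functions Y. (\<lambda>x. f) \<in> adeles_bounded Y E}"
  by (simp add: H0_def adeles_bounded_def)

lemma diagonal_add: "(\<lambda>x. f + g) = (\<lambda>x. f) + (\<lambda>x. g)"
  by (simp add: fun_eq_iff)

lemma diagonal_scale: "(\<lambda>x. sec_scale k f) = adele_scale k (\<lambda>x. f)"
  by (simp add: adele_scale_def)

lemma subspace_H0: "nodal_curve Y \<Longrightarrow> sec.subspace (H0 Y E)"
  using subspace_rational_functions[of Y] subspace_adeles_bounded[of Y E]
  unfolding H0_eq sec.subspace_def adele.subspace_def 
  by (auto simp: diagonal_add diagonal_scale zero_fun_def)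

lemma subspace_coboundaries:
  assumes "nodal_curve Y" shows "adele.subspace (coboundaries Y E)"
proof (rule adele.subspaceI)
  note R = subspace_rational_functions[of Y] and A = subspace_adeles_bounded[OF assms, of E]
  have "0 = (\<lambda>x. 0) + (0 :: 'a pnt set \<Rightarrow> nat \<Rightarrow> 'a poly fract)" by (simp add: fun_eq_iff)
  then show "0 \<in> coboundaries Y E" 
    unfolding coboundaries_def using sec.subspace_0[OF R] adele.subspace_0[OF A] by blast
next
  note R = subspace_rational_functions[of Y] and A = subspace_adeles_bounded[OF assms, of E]
  fix r s assume "r \<in> coboundaries Y E" "s \<in> coboundaries Y E"
  then obtain f a g b where *: "r = (\<lambda>x. f) + a" "s = (\<lambda>x. g) + b" "f \<in> rational_functions Y"
    "g \<in> rational_functions Y" "a \<in> adeles_bounded Y E" "b \<in> adeles_bounded Y E"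
    by (auto simp: coboundaries_def)
  have "r + s = (\<lambda>x. f + g) + (a + b)" unfolding * by (simp add: fun_eq_iff)
  then show "r + s \<in> coboundaries Y E" unfolding coboundaries_def
    using sec.subspace_add[OF R *(3,4)] adele.subspace_add[OF A *(5,6)] by blast
next
  note R = subspace_rational_functions[of Y] and A = subspace_adeles_bounded[OF assms, of E]
  fix k r assume "r \<in> coboundaries Y E"
  then obtain f a where *: "r = (\<lambda>x. f) + a" "f \<in> rational_functions Y" "a \<in> adeles_bounded Y E"
    by (auto simp: coboundaries_def)
  have "adele_scale k r = (\<lambda>x. sec_scale k f) + adele_scale k a"
    unfolding * by (simp add: fun_eq_iff adele_scale_def sec_scale_def algebra_simps)
  then show "adele_scale k r \<in> coboundaries Y E" unfolding coboundaries_def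
    using sec.subspace_scale[OF R *(2)] adele.subspace_scale[OF A *(3)] by blast
qed

section \<open>Approximation of repartitions on one component\<close>

text \<open>
  The values \<open>v\<close> are prescribed by adding constants to the repartition at the branches and then
  asking for zeros there; the zeros cost one degree for every branch.
\<close>

lemma component_approximation:
  assumes Y: "nodal_curve Y" and E: "divisor_on Y E" and r: "r \<in> adeles Y" and c: "c \<in> comps Y"
    and deg: "place_div_degree (\<lambda>y. E (c, y)) \<ge> int (card (branches Y c)) - 1"
  shows "\<exists>f. (\<forall>y. (c, y) \<in> smooth_points Y \<longrightarrow> f - r {(c, y)} c \<in> stalk (E (c, y)) y) \<and>
    (\<forall>x\<in>nodes Y. \<forall>y. (c, y) \<in> x \<longrightarrow> has_value y (f - r x c) (v y))"
proof -
  let ?B = "branches Y c"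
  define node where "node y = (SOME x. x \<in> nodes Y \<and> (c, y) \<in> x)" for y
  have node: "node y = x" if "x \<in> nodes Y" "(c, y) \<in> x" for x y
    using that nodal_curveD(5)[OF Y] someI[of "\<lambda>x. x \<in> nodes Y \<and> (c, y) \<in> x" x]
    unfolding node_def by metis
  define e where "e y = E (c, y) - of_bool (y \<in> ?B)" for y
  have pe: "place_divisor e" and de: "place_div_degree e \<ge> -1"
    using divisor_minus_branches[OF Y E, of c] deg unfolding e_def[symmetric] by auto
  define s where "s y = (if y \<in> ?B then r (node y) c + const (v y) else r {(c, y)} c)" for y
  have "{y \<in> closed_places. s y \<notin> local_ring y} \<subseteq> ?B \<union> {y. {(c, y)} \<in> {x \<in> points Y. r x \<notin> germs Y (\<lambda>_. 0) x}}"
  proof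
    fix y assume y: "y \<in> {y \<in> closed_places. s y \<notin> local_ring y}"
    have "r {(c, y)} \<notin> germs Y (\<lambda>_. 0) {(c, y)}" if "y \<notin> ?B"
      using y that by (auto simp: s_def germs_def)
    then show "y \<in> ?B \<union> {y. {(c, y)} \<in> {x \<in> points Y. r x \<notin> germs Y (\<lambda>_. 0) x}}"
      using y c smooth_point_in_points[of "(c, y)" Y] by (auto simp: smooth_iff_not_branch)
  qed
  moreover have "finite {y. {(c, y)} \<in> {x \<in> points Y. r x \<notin> germs Y (\<lambda>_. 0) x}}"
  proof -
    have "finite {x \<in> points Y. r x \<notin> germs Y (\<lambda>_. 0) x}" using r by (simp add: adeles_def)
    moreover have "inj (\<lambda>y. {(c, y)})" by (auto simp: inj_on_def)
    ultimately have "finite ((\<lambda>y. {(c, y)}) -` {x \<in> points Y. r x \<notin> germs Y (\<lambda>_. 0) x})"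
      by (rule finite_vimageI)
    then show ?thesis by (simp only: vimage_def)
  qed
  ultimately have "finite {y \<in> closed_places. s y \<notin> local_ring y}"
    using branches_finite[OF Y] finite_subset by blast
  from repartition_approximation[OF pe de this] obtain f where
    f: "\<And>y. y \<in> closed_places \<Longrightarrow> f - s y \<in> stalk (e y) y" by blast
  have "f - r {(c, y)} c \<in> stalk (E (c, y)) y" if "(c, y) \<in> smooth_points Y" for y
    using f[of y] that by (auto simp: smooth_iff_not_branch s_def e_def)
  moreover have "has_value y (f - r x c) (v y)" if "x \<in> nodes Y" "(c, y) \<in> x" for x y
  proof -
    have "y \<in> ?B" using that by (auto simp: branches_def)
    moreover have "y \<in> closed_places" using nodal_curveD(4)[OF Y that] rational_places_closed by blast
    moreover have "E (c, y) = 0" using divisor_on_node[OF E that] .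
    ultimately show ?thesis using f[of y] node[OF that]
      by (simp add: has_value_def s_def e_def algebra_simps)
  qed
  ultimately show ?thesis by blast
qed

text \<open>
  The components can be treated separately, because an error that vanishes at all branches satisfies
  the gluing condition at the nodes.
\<close>

lemma H1_vanishes_of_large_degree:
  assumes Y: "nodal_curve Y" and E: "divisor_on Y E"
    and deg: "\<And>c. c \<in> comps Y \<Longrightarrow> place_div_degree (\<lambda>y. E (c, y)) \<ge> int (card (branches Y c)) - 1"
  shows "H1_vanishes Y E"
  unfolding H1_vanishes_def
proof
  fix r assume r: "r \<in> adeles Y"
  have "\<forall>c\<in>comps Y. \<exists>f. (\<forall>y. (c, y) \<in> smooth_points Y \<longrightarrow> f - r {(c, y)} c \<in> stalk (E (c, y)) y) \<and>
    (\<forall>x\<in>nodes Y. \<forall>y. (c, y) \<in> x \<longrightarrow> has_value y (f - r x c) 0)"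
    by (intro ballI component_approximation[OF Y E r _ deg])
  from bchoice[OF this] obtain f where f0: "\<forall>c\<in>comps Y. (\<forall>y. (c, y) \<in> smooth_points Y \<longrightarrow> f c - r {(c, y)} c \<in> stalk (E (c, y)) y) \<and>
    (\<forall>x\<in>nodes Y. \<forall>y. (c, y) \<in> x \<longrightarrow> has_value y (f c - r x c) 0)" ..
  have f: "f c - r {(c, y)} c \<in> stalk (E (c, y)) y" if "(c, y) \<in> smooth_points Y" for c y
    using f0 that by (simp add: smooth_iff_not_branch)
  have f': "has_value y (f c - r x c) 0" if "x \<in> nodes Y" "(c, y) \<in> x" for c x y
    using f0 that nodal_curveD(4)[OF Y that] by simp
  define g where "g c = (if c \<in> comps Y then f c else 0)" for c
  have "g \<in> rational_functions Y" by (simp add: rational_functions_def g_def)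
  moreover have "r - (\<lambda>x. g) \<in> adeles_bounded Y E"
    unfolding adeles_bounded_def
  proof (intro CollectI ballI)
    fix x assume x: "x \<in> points Y"
    have neg: "r x c - g c \<in> stalk e y" if "f c - r x c \<in> stalk e y" "(c, y) \<in> x" for e c y
      using stalk_uminus[OF points_closed(2)[OF Y x that(2)] that(1)] points_closed(1)[OF Y x that(2)]
      by (simp add: g_def)
    show "(r - (\<lambda>x. g)) x \<in> germs Y E x"
    proof (cases "x \<in> nodes Y")
      case True
      have *: "r x c - g c \<in> stalk (-1) y" if "(c, y) \<in> x" for c y
        using f'[OF True that] neg that by (simp add: has_value_0_iff)
      moreover have "r x c - g c \<in> stalk (E (c, y)) y" if "(c, y) \<in> x" for c y
        using *[OF that] stalk_mono[OF points_closed(2)[OF Y x that], of "-1" 0] divisor_on_node[OF E True that] by auto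
      ultimately show ?thesis by (auto simp: germs_def has_value_0_iff intro!: exI[of _ 0])
    next
      case False
      then obtain u where u: "x = {u}" "u \<in> smooth_points Y" using x by (auto simp: points_def)
      then obtain c y where "u = (c, y)" by (cases u)
      then show ?thesis using u f[of c y] neg[of c "E (c, y)" y] False by (auto simp: germs_def)
    qed
  qed
  moreover have "r = (\<lambda>x. g) + (r - (\<lambda>x. g))" by (simp add: fun_eq_iff)
  ultimately show "r \<in> coboundaries Y E" unfolding coboundaries_def by blast
qed

section \<open>Riemann--Roch\<close>

text \<open>
  The statement speaks of bases instead of \<open>h0\<close> and \<open>h1\<close>, because these numbers do not
  show that the spaces have finite dimension.
\<close>

definition riemann_roch :: "'k::field_char_0 curve \<Rightarrow> 'k divisor \<Rightarrow> bool" where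
  "riemann_roch Y E \<longleftrightarrow> (\<exists>B0 B1. finite B0 \<and> sec.independent B0 \<and> sec.span B0 = H0 Y E \<and>
     finite B1 \<and> quotient_basis adele_scale (adeles Y) (coboundaries Y E) B1 \<and>
     int (card B0) - int (card B1) = div_degree E + int (card (comps Y)) - int (card (nodes Y)))"

definition shift_div :: "'k::field_char_0 divisor \<Rightarrow> int \<Rightarrow> 'k pnt \<Rightarrow> 'k divisor" where
  "shift_div E n p = (\<lambda>u. E u + (if u = p then n else 0))"

lemma div_degree_superset:
  assumes "finite S" "{u. E u \<noteq> 0} \<subseteq> S"
  shows "div_degree E = (\<Sum>u\<in>S. E u * int (place_degree (snd u)))"
  unfolding div_degree_def using assms by (intro sum.mono_neutral_left) auto

lemma div_degree_shift:
  assumes "finite {u. E u \<noteq> 0}"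
  shows "div_degree (shift_div E n p) = div_degree E + n * int (place_degree (snd p))"
proof -
  let ?S = "insert p {u. E u \<noteq> 0}"
  have "div_degree (shift_div E n p) = (\<Sum>u\<in>?S. shift_div E n p u * int (place_degree (snd u)))"
    using assms by (intro div_degree_superset) (auto simp: shift_div_def)
  also have "\<dots> = (\<Sum>u\<in>?S. E u * int (place_degree (snd u)) + (if u = p then n * int (place_degree (snd u)) else 0))"
    by (intro sum.cong) (auto simp: shift_div_def algebra_simps)
  also have "\<dots> = (\<Sum>u\<in>?S. E u * int (place_degree (snd u))) + n * int (place_degree (snd p))"
    using assms by (simp add: sum.distrib)
  also have "(\<Sum>u\<in>?S. E u * int (place_degree (snd u))) = div_degree E"
    using assms by (intro div_degree_superset[symmetric]) auto
  finally show ?thesis .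
qed

lemma divisor_on_shift: "divisor_on Y E \<Longrightarrow> p \<in> smooth_points Y \<Longrightarrow> divisor_on Y (shift_div E n p)"
  unfolding divisor_on_def
proof (intro conjI, goal_cases)
  case 1
  have "{u. shift_div E n p u \<noteq> 0} \<subseteq> insert p {u. E u \<noteq> 0}" by (auto simp: shift_div_def)
  with 1 show ?case using finite_subset by blast
next
  case 2
  then show ?case by (auto simp: shift_div_def split: if_splits)
qed

text \<open>
  The repartitions bounded by \<open>E + p\<close> are those bounded by \<open>E\<close> and one more dimension, spanned by
  a repartition \<open>s\<close>. If \<open>s\<close> is a coboundary for \<open>E\<close>, it comes from a new section and the first
  cohomology is unchanged. If not, there is no new section and the class of \<open>s\<close> disappears
  from the first cohomology. So \<open>h0 - h1\<close> grows by one in both cases.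
\<close>

lemma riemann_roch_step:
  assumes Y: "nodal_curve Y" and E: "divisor_on Y E" and p: "p \<in> smooth_points Y"
    and rat: "snd p \<in> rational_places"
  shows "riemann_roch Y (shift_div E 1 p) \<longleftrightarrow> riemann_roch Y E"
proof -
  let ?E1 = "shift_div E 1 p"
  obtain c0 y0 where p_eq: "p = (c0, y0)" by (cases p)
  have y0: "y0 \<in> closed_places" "y0 \<in> rational_places" using rat p_eq rational_places_closed by auto
  have c0: "c0 \<in> comps Y" using p p_eq by (auto simp: smooth_points_def)
  note u0 = uniformizer_nonzero[OF y0(1)]
  \<comment> \<open>a local generator of the sheaf of \<open>E + p\<close> at \<open>p\<close>\<close>
  define t where "t = uniformizer y0 powi (- (E p + 1))"
  define s where "s = (\<lambda>(x::'a pnt set) c. if x = {p} \<and> c = c0 then t else 0)"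
  have pp: "{p} \<in> points Y" "{p} \<notin> nodes Y"
    using smooth_point_in_points[OF p] singleton_not_node[OF Y] by auto
  have other: "E (c, y) = ?E1 (c, y)" if "x \<in> points Y" "x \<noteq> {p}" "(c, y) \<in> x" for x c y
    using point_eq_singleton[of x Y p] that p by (auto simp: shift_div_def)
  have germs_other: "germs Y E x = germs Y ?E1 x" if x: "x \<in> points Y" "x \<noteq> {p}" for x
    unfolding germs_def using other[OF x] by auto
  have germs_p: "f \<in> germs Y E' {p} \<longleftrightarrow> f c0 \<in> stalk (E' p) y0" for f E'
    using pp by (simp add: germs_def p_eq)
  have tu: "t * uniformizer y0 powi (E p + 1) = 1"
    unfolding t_def power_int_minus using u0 by (intro left_inverse) simp
  have t1: "t \<in> stalk (E p + 1) y0" unfolding t_def by (rule uniformizer_power_in_stalk[OF y0(1)]) simp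
  have t0: "t \<notin> stalk (E p) y0"
  proof
    assume "t \<in> stalk (E p) y0"
    moreover have "uniformizer y0 powi (E p + 1) \<in> stalk (- E p - 1) y0"
      using uniformizer_power_in_stalk[OF y0(1), of "- E p - 1" "- E p - 1"] by (simp add: add.commute)
    ultimately have "t * uniformizer y0 powi (E p + 1) \<in> stalk (E p + (- E p - 1)) y0"
      by (rule stalk_mult[OF y0(1)])
    moreover have "t * uniformizer y0 powi (E p + 1) = const 1" using tu by simp
    ultimately have "const 1 \<in> stalk (-1) y0" by simp
    then show False using const_in_stalk[OF y0(1)] by fastforce
  qed
  let ?A0 = "adeles_bounded Y E" and ?A1 = "adeles_bounded Y ?E1"
  let ?C0 = "coboundaries Y E" and ?C1 = "coboundaries Y ?E1"
  have A01: "?A0 \<subseteq> ?A1"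
  proof
    fix a assume a: "a \<in> ?A0"
    have "a x \<in> germs Y ?E1 x" if x: "x \<in> points Y" for x
    proof (cases "x = {p}")
      case True
      then show ?thesis using a x stalk_mono[OF y0(1), of "E p" "E p + 1"] germs_p
        by (auto simp: adeles_bounded_def shift_div_def)
    next
      case False
      then show ?thesis using a x germs_other by (auto simp: adeles_bounded_def)
    qed
    then show "a \<in> ?A1" by (simp add: adeles_bounded_def)
  qed
  have s_other: "s x = 0" if "x \<noteq> {p}" for x using that by (auto simp: s_def)
  have sA1: "s \<in> ?A1"
  proof -
    have "s x \<in> germs Y ?E1 x" if x: "x \<in> points Y" for x
    proof (cases "x = {p}")
      case True
      have "s x \<in> germs Y ?E1 {p}" unfolding germs_p using t1 True by (simp add: s_def shift_div_def)
      then show ?thesis using True by simp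
    next
      case False
      then show ?thesis using s_other germs_0[OF Y x] by simp
    qed
    then show ?thesis by (simp add: adeles_bounded_def)
  qed
  have sA0: "s \<notin> ?A0"
  proof
    assume "s \<in> ?A0"
    then have "s {p} \<in> germs Y E {p}" using pp by (simp add: adeles_bounded_def)
    then show False unfolding germs_p using t0 by (simp add: s_def)
  qed
  have s_adele: "s \<in> adeles Y"
  proof -
    have "{x \<in> points Y. s x \<notin> germs Y (\<lambda>_. 0) x} \<subseteq> {{p}}"
    proof
      fix x assume x: "x \<in> {x \<in> points Y. s x \<notin> germs Y (\<lambda>_. 0) x}"
      then have "s x \<noteq> 0" using germs_0[OF Y, of x] by auto
      then have "x = {p}" using s_other[of x] by (rule contrapos_np)
      then show "x \<in> {{p}}" by simp
    qed
    then show ?thesis unfolding adeles_def using finite_subset by blast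
  qed
  have A1: "\<exists>k. a - adele_scale k s \<in> ?A0" if a: "a \<in> ?A1" for a
  proof -
    have "a {p} c0 \<in> stalk (E p + 1) y0"
      using a pp germs_p[of "a {p}" ?E1] by (simp add: adeles_bounded_def shift_div_def)
    then have "a {p} c0 * uniformizer y0 powi (E p + 1) \<in> local_ring y0"
      by (simp add: stalk_iff y0)
    then obtain k where k: "has_value y0 (a {p} c0 * uniformizer y0 powi (E p + 1)) k"
      using has_value_exists[OF y0(2)] by blast
    then have "(a {p} c0 * uniformizer y0 powi (E p + 1) - const k) \<in> stalk (-1) y0"
      by (simp add: has_value_def)
    from stalk_mult[OF y0(1) this t1] have "(a {p} c0 * uniformizer y0 powi (E p + 1) - const k) * t \<in> stalk (E p) y0"
      by simp
    moreover have "(a {p} c0 * uniformizer y0 powi (E p + 1) - const k) * t = a {p} c0 - const k * t"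
    proof -
      have "a {p} c0 * (t * uniformizer y0 powi (E p + 1)) = a {p} c0" unfolding tu by simp
      then show ?thesis by (simp only: left_diff_distrib right_diff_distrib mult_ac)
    qed
    ultimately have *: "(a - adele_scale k s) {p} \<in> germs Y E {p}"
      unfolding germs_p by (simp add: adele_scale_def sec_scale_def s_def)
    have "(a - adele_scale k s) x \<in> germs Y E x" if x: "x \<in> points Y" for x
    proof (cases "x = {p}")
      case False
      then have "(a - adele_scale k s) x = a x" using s_other
        by (simp add: adele_scale_def sec_scale_def fun_eq_iff)
      then show ?thesis using a x germs_other[OF x False] by (simp add: adeles_bounded_def)
    qed (use * in simp)
    then show ?thesis by (auto simp: adeles_bounded_def)
  qed
  note sub = subspace_adeles_bounded[OF Y] subspace_coboundaries[OF Y] subspace_H0[OF Y]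
  have A_C: "?A1 \<subseteq> ?C1" "?A0 \<subseteq> ?C0"
  proof -
    have "a = (\<lambda>x. 0) + a" for a :: "'a pnt set \<Rightarrow> nat \<Rightarrow> 'a poly fract" by (simp add: fun_eq_iff)
    moreover have "0 \<in> rational_functions Y" using sec.subspace_0[OF subspace_rational_functions] .
    ultimately show "?A1 \<subseteq> ?C1" "?A0 \<subseteq> ?C0" unfolding coboundaries_def zero_fun_def by blast+
  qed
  have C01: "?C0 \<subseteq> ?C1" using A01 unfolding coboundaries_def by blast
  have C1: "?C1 = {x. \<exists>k. \<exists>y\<in>?C0. x = adele_scale k s + y}"
  proof (intro equalityI subsetI)
    fix x assume "x \<in> ?C1"
    then obtain f a where fa: "x = (\<lambda>x. f) + a" "f \<in> rational_functions Y" "a \<in> ?A1"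
      by (auto simp: coboundaries_def)
    obtain k where "a - adele_scale k s \<in> ?A0" using A1[OF fa(3)] ..
    then have "(\<lambda>x. f) + (a - adele_scale k s) \<in> ?C0" using fa(2) unfolding coboundaries_def by blast
    moreover have "x = adele_scale k s + ((\<lambda>x. f) + (a - adele_scale k s))" unfolding fa(1) by (simp add: fun_eq_iff)
    ultimately show "x \<in> {x. \<exists>k. \<exists>y\<in>?C0. x = adele_scale k s + y}" by blast
  next
    fix x assume "x \<in> {x. \<exists>k. \<exists>y\<in>?C0. x = adele_scale k s + y}"
    then show "x \<in> ?C1" using C01 A_C(1) sA1 adele.subspace_add[OF sub(2)] adele.subspace_scale[OF sub(2)] by blast
  qed
  have H01: "H0 Y E \<subseteq> H0 Y ?E1" using A01 unfolding H0_eq by blast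
  have deg: "div_degree ?E1 = div_degree E + 1"
    using div_degree_shift[of E 1 p] E rational_places_degree[OF rat] by (simp add: divisor_on_def)
  show ?thesis
  proof (cases "s \<in> ?C0")
    case True
    have CC: "?C1 = ?C0"
      using C1 C01 True adele.subspace_add[OF sub(2)] adele.subspace_scale[OF sub(2)] by auto
    obtain f a where fa: "s = (\<lambda>x. f) + a" "f \<in> rational_functions Y" "a \<in> ?A0"
      using True by (auto simp: coboundaries_def)
    have fs: "(\<lambda>x. f) = s - a" using fa(1) by simp
    then have fH1: "f \<in> H0 Y ?E1" 
      unfolding H0_eq using fa(2) A01 fa(3) sA1 adele.subspace_diff[OF sub(1)] by auto
    have fH0: "f \<notin> H0 Y E"
    proof
      assume "f \<in> H0 Y E"
      then have "s \<in> ?A0" using fa(1,3) adele.subspace_add[OF sub(1)] by (simp add: H0_eq)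
      then show False using sA0 by simp
    qed
    have gH: "\<exists>k. g - sec_scale k f \<in> H0 Y E" if g: "g \<in> H0 Y ?E1" for g
    proof -
      obtain k where k: "(\<lambda>x. g) - adele_scale k s \<in> ?A0" using A1 g unfolding H0_eq by blast
      have "(\<lambda>x. g - sec_scale k f) = ((\<lambda>x. g) - adele_scale k s) + adele_scale k a"
        unfolding fa(1) by (simp add: fun_eq_iff adele_scale_def sec_scale_def algebra_simps)
      then have "(\<lambda>x. g - sec_scale k f) \<in> ?A0"
        using k fa(3) adele.subspace_add[OF sub(1)] adele.subspace_scale[OF sub(1)] by metis
      moreover have "g - sec_scale k f \<in> rational_functions Y"
        using g fa(2) sec.subspace_diff sec.subspace_scale subspace_rational_functions unfolding H0_eq by blast
      ultimately show ?thesis unfolding H0_eq by blast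
    qed
    have span1: "sec.span (insert f B) = H0 Y ?E1" if B: "sec.span B = H0 Y E" for B
    proof (intro equalityI subsetI)
      fix g assume "g \<in> sec.span (insert f B)"
      then obtain k h where "g = sec_scale k f + h" "h \<in> H0 Y E" unfolding sec.span_insert_scaled_sum B by blast
      then show "g \<in> H0 Y ?E1" using H01 fH1 sec.subspace_add[OF sub(3)] sec.subspace_scale[OF sub(3)] by blast
    next
      fix g assume "g \<in> H0 Y ?E1"
      then obtain k where "g - sec_scale k f \<in> sec.span B" using gH B by blast
      then show "g \<in> sec.span (insert f B)" unfolding sec.span_insert by blast
    qed
    have ins: "f \<notin> B \<and> sec.independent (insert f B)" if "sec.independent B" "sec.span B = H0 Y E" for B
      using that fH0 sec.independent_insertI[of f B] sec.span_base[of f B] by auto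
    show ?thesis
    proof
      assume "riemann_roch Y E"
      then obtain B0 B1 where B: "finite B0" "sec.independent B0" "sec.span B0 = H0 Y E" "finite B1"
        "quotient_basis adele_scale (adeles Y) ?C0 B1"
        "int (card B0) - int (card B1) = div_degree E + int (card (comps Y)) - int (card (nodes Y))"
        unfolding riemann_roch_def by blast
      show "riemann_roch Y ?E1" unfolding riemann_roch_def CC deg
        using B span1[OF B(3)] ins[OF B(2,3)] by (intro exI[of _ "insert f B0"] exI[of _ B1]) auto
    next
      assume "riemann_roch Y ?E1"
      then obtain B0 B1 where B: "finite B0" "sec.independent B0" "sec.span B0 = H0 Y ?E1" "finite B1"
        "quotient_basis adele_scale (adeles Y) ?C0 B1"
        "int (card B0) - int (card B1) = div_degree E + 1 + int (card (comps Y)) - int (card (nodes Y))"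
        unfolding riemann_roch_def CC deg by blast
      obtain B where B': "B \<subseteq> H0 Y E" "sec.independent B" "H0 Y E \<subseteq> sec.span B"
        using sec.maximal_independent_subset[of "H0 Y E"] by blast
      have spB: "sec.span B = H0 Y E" using B'(3) sec.span_minimal[OF B'(1) sub(3)] by blast
      note i = ins[OF B'(2) spB]
      have "finite (insert f B) \<and> card (insert f B) = card B0"
        using sec.basis_card_unique[OF B(2,1), of "insert f B"] i span1[OF spB] B(3) by simp
      then have "finite B" "card B0 = card B + 1" using i by auto
      then show "riemann_roch Y E" unfolding riemann_roch_def using B B'(2) spB
        by (intro exI[of _ "B"] exI[of _ B1]) auto
    qed
  next
    case False
    have HH: "H0 Y ?E1 = H0 Y E"
    proof
      show "H0 Y ?E1 \<subseteq> H0 Y E"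
      proof
        fix g assume g: "g \<in> H0 Y ?E1"
        then obtain k where k: "(\<lambda>x. g) - adele_scale k s \<in> ?A0" using A1 unfolding H0_eq by blast
        have "k = 0"
        proof (rule ccontr)
          assume "k \<noteq> 0"
          let ?a = "(\<lambda>x. g) - adele_scale k s"
          have "s = (\<lambda>x. sec_scale (1/k) g) + adele_scale (- (1/k)) ?a"
          proof -
            have "const (1/k) * const k = 1" using \<open>k \<noteq> 0\<close> by (simp flip: const_simps(2))
            then have "const (1/k) * (const k * z) = z" for z by (simp add: mult.assoc[symmetric])
            then have "z = const (1/k) * w - const (1/k) * (w - const k * z)" for z w by (simp only: right_diff_distrib) simp
            then show ?thesis by (simp add: fun_eq_iff adele_scale_def sec_scale_def const_uminus)
          qed
          moreover have "sec_scale (1/k) g \<in> rational_functions Y"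
            using g sec.subspace_scale[OF subspace_rational_functions] unfolding H0_eq by blast
          moreover have "adele_scale (- (1/k)) ?a \<in> ?A0" using adele.subspace_scale[OF sub(1) k] .
          ultimately have "s \<in> ?C0" unfolding coboundaries_def by blast
          with False show False by simp
        qed
        then have "(\<lambda>x. g) - adele_scale k s = (\<lambda>x. g)" by simp
        then have "(\<lambda>x. g) \<in> ?A0" using k by (simp only:)
        then show "g \<in> H0 Y E" using g unfolding H0_eq by blast
      qed
    qed (rule H01)
    note qi = adele.quotient_basis_insert[OF sub(2) C1 False s_adele]
    show ?thesis
    proof
      assume "riemann_roch Y E"
      then obtain B0 B1 where B: "finite B0" "sec.independent B0" "sec.span B0 = H0 Y E" "finite B1"
        "quotient_basis adele_scale (adeles Y) ?C0 B1"
        "int (card B0) - int (card B1) = div_degree E + int (card (comps Y)) - int (card (nodes Y))"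
        unfolding riemann_roch_def by blast
      obtain B' where B': "quotient_basis adele_scale (adeles Y) ?C1 B'"
        using adele.quotient_basis_exists[OF sub(2)] by blast
      note i = qi[OF B']
      have "finite (insert s B') \<and> card (insert s B') = card B1"
        by (rule adele.quotient_basis_card[OF sub(2) B(5,4) conjunct2[OF i]])
      then have "finite B'" "card B1 = card B' + 1" using i by auto
      then show "riemann_roch Y ?E1" unfolding riemann_roch_def HH deg
        using B B' by (intro exI[of _ B0] exI[of _ B']) auto
    next
      assume "riemann_roch Y ?E1"
      then obtain B0 B1 where B: "finite B0" "sec.independent B0" "sec.span B0 = H0 Y E" "finite B1"
        "quotient_basis adele_scale (adeles Y) ?C1 B1"
        "int (card B0) - int (card B1) = div_degree E + 1 + int (card (comps Y)) - int (card (nodes Y))"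
        unfolding riemann_roch_def HH deg by blast
      show "riemann_roch Y E" unfolding riemann_roch_def
        using B qi[OF B(5)] by (intro exI[of _ B0] exI[of _ "insert s B1"]) auto
    qed
  qed
qed

lemma riemann_roch_shift:
  assumes Y: "nodal_curve Y" and p: "p \<in> smooth_points Y" "snd p \<in> rational_places"
    and E: "divisor_on Y E"
  shows "riemann_roch Y (shift_div E n p) \<longleftrightarrow> riemann_roch Y E"
proof -
  have nat: "riemann_roch Y (shift_div E (int n) p) \<longleftrightarrow> riemann_roch Y E" if "divisor_on Y E" for n E
  proof (induction n)
    case (Suc n)
    have "shift_div E (int (Suc n)) p = shift_div (shift_div E (int n) p) 1 p"
      by (auto simp: shift_div_def)
    then show ?case using riemann_roch_step[OF Y divisor_on_shift[OF that p(1)] p] Suc by simp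
  qed (simp add: shift_div_def)
  show ?thesis
  proof (cases "n \<ge> 0")
    case True
    then show ?thesis using nat[OF E, of "nat n"] by simp
  next
    case False
    have "shift_div (shift_div E n p) (int (nat (- n))) p = E" using False by (auto simp: shift_div_def)
    then show ?thesis using nat[OF divisor_on_shift[OF E p(1)], of n "nat (- n)"] by simp
  qed
qed

lemma div_degree_eq_sum_components:
  assumes Y: "nodal_curve Y" and E: "divisor_on Y E"
  shows "div_degree E = (\<Sum>c\<in>comps Y. place_div_degree (\<lambda>y. E (c, y)))"
proof -
  let ?S = "SIGMA c:comps Y. {y. E (c, y) \<noteq> 0}"
  have fin: "finite (comps Y)" "finite {y. E (c, y) \<noteq> 0}" for c
    using nodal_curveD(1)[OF Y] divisor_on_place_divisor[OF E, of c] by (auto simp: place_divisor_def)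
  have "div_degree E = (\<Sum>u\<in>?S. E u * int (place_degree (snd u)))"
    using fin E by (intro div_degree_superset finite_SigmaI) (auto simp: divisor_on_def smooth_points_def)
  also have "\<dots> = (\<Sum>c\<in>comps Y. \<Sum>y | E (c, y) \<noteq> 0. E (c, y) * int (place_degree y))"
    using fin by (subst sum.Sigma) (auto intro!: sum.cong)
  finally show ?thesis by (simp add: place_div_degree_def)
qed

lemma sum_card_branches:
  assumes Y: "nodal_curve Y"
  shows "(\<Sum>c\<in>comps Y. card (branches Y c)) = 2 * card (nodes Y)"
proof -
  have fx: "finite x" if "x \<in> nodes Y" for x using nodal_curveD(3)[OF Y that] card.infinite by fastforce
  have "(\<Sum>c\<in>comps Y. card (branches Y c)) = card (SIGMA c:comps Y. branches Y c)"
    using nodal_curveD(1)[OF Y] branches_finite[OF Y] by (simp add: card_SigmaI)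
  also have "(SIGMA c:comps Y. branches Y c) = \<Union>(nodes Y)"
    using nodal_curveD(4)[OF Y] by (fastforce simp: branches_def)
  also have "card (\<Union>(nodes Y)) = (\<Sum>x\<in>nodes Y. card x)"
    using Y fx by (intro card_Union_disjoint) (auto simp: nodal_curve_def)
  also have "\<dots> = 2 * card (nodes Y)" using nodal_curveD(3)[OF Y] by simp
  finally show ?thesis .
qed

text \<open>
  The ground field is infinite, since its characteristic is zero.
\<close>

lemma rational_smooth_point_exists:
  assumes Y: "nodal_curve Y" and c: "c \<in> comps Y"
  shows "\<exists>y\<in>rational_places. (c, y) \<in> smooth_points Y"
proof -
  have "infinite (range (aff :: 'a \<Rightarrow> _))" 
    using finite_imageD[of "aff :: 'a \<Rightarrow> _" UNIV] infinite_UNIV_char_0 by (auto simp: inj_def aff_def)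
  then have "\<not> range (aff :: 'a \<Rightarrow> _) \<subseteq> branches Y c" using branches_finite[OF Y] finite_subset by blast
  then show ?thesis using c by (auto simp: smooth_iff_not_branch rational_places_def)
qed

lemma riemann_roch_shift_all:
  fixes n :: "nat \<Rightarrow> int"
  assumes Y: "nodal_curve Y" and E: "divisor_on Y E" and C: "C \<subseteq> comps Y"
    and y: "\<And>c. c \<in> C \<Longrightarrow> y c \<in> rational_places \<and> (c, y c) \<in> smooth_points Y"
  defines "E' \<equiv> (\<lambda>u. E u + (if fst u \<in> C \<and> snd u = y (fst u) then n (fst u) else 0))"
  shows "divisor_on Y E' \<and> (riemann_roch Y E' \<longleftrightarrow> riemann_roch Y E)"
proof -
  have "finite C" using C nodal_curveD(1)[OF Y] finite_subset by blast
  then show ?thesis using y unfolding E'_def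
  proof (induction C rule: finite_induct)
    case (insert c C)
    let ?F = "\<lambda>u. E u + (if fst u \<in> C \<and> snd u = y (fst u) then n (fst u) else 0)"
    let ?G = "\<lambda>u. E u + (if fst u \<in> insert c C \<and> snd u = y (fst u) then n (fst u) else 0)"
    have "?G = shift_div ?F (n c) (c, y c)" using insert by (auto simp: shift_div_def fun_eq_iff)
    moreover have "divisor_on Y ?F \<and> (riemann_roch Y ?F \<longleftrightarrow> riemann_roch Y E)" using insert by simp
    ultimately show ?case
      using riemann_roch_shift[OF Y, of "(c, y c)" ?F "n c"] divisor_on_shift[of Y ?F "(c, y c)" "n c"] insert.prems[of c]
      by simp
  qed (simp add: E)
qed

lemma sum_apply: "(\<Sum>i\<in>I. f i) c = (\<Sum>i\<in>I. f i c)" for f :: "'i \<Rightarrow> 'c \<Rightarrow> 'b::comm_monoid_add"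
  by (induction I rule: infinite_finite_induct) auto

text \<open>
  On every component, the sections that vanish at the branches belong to a divisor of degree \<open>-1\<close>,
  which has neither sections nor first cohomology. So there is exactly one section for every choice
  of values at the nodes, and the sections with value one at a single node form a basis.
\<close>

lemma riemann_roch_balanced:
  assumes Y: "nodal_curve Y" and E: "divisor_on Y E"
    and deg: "\<And>c. c \<in> comps Y \<Longrightarrow> place_div_degree (\<lambda>y. E (c, y)) = int (card (branches Y c)) - 1"
  shows "riemann_roch Y E"
proof -
  have "H1_vanishes Y E" using H1_vanishes_of_large_degree[OF Y E] deg by simp
  then have B1: "quotient_basis adele_scale (adeles Y) (coboundaries Y E) {}"
    by (simp add: adele.quotient_basis_empty_iff[OF subspace_coboundaries[OF Y]] H1_vanishes_def)
  have 0: "0 \<in> adeles Y" using adele.subspace_0[OF subspace_adeles[OF Y]] .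
  have "\<exists>f\<in>H0 Y E. \<forall>x'\<in>nodes Y. \<forall>(c, y)\<in>x'. has_value y (f c) (if x' = x then 1 else 0)" if x: "x \<in> nodes Y" for x
  proof -
    have "\<forall>c\<in>comps Y. \<exists>f. (\<forall>y. (c, y) \<in> smooth_points Y \<longrightarrow> f \<in> stalk (E (c, y)) y) \<and>
      (\<forall>x'\<in>nodes Y. \<forall>y. (c, y) \<in> x' \<longrightarrow> has_value y f (if (c, y) \<in> x then 1 else 0))"
    proof
      fix c assume c: "c \<in> comps Y"
      show "\<exists>f. (\<forall>y. (c, y) \<in> smooth_points Y \<longrightarrow> f \<in> stalk (E (c, y)) y) \<and>
      (\<forall>x'\<in>nodes Y. \<forall>y. (c, y) \<in> x' \<longrightarrow> has_value y f (if (c, y) \<in> x then 1 else 0))"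
      using component_approximation[OF Y E 0 c, of "\<lambda>y. if (c, y) \<in> x then 1 else 0"] deg[OF c] by simp
    qed
    from bchoice[OF this] obtain f where f: "\<forall>c\<in>comps Y. (\<forall>y. (c, y) \<in> smooth_points Y \<longrightarrow> f c \<in> stalk (E (c, y)) y) \<and>
      (\<forall>x'\<in>nodes Y. \<forall>y. (c, y) \<in> x' \<longrightarrow> has_value y (f c) (if (c, y) \<in> x then 1 else 0))" ..
    define g where "g c = (if c \<in> comps Y then f c else 0)" for c
    have val: "has_value y (g c) (if x' = x then 1 else 0)" if "x' \<in> nodes Y" "(c, y) \<in> x'" for x' c y
    proof -
      have "(c, y) \<in> x \<longleftrightarrow> x' = x" using nodal_curveD(5)[OF Y x that(1), of "(c, y)"] that by auto
      moreover have "has_value y (f c) (if (c, y) \<in> x then 1 else 0)"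
        using f that nodal_curveD(4)[OF Y that] by blast
      ultimately show ?thesis using nodal_curveD(4)[OF Y that] by (simp add: g_def)
    qed
    have "g \<in> germs Y E x'" if x': "x' \<in> points Y" for x'
    proof (cases "x' \<in> nodes Y")
      case True
      have "g c \<in> stalk (E (c, y)) y" if "(c, y) \<in> x'" for c y
        using has_value_in_local_ring[OF points_closed(2)[OF Y x' that] val[OF True that]] divisor_on_node[OF E True that]
        by simp
      moreover have "\<forall>(c, y)\<in>x'. has_value y (g c) (if x' = x then 1 else 0)"
      proof (rule ballI, rule case_prodI2)
        fix u c y assume "u \<in> x'" "u = (c, y)"
        then show "has_value y (g c) (if x' = x then 1 else 0)" using val[OF True, of c y] by (simp only:)
      qed
      ultimately show ?thesis unfolding germs_def by blast
    next
      case False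
      then obtain u where u: "x' = {u}" "u \<in> smooth_points Y" using x' by (auto simp: points_def)
      then obtain c y where "u = (c, y)" by (cases u)
      then show ?thesis using u f False by (auto simp: germs_def g_def smooth_iff_not_branch)
    qed
    then have "g \<in> H0 Y E" by (simp add: H0_def rational_functions_def g_def)
    moreover have "\<forall>x'\<in>nodes Y. \<forall>(c, y)\<in>x'. has_value y (g c) (if x' = x then 1 else 0)"
    proof (intro ballI, rule case_prodI2)
      fix x' u c y assume "x' \<in> nodes Y" "u \<in> x'" "u = (c, y)"
      then show "has_value y (g c) (if x' = x then 1 else 0)" using val[of x' c y] by (simp only:)
    qed
    ultimately show ?thesis by blast
  qed
  then have "\<forall>x\<in>nodes Y. \<exists>f. f \<in> H0 Y E \<and> (\<forall>x'\<in>nodes Y. \<forall>(c, y)\<in>x'. has_value y (f c) (if x' = x then 1 else 0))" by blast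
  from bchoice[OF this] obtain f where f0: "\<forall>x\<in>nodes Y. f x \<in> H0 Y E \<and> (\<forall>x'\<in>nodes Y. \<forall>(c, y)\<in>x'. has_value y (f x c) (if x' = x then 1 else 0))" ..
  have f: "f x \<in> H0 Y E" if "x \<in> nodes Y" for x using f0 that by blast
  have val: "has_value y (f x c) (if x' = x then 1 else 0)" if "x \<in> nodes Y" "x' \<in> nodes Y" "(c, y) \<in> x'" for x x' c y
    using f0 that by blast
  note finN = nodal_curveD(2)[OF Y]
  have sumval: "has_value y ((\<Sum>x\<in>nodes Y. sec_scale (k x) (f x)) c) (k x')" if x': "x' \<in> nodes Y" "(c, y) \<in> x'" for k x' c y
  proof -
    have y: "y \<in> closed_places" using nodal_curveD(4)[OF Y x'] rational_places_closed by blast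
    have "has_value y (\<Sum>x\<in>nodes Y. const (k x) * f x c) (\<Sum>x\<in>nodes Y. k x * (if x' = x then 1 else 0))"
      using val x' y by (intro has_value_sum has_value_const_mult) auto
    then show ?thesis using finN x' by (simp add: sec_scale_def sum_apply if_distrib cong: if_cong)
  qed
  have indep: "inj_on f (nodes Y) \<and> sec.independent (f ` nodes Y)"
  proof (rule sec.independent_family[OF finN], rule ballI)
    fix k x' assume k: "(\<Sum>x\<in>nodes Y. sec_scale (k x) (f x)) = 0" and x': "x' \<in> nodes Y"
    have "x' \<noteq> {}" using nodal_curveD(3)[OF Y x'] by auto
    then obtain c y where cy: "(c, y) \<in> x'" by auto
    have y: "y \<in> closed_places" using nodal_curveD(4)[OF Y x' cy] rational_places_closed by blast
    have "has_value y 0 (k x')" using sumval[OF x' cy, of k] k by simp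
    moreover have "has_value y 0 0" by (simp add: has_value_0_iff stalk_zero y)
    ultimately show "k x' = 0" using has_value_unique y by blast
  qed
  have "g \<in> sec.span (f ` nodes Y)" if g: "g \<in> H0 Y E" for g
  proof -
    have "\<forall>x\<in>nodes Y. \<exists>v. \<forall>(c, y)\<in>x. has_value y (g c) v"
      using g by (auto simp: H0_def germs_def points_def)
    from bchoice[OF this] obtain v where v: "\<forall>x\<in>nodes Y. \<forall>(c, y)\<in>x. has_value y (g c) (v x)" ..
    let ?s = "\<Sum>x\<in>nodes Y. sec_scale (v x) (f x)"
    have sH: "?s \<in> H0 Y E" 
      by (intro sec.subspace_sum[OF subspace_H0[OF Y]] sec.subspace_scale[OF subspace_H0[OF Y]] f)
    have hH: "g - ?s \<in> H0 Y E" using sec.subspace_diff[OF subspace_H0[OF Y] g sH] .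
    have "(g - ?s) c = 0" for c
    proof (cases "c \<in> comps Y")
      case False
      then show ?thesis using hH by (auto simp: H0_def rational_functions_def)
    next
      case c: True
      let ?B = "branches Y c"
      define e where "e y = E (c, y) - of_bool (y \<in> ?B)" for y
      have pe: "place_divisor e" and de: "place_div_degree e < 0"
        using divisor_minus_branches[OF Y E, of c] deg[OF c] unfolding e_def[symmetric] by auto
      show ?thesis
      proof (rule no_sections_of_negative_degree[OF pe de])
        fix y :: "'a poly place" assume y: "y \<in> closed_places"
        show "(g - ?s) c \<in> stalk (e y) y"
        proof (cases "y \<in> ?B")
          case True
          then obtain x where x: "x \<in> nodes Y" "(c, y) \<in> x" by (auto simp: branches_def)
          have "has_value y (g c - ?s c) (v x - v x)"
            using v x sumval[OF x, of v] by (intro has_value_diff y) auto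
          then show ?thesis using divisor_on_node[OF E x] True by (simp add: has_value_0_iff e_def)
        next
          case False
          then have sm: "(c, y) \<in> smooth_points Y" using c y by (simp add: smooth_iff_not_branch)
          then have "g - ?s \<in> germs Y E {(c, y)}" using hH smooth_point_in_points[OF sm] by (simp add: H0_def)
          then show ?thesis using False by (simp add: germs_def e_def)
        qed
      qed
    qed
    then have "g = ?s" by (simp add: fun_eq_iff)
    moreover have "?s \<in> sec.span (f ` nodes Y)"
      by (intro sec.span_sum sec.span_scale sec.span_base) auto
    ultimately show ?thesis by simp
  qed
  then have span: "sec.span (f ` nodes Y) = H0 Y E"
    using sec.span_minimal[OF _ subspace_H0[OF Y], of "f ` nodes Y"] f by blast
  have "div_degree E = (\<Sum>c\<in>comps Y. int (card (branches Y c)) - 1)"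
    unfolding div_degree_eq_sum_components[OF Y E] using deg by (intro sum.cong) auto
  also have "\<dots> = int (\<Sum>c\<in>comps Y. card (branches Y c)) - int (card (comps Y))"
    by (simp add: sum_subtractf)
  finally have "div_degree E = 2 * int (card (nodes Y)) - int (card (comps Y))"
    unfolding sum_card_branches[OF Y] by simp
  then show ?thesis unfolding riemann_roch_def
    using indep span B1 finN by (intro exI[of _ "f ` nodes Y"] exI[of _ "{}"]) (auto simp: card_image)
qed

text \<open>
  Multiples of one rational smooth point on each component lead from \<open>E\<close> to the balanced case.
\<close>

lemma riemann_roch_holds:
  assumes Y: "nodal_curve Y" and E: "divisor_on Y E"
  shows "riemann_roch Y E"
proof -
  have "\<forall>c\<in>comps Y. \<exists>y. y \<in> rational_places \<and> (c, y) \<in> smooth_points Y"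
    using rational_smooth_point_exists[OF Y] by blast
  from bchoice[OF this] obtain y where y: "\<forall>c\<in>comps Y. y c \<in> rational_places \<and> (c, y c) \<in> smooth_points Y" ..
  define n where "n c = int (card (branches Y c)) - 1 - place_div_degree (\<lambda>y. E (c, y))" for c
  define E' where "E' = (\<lambda>u. E u + (if fst u \<in> comps Y \<and> snd u = y (fst u) then n (fst u) else 0))"
  have E': "divisor_on Y E'" "riemann_roch Y E' \<longleftrightarrow> riemann_roch Y E"
    using riemann_roch_shift_all[OF Y E subset_refl, of y n] y unfolding E'_def by auto
  have "place_div_degree (\<lambda>z. E' (c, z)) = int (card (branches Y c)) - 1" if c: "c \<in> comps Y" for c
  proof -
    let ?d = "\<lambda>z. if z = y c then n c else 0"
    have yc: "y c \<in> rational_places" using y c by blast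
    have "{z. ?d z \<noteq> 0} \<subseteq> {y c}" by auto
    then have pd: "place_divisor ?d"
      using rational_places_closed[OF yc] by (auto simp: place_divisor_def intro: finite_subset)
    have "place_div_degree ?d = n c"
      using place_div_degree_superset[OF _ \<open>{z. ?d z \<noteq> 0} \<subseteq> {y c}\<close>] rational_places_degree[OF yc] by simp
    moreover have "(\<lambda>z. E' (c, z)) = (\<lambda>z. E (c, z) + ?d z)" using c by (auto simp: E'_def)
    ultimately show ?thesis
      using place_div_degree_add[OF divisor_on_place_divisor[OF E, of c] pd] by (simp add: n_def)
  qed
  then show ?thesis using riemann_roch_balanced[OF Y E'(1)] E'(2) by simp
qed

lemma riemann_roch_h0_h1:
  assumes Y: "nodal_curve Y" and E: "divisor_on Y E"
  shows "int (h0 Y E) - int (h1 Y E) = div_degree E + int (card (comps Y)) - int (card (nodes Y))"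
    "h1 Y E = 0 \<longleftrightarrow> H1_vanishes Y E"
proof -
  obtain B0 B1 where B: "finite B0" "sec.independent B0" "sec.span B0 = H0 Y E" "finite B1"
    "quotient_basis adele_scale (adeles Y) (coboundaries Y E) B1"
    "int (card B0) - int (card B1) = div_degree E + int (card (comps Y)) - int (card (nodes Y))"
    using riemann_roch_holds[OF Y E] unfolding riemann_roch_def by blast
  note sC = subspace_coboundaries[OF Y, of E]
  have h0: "h0 Y E = card B0" unfolding h0_def B(3)[symmetric] by (rule sec.dim_span_eq_card_independent[OF B(2)])
  have h1: "h1 Y E = card B1" unfolding h1_def
    using adele.quotient_basis_card[OF sC B(5,4)] someI[of "quotient_basis adele_scale (adeles Y) (coboundaries Y E)", OF B(5)] by blast
  show "int (h0 Y E) - int (h1 Y E) = div_degree E + int (card (comps Y)) - int (card (nodes Y))"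
    using B h0 h1 by simp
  have "H1_vanishes Y E \<longleftrightarrow> quotient_basis adele_scale (adeles Y) (coboundaries Y E) {}"
    by (simp add: adele.quotient_basis_empty_iff[OF sC] H1_vanishes_def)
  also have "\<dots> \<longleftrightarrow> card B1 = 0"
  proof
    assume "quotient_basis adele_scale (adeles Y) (coboundaries Y E) {}"
    then show "card B1 = 0" using adele.quotient_basis_card[OF sC B(5,4)] by fastforce
  qed (use B in auto)
  finally show "h1 Y E = 0 \<longleftrightarrow> H1_vanishes Y E" using h1 by simp
qed

lemma arith_genus_eq: "nodal_curve Y \<Longrightarrow> arith_genus Y = 1 - int (card (comps Y)) + int (card (nodes Y))"
  using riemann_roch_h0_h1(1)[of Y "\<lambda>_. 0"] unfolding arith_genus_def
  by (simp add: divisor_on_def div_degree_def)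

section \<open>Laurent expansions at infinity\<close>

lemma poly_at_inf_1 [simp]: "poly_at_inf 1 = 1"
  by (simp add: one_pCons poly_at_inf_pCons poly_at_inf_0)

lemma poly_at_inf_monom: "poly_at_inf (monom 1 m) = fls_X_inv ^ m"
  by (induction m) (simp_all add: monom_0 monom_Suc poly_at_inf_pCons poly_at_inf_0)

lemma poly_at_inf_linear: "poly_at_inf [:- c, 1:] = fls_X_inv - fls_const c"
  by (simp add: poly_at_inf_pCons poly_at_inf_0)

lemma subdegree_poly_at_inf:
  assumes "n \<noteq> 0" shows "fls_subdegree (poly_at_inf n) = - int (degree n)"
proof (rule fls_subdegree_eqI)
  show "fls_nth (poly_at_inf n) (- int (degree n)) \<noteq> 0" using assms by (simp add: fls_nth_poly_at_inf)
  fix k assume "k < - int (degree n)"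
  then show "fls_nth (poly_at_inf n) k = 0"
    using fls_nth_poly_at_inf[of n "nat (- k)"] by (simp add: coeff_eq_0)
qed

lemma laurent_mult: "laurent_at_inf (f * g) = laurent_at_inf f * laurent_at_inf g"
  by (cases f, cases g) (simp add: laurent_at_inf_Fract poly_at_inf_mult)

lemma laurent_add: "laurent_at_inf (f + g) = laurent_at_inf f + laurent_at_inf g"
  by (cases f, cases g)
    (simp add: laurent_at_inf_Fract poly_at_inf_mult poly_at_inf_add add_frac_eq poly_at_inf_eq_0_iff)

lemma laurent_0 [simp]: "laurent_at_inf 0 = 0"
  by (simp add: Zero_fract_def laurent_at_inf_Fract poly_at_inf_0)

lemma laurent_1 [simp]: "laurent_at_inf 1 = 1"
  by (simp add: One_fract_def laurent_at_inf_Fract)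

lemma laurent_eq_0_iff: "laurent_at_inf f = 0 \<longleftrightarrow> f = 0"
  by (cases f) (simp add: laurent_at_inf_Fract poly_at_inf_eq_0_iff Zero_fract_def eq_fract)

lemma laurent_uminus: "laurent_at_inf (- f) = - laurent_at_inf f"
  using laurent_add[of f "- f"] by (simp add: eq_neg_iff_add_eq_0 add.commute)

lemma laurent_inject: "laurent_at_inf f = laurent_at_inf g \<longleftrightarrow> f = g"
  using laurent_eq_0_iff[of "f - g"] laurent_add[of f "- g"] by (simp add: laurent_uminus)

lemma laurent_inverse: "laurent_at_inf (inverse f) = inverse (laurent_at_inf f)"
  by (cases "f = 0") (metis inverse_zero laurent_0, metis laurent_1 laurent_mult inverse_unique right_inverse)

lemma laurent_power: "laurent_at_inf (f ^ n) = laurent_at_inf f ^ n"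
  by (induction n) (simp_all add: laurent_mult)

lemma laurent_power_int: "laurent_at_inf (f powi n) = laurent_at_inf f powi n"
  by (simp add: power_int_def laurent_power laurent_inverse)

lemma laurent_prod: "laurent_at_inf (\<Prod>i\<in>I. f i) = (\<Prod>i\<in>I. laurent_at_inf (f i))"
  by (induction I rule: infinite_finite_induct) (auto simp: laurent_mult)

section \<open>Soliton points as spaces of polynomials\<close>

definition param_poly :: "'k::field_char_0 list \<Rightarrow> 'k poly" where
  "param_poly \<kappa>s = (\<Prod>i<length \<kappa>s. [:- (\<kappa>s ! i), 1:])"

text \<open>
  By Lagrange interpolation the \<open>i\<close>-th coefficient of \<open>u / K\<close> in partial fractions is the
  value of \<open>u / K'\<close> at the \<open>i\<close>-th parameter. So these are the polynomials whose vector of coefficients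
  is a combination of the rows of \<open>M\<close>.
\<close>

definition soliton_polys :: "'k::field_char_0 mat \<Rightarrow> 'k list \<Rightarrow> 'k poly set" where
  "soliton_polys M \<kappa>s = {u. \<exists>c. \<forall>i<dim_col M.
     poly u (\<kappa>s ! i) = poly (pderiv (param_poly \<kappa>s)) (\<kappa>s ! i) * (\<Sum>j<dim_row M. c j * M $$ (j, i))}"

text \<open>
  Expansion at infinity of \<open>x\<^sup>k u / K\<close>, where \<open>k\<close> is the number of rows.
\<close>

definition soliton_embed :: "'k::field_char_0 mat \<Rightarrow> 'k list \<Rightarrow> 'k poly \<Rightarrow> 'k fls" where
  "soliton_embed M \<kappa>s u = fls_X_intpow (- int (dim_row M)) * poly_at_inf u / poly_at_inf (param_poly \<kappa>s)"

definition omit_factor :: "'k::field_char_0 list \<Rightarrow> nat \<Rightarrow> 'k poly" where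
  "omit_factor \<kappa>s i = (\<Prod>l\<in>{..<length \<kappa>s} - {i}. [:- (\<kappa>s ! l), 1:])"

text \<open>
  The numerator of the sum that defines a basis vector of the soliton point, over the
  denominator \<open>K\<close>.
\<close>

definition soliton_poly :: "'k::field_char_0 mat \<Rightarrow> 'k list \<Rightarrow> nat \<Rightarrow> 'k poly" where
  "soliton_poly M \<kappa>s j = (\<Sum>i<dim_col M. Polynomial.smult (M $$ (j, i)) (omit_factor \<kappa>s i))"

lemma param_poly_nonzero [simp]: "param_poly \<kappa>s \<noteq> 0"
  by (simp add: param_poly_def)

lemma degree_param_poly: "degree (param_poly \<kappa>s) = length \<kappa>s"
  unfolding param_poly_def by (subst degree_prod_eq_sum_degree) auto

lemma poly_param_poly: "i < length \<kappa>s \<Longrightarrow> poly (param_poly \<kappa>s) (\<kappa>s ! i) = 0"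
  by (auto simp: param_poly_def poly_prod)

lemma param_poly_remove: "i < length \<kappa>s \<Longrightarrow> param_poly \<kappa>s = [:- (\<kappa>s ! i), 1:] * omit_factor \<kappa>s i"
  unfolding param_poly_def omit_factor_def by (rule prod.remove) auto

lemma poly_omit_factor:
  assumes "distinct \<kappa>s" "i < length \<kappa>s" "l < length \<kappa>s"
  shows "poly (omit_factor \<kappa>s i) (\<kappa>s ! l) = (if l = i then poly (pderiv (param_poly \<kappa>s)) (\<kappa>s ! i) else 0)"
proof (cases "l = i")
  case True
  have "poly (pderiv (param_poly \<kappa>s)) (\<kappa>s ! i) = poly (omit_factor \<kappa>s i) (\<kappa>s ! i)"
    unfolding param_poly_remove[OF assms(2)] pderiv_mult by (simp add: pderiv_pCons)
  with True show ?thesis by simp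
next
  case False
  then show ?thesis using assms by (auto simp: omit_factor_def poly_prod)
qed

lemma pderiv_param_poly_nonzero:
  assumes "distinct \<kappa>s" "i < length \<kappa>s"
  shows "poly (pderiv (param_poly \<kappa>s)) (\<kappa>s ! i) \<noteq> 0"
proof -
  have "poly (omit_factor \<kappa>s i) (\<kappa>s ! i) \<noteq> 0"
    using assms by (auto simp: omit_factor_def poly_prod nth_eq_iff_index_eq)
  then show ?thesis using poly_omit_factor[OF assms(1,2,2)] by simp
qed

lemma poly_soliton_poly:
  assumes "distinct \<kappa>s" "length \<kappa>s = dim_col M" "i < dim_col M"
  shows "poly (soliton_poly M \<kappa>s j) (\<kappa>s ! i) = poly (pderiv (param_poly \<kappa>s)) (\<kappa>s ! i) * M $$ (j, i)"
proof -
  have "poly (soliton_poly M \<kappa>s j) (\<kappa>s ! i) = (\<Sum>l<dim_col M. M $$ (j, l) * (if i = l then poly (pderiv (param_poly \<kappa>s)) (\<kappa>s ! i) else 0))"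
    unfolding soliton_poly_def poly_sum poly_smult
    using assms by (intro sum.cong) (auto simp: poly_omit_factor)
  then show ?thesis using assms by (simp add: if_distrib cong: if_cong)
qed

lemma degree_soliton_poly:
  assumes "length \<kappa>s = dim_col M" "soliton_poly M \<kappa>s j \<noteq> 0"
  shows "degree (soliton_poly M \<kappa>s j) < dim_col M"
proof -
  have "degree (Polynomial.smult (M $$ (j, i)) (omit_factor \<kappa>s i)) \<le> dim_col M - 1" if "i < dim_col M" for i
  proof -
    have "degree (omit_factor \<kappa>s i) = card ({..<length \<kappa>s} - {i})"
      unfolding omit_factor_def by (subst degree_prod_eq_sum_degree) auto
    then show ?thesis using assms that by simp
  qed
  then have "degree (soliton_poly M \<kappa>s j) \<le> dim_col M - 1"
    unfolding soliton_poly_def by (intro degree_sum_le) auto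
  moreover have "dim_col M > 0" using assms(2) by (cases "dim_col M") (auto simp: soliton_poly_def)
  ultimately show ?thesis by simp
qed

lemma dvd_if_vanishes_at_params:
  assumes "distinct \<kappa>s" "\<And>i. i < length \<kappa>s \<Longrightarrow> poly u (\<kappa>s ! i) = 0"
  shows "param_poly \<kappa>s dvd u"
proof -
  have "(\<Prod>i<m. [:- (\<kappa>s ! i), 1:]) dvd u" if "m \<le> length \<kappa>s" for m
    using that
  proof (induction m)
    case (Suc m)
    then obtain w where w: "u = (\<Prod>i<m. [:- (\<kappa>s ! i), 1:]) * w" by (auto elim: dvdE)
    have "poly (\<Prod>i<m. [:- (\<kappa>s ! i), 1:]) (\<kappa>s ! m) \<noteq> 0"
      using Suc.prems assms(1) by (auto simp: poly_prod nth_eq_iff_index_eq)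
    moreover have "poly u (\<kappa>s ! m) = 0" using assms(2) Suc.prems by simp
    ultimately have "poly w (\<kappa>s ! m) = 0" unfolding w by simp
    then obtain w' where "w = [:- (\<kappa>s ! m), 1:] * w'" unfolding poly_eq_0_iff_dvd by (rule dvdE)
    then have "u = (\<Prod>i<Suc m. [:- (\<kappa>s ! i), 1:]) * w'" using w by (simp only: prod.lessThan_Suc mult.assoc)
    then show ?case by (rule dvdI)
  qed simp
  then show ?thesis by (simp add: param_poly_def)
qed

lemma fls_shift_one_nonzero [simp]: "(fls_shift n 1 :: 'k::field fls) \<noteq> 0"
  using fls_X_intpow_nonzero[of "- n"] by simp

lemma soliton_embed_add: "soliton_embed M \<kappa>s (u + v) = soliton_embed M \<kappa>s u + soliton_embed M \<kappa>s v"
  by (simp add: soliton_embed_def poly_at_inf_add distrib_left add_divide_distrib)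

lemma soliton_embed_smult: "soliton_embed M \<kappa>s (Polynomial.smult c u) = fls_const c * soliton_embed M \<kappa>s u"
  by (simp add: soliton_embed_def poly_at_inf_smult mult_ac)

lemma soliton_embed_0 [simp]: "soliton_embed M \<kappa>s 0 = 0"
  by (simp add: soliton_embed_def poly_at_inf_0)

lemma soliton_embed_sum: "soliton_embed M \<kappa>s (\<Sum>i\<in>I. f i) = (\<Sum>i\<in>I. soliton_embed M \<kappa>s (f i))"
  by (induction I rule: infinite_finite_induct) (auto simp: soliton_embed_add)

lemma soliton_embed_eq_0_iff: "soliton_embed M \<kappa>s u = 0 \<longleftrightarrow> u = 0"
  by (simp add: soliton_embed_def poly_at_inf_eq_0_iff)

lemma subdegree_soliton_embed:
  assumes "u \<noteq> 0"
  shows "fls_subdegree (soliton_embed M \<kappa>s u) = int (length \<kappa>s) - int (degree u) - int (dim_row M)"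
proof -
  have nz: "poly_at_inf u \<noteq> 0" "poly_at_inf (param_poly \<kappa>s) \<noteq> 0" using assms by (auto simp: poly_at_inf_eq_0_iff)
  then have "fls_subdegree (soliton_embed M \<kappa>s u) =
    fls_subdegree (fls_X_intpow (- int (dim_row M)) * poly_at_inf u) - fls_subdegree (poly_at_inf (param_poly \<kappa>s))"
    unfolding soliton_embed_def by (intro fls_divide_subdegree) simp_all
  also have "\<dots> = int (length \<kappa>s) - int (degree u) - int (dim_row M)"
    using nz assms by (subst fls_subdegree_mult) (simp_all add: subdegree_poly_at_inf degree_param_poly)
  finally show ?thesis .
qed

lemma soliton_embed_param_mult:
  "soliton_embed M \<kappa>s (param_poly \<kappa>s * w) = fls_X_intpow (- int (dim_row M)) * poly_at_inf w"
proof -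
  have "poly_at_inf (param_poly \<kappa>s) \<noteq> 0" by (simp add: poly_at_inf_eq_0_iff)
  then show ?thesis by (simp add: soliton_embed_def poly_at_inf_mult)
qed

lemma soliton_basis_eq_low:
  assumes "length \<kappa>s = dim_col M" "j < dim_row M"
  shows "soliton_basis M \<kappa>s j = soliton_embed M \<kappa>s (soliton_poly M \<kappa>s j)"
proof -
  let ?k = "int (dim_row M)" and ?K = "poly_at_inf (param_poly \<kappa>s)"
  have K: "?K \<noteq> 0" by (simp add: poly_at_inf_eq_0_iff)
  have one: "fls_X_intpow (1 - ?k) * (fls_const m / (1 - fls_const (\<kappa>s ! i) * fls_X)) =
    soliton_embed M \<kappa>s (Polynomial.smult m (omit_factor \<kappa>s i))" if i: "i < dim_col M" for i m
  proof -
    let ?L = "poly_at_inf [:- (\<kappa>s ! i), 1:]"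
    have L: "?L \<noteq> 0" by (subst poly_at_inf_eq_0_iff) simp
    have KL: "?K = ?L * poly_at_inf (omit_factor \<kappa>s i)"
      using param_poly_remove[of i \<kappa>s] assms i by (metis poly_at_inf_mult)
    have N: "poly_at_inf (omit_factor \<kappa>s i) \<noteq> 0" using K KL by auto
    have X: "1 - fls_const (\<kappa>s ! i) * fls_X = fls_X * ?L"
      unfolding poly_at_inf_linear 
      using fls_X_intpow_times_fls_X_intpow[of 1 "-1", where ?'a = 'a]
      by (simp add: right_diff_distrib fls_X_conv_shift_1 fls_X_inv_conv_shift_1 mult.commute)
    have "fls_X_intpow (1 - ?k) = fls_X * (fls_X_intpow (- ?k) :: 'a fls)"
      using fls_X_intpow_times_fls_X_intpow[of 1 "- ?k", where ?'a = 'a]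
      unfolding fls_X_conv_shift_1 add_uminus_conv_diff by (rule sym)
    then have "fls_X_intpow (1 - ?k) * (fls_const m / (1 - fls_const (\<kappa>s ! i) * fls_X)) =
      (fls_X * fls_X_intpow (- ?k)) * (fls_const m / (fls_X * ?L))" unfolding X by simp
    also have "\<dots> = fls_X_intpow (- ?k) * fls_const m / ?L"
      using L by (simp add: field_simps)
    also have "\<dots> = fls_X_intpow (- ?k) * (fls_const m * poly_at_inf (omit_factor \<kappa>s i)) / ?K"
      unfolding KL using L N by (simp add: field_simps)
    finally show ?thesis unfolding soliton_embed_def poly_at_inf_smult .
  qed
  have "soliton_basis M \<kappa>s j = (\<Sum>i<dim_col M. fls_X_intpow (1 - ?k) * (fls_const (M $$ (j, i)) / (1 - fls_const (\<kappa>s ! i) * fls_X)))"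
    using assms by (simp add: soliton_basis_def sum_distrib_left)
  also have "\<dots> = (\<Sum>i<dim_col M. soliton_embed M \<kappa>s (Polynomial.smult (M $$ (j, i)) (omit_factor \<kappa>s i)))"
    by (intro sum.cong refl one) simp
  finally show ?thesis unfolding soliton_poly_def soliton_embed_sum .
qed

lemma soliton_basis_eq_high:
  "soliton_basis M \<kappa>s (dim_row M + i) = soliton_embed M \<kappa>s (param_poly \<kappa>s * monom 1 i)"
proof -
  have "fls_X_intpow (- int (dim_row M + i)) = fls_X_intpow (- int (dim_row M)) * (fls_X_intpow (- int i) :: 'a fls)"
    unfolding fls_X_intpow_times_fls_X_intpow by simp
  then show ?thesis
    unfolding soliton_embed_param_mult by (simp add: soliton_basis_def poly_at_inf_monom fls_X_inv_power_conv_shift_1)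
qed

lemma soliton_polys_decompose:
  assumes "distinct \<kappa>s" "length \<kappa>s = dim_col M" "u \<in> soliton_polys M \<kappa>s"
  shows "\<exists>c w. u = (\<Sum>j<dim_row M. Polynomial.smult (c j) (soliton_poly M \<kappa>s j)) + param_poly \<kappa>s * w"
proof -
  obtain c where c: "\<And>i. i < dim_col M \<Longrightarrow>
     poly u (\<kappa>s ! i) = poly (pderiv (param_poly \<kappa>s)) (\<kappa>s ! i) * (\<Sum>j<dim_row M. c j * M $$ (j, i))"
    using assms(3) by (auto simp: soliton_polys_def)
  let ?s = "\<Sum>j<dim_row M. Polynomial.smult (c j) (soliton_poly M \<kappa>s j)"
  have "param_poly \<kappa>s dvd u - ?s"
  proof (rule dvd_if_vanishes_at_params[OF assms(1)])
    fix i assume "i < length \<kappa>s"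
    then have i: "i < dim_col M" using assms by simp
    have "poly ?s (\<kappa>s ! i) = (\<Sum>j<dim_row M. c j * (poly (pderiv (param_poly \<kappa>s)) (\<kappa>s ! i) * M $$ (j, i)))"
      by (simp add: poly_sum poly_soliton_poly[OF assms(1,2) i])
    then show "poly (u - ?s) (\<kappa>s ! i) = 0" using c[OF i] by (simp add: sum_distrib_left mult_ac)
  qed
  then obtain w where "u - ?s = param_poly \<kappa>s * w" by (rule dvdE)
  then have "u = ?s + param_poly \<kappa>s * w" by (simp add: algebra_simps)
  then show ?thesis by blast
qed

lemma soliton_polys_compose:
  assumes "distinct \<kappa>s" "length \<kappa>s = dim_col M"
  shows "(\<Sum>j<dim_row M. Polynomial.smult (c j) (soliton_poly M \<kappa>s j)) + param_poly \<kappa>s * w \<in> soliton_polys M \<kappa>s"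
  unfolding soliton_polys_def
proof (intro CollectI exI allI impI)
  fix i assume i: "i < dim_col M"
  then show "poly ((\<Sum>j<dim_row M. Polynomial.smult (c j) (soliton_poly M \<kappa>s j)) + param_poly \<kappa>s * w) (\<kappa>s ! i) =
    poly (pderiv (param_poly \<kappa>s)) (\<kappa>s ! i) * (\<Sum>j<dim_row M. c j * M $$ (j, i))"
    using assms by (simp add: poly_sum poly_soliton_poly poly_param_poly sum_distrib_left mult_ac)
qed

lemma soliton_polys_add:
  assumes "u \<in> soliton_polys M \<kappa>s" "v \<in> soliton_polys M \<kappa>s" shows "u + v \<in> soliton_polys M \<kappa>s"
proof -
  obtain c d where "\<And>i. i < dim_col M \<Longrightarrow>
     poly u (\<kappa>s ! i) = poly (pderiv (param_poly \<kappa>s)) (\<kappa>s ! i) * (\<Sum>j<dim_row M. c j * M $$ (j, i))"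
     "\<And>i. i < dim_col M \<Longrightarrow>
     poly v (\<kappa>s ! i) = poly (pderiv (param_poly \<kappa>s)) (\<kappa>s ! i) * (\<Sum>j<dim_row M. d j * M $$ (j, i))"
    using assms unfolding soliton_polys_def by blast
  then show ?thesis unfolding soliton_polys_def
    by (intro CollectI exI[of _ "\<lambda>j. c j + d j"]) (simp add: sum.distrib algebra_simps)
qed

lemma soliton_polys_smult:
  assumes "u \<in> soliton_polys M \<kappa>s" shows "Polynomial.smult a u \<in> soliton_polys M \<kappa>s"
proof -
  obtain c where "\<And>i. i < dim_col M \<Longrightarrow>
     poly u (\<kappa>s ! i) = poly (pderiv (param_poly \<kappa>s)) (\<kappa>s ! i) * (\<Sum>j<dim_row M. c j * M $$ (j, i))"
    using assms unfolding soliton_polys_def by blast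
  then show ?thesis unfolding soliton_polys_def
    by (intro CollectI exI[of _ "\<lambda>j. a * c j"]) (simp add: sum_distrib_left mult_ac)
qed

lemma subspace_soliton_embed: "fls.subspace (soliton_embed M \<kappa>s ` soliton_polys M \<kappa>s)"
proof (rule fls.subspaceI)
  have "0 \<in> soliton_polys M \<kappa>s" unfolding soliton_polys_def by (intro CollectI exI[of _ "\<lambda>_. 0"]) simp
  then show "0 \<in> soliton_embed M \<kappa>s ` soliton_polys M \<kappa>s" using soliton_embed_0 by force
next
  fix f g assume "f \<in> soliton_embed M \<kappa>s ` soliton_polys M \<kappa>s" "g \<in> soliton_embed M \<kappa>s ` soliton_polys M \<kappa>s"
  then show "f + g \<in> soliton_embed M \<kappa>s ` soliton_polys M \<kappa>s"
    by (auto simp: soliton_embed_add[symmetric] intro: soliton_polys_add)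
next
  fix a f assume "f \<in> soliton_embed M \<kappa>s ` soliton_polys M \<kappa>s"
  then show "fls_scale a f \<in> soliton_embed M \<kappa>s ` soliton_polys M \<kappa>s"
    by (auto simp: fls_scale_def soliton_embed_smult[symmetric] intro: soliton_polys_smult)
qed

lemma poly_sum_monom: "(u :: 'k::field_char_0 poly) = (\<Sum>i\<le>degree u. Polynomial.smult (coeff u i) (monom 1 i))"
  by (simp only: smult_monom mult_1_right poly_as_sum_of_monoms)

text \<open>
  The first \<open>k\<close> basis vectors are the images of the numerators of the rows, and the powers of \<open>1/z\<close> that
  follow are the images of the multiples of \<open>K\<close>. Both kinds together span \<open>soliton_polys\<close>, because a
  polynomial that vanishes at all parameters is a multiple of \<open>K\<close>.
\<close>

lemma soliton_point_eq:
  assumes "distinct \<kappa>s" "length \<kappa>s = dim_col M"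
  shows "soliton_point M \<kappa>s = soliton_embed M \<kappa>s ` soliton_polys M \<kappa>s"
proof (intro equalityI)
  have "soliton_basis M \<kappa>s j \<in> soliton_embed M \<kappa>s ` soliton_polys M \<kappa>s" for j
  proof (cases "j < dim_row M")
    case True
    have "soliton_poly M \<kappa>s j \<in> soliton_polys M \<kappa>s"
      using soliton_polys_compose[OF assms, of "\<lambda>i. of_bool (i = j)" 0] True by (simp add: of_bool_def if_distrib[of "\<lambda>c. Polynomial.smult c _"] cong: if_cong)
    then show ?thesis using soliton_basis_eq_low[OF assms(2) True] by blast
  next
    case False
    have "param_poly \<kappa>s * monom 1 (j - dim_row M) \<in> soliton_polys M \<kappa>s"
      using soliton_polys_compose[OF assms, of "\<lambda>i. 0" "monom 1 (j - dim_row M)"] by simp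
    then show ?thesis using soliton_basis_eq_high[of M \<kappa>s "j - dim_row M"] False by auto
  qed
  then show "soliton_point M \<kappa>s \<subseteq> soliton_embed M \<kappa>s ` soliton_polys M \<kappa>s"
    unfolding soliton_point_def by (intro fls.span_minimal subspace_soliton_embed) auto
next
  show "soliton_embed M \<kappa>s ` soliton_polys M \<kappa>s \<subseteq> soliton_point M \<kappa>s"
  proof
    fix f assume "f \<in> soliton_embed M \<kappa>s ` soliton_polys M \<kappa>s"
    then obtain u where u: "f = soliton_embed M \<kappa>s u" "u \<in> soliton_polys M \<kappa>s" by auto
    obtain c w where cw: "u = (\<Sum>j<dim_row M. Polynomial.smult (c j) (soliton_poly M \<kappa>s j)) + param_poly \<kappa>s * w"
      using soliton_polys_decompose[OF assms u(2)] by blast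
    have "param_poly \<kappa>s * w = (\<Sum>i\<le>degree w. Polynomial.smult (coeff w i) (param_poly \<kappa>s * monom 1 i))"
      by (subst poly_sum_monom[of w]) (simp add: sum_distrib_left)
    then have w: "soliton_embed M \<kappa>s (param_poly \<kappa>s * w) = (\<Sum>i\<le>degree w. fls_scale (coeff w i) (soliton_basis M \<kappa>s (dim_row M + i)))"
      by (simp only: soliton_embed_sum soliton_embed_smult fls_scale_def soliton_basis_eq_high)
    have "f = (\<Sum>j<dim_row M. fls_scale (c j) (soliton_basis M \<kappa>s j)) + 
      (\<Sum>i\<le>degree w. fls_scale (coeff w i) (soliton_basis M \<kappa>s (dim_row M + i)))"
      unfolding u(1) cw soliton_embed_add soliton_embed_sum soliton_embed_smult w
      by (simp add: fls_scale_def soliton_basis_eq_low[OF assms(2)])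
    then show "f \<in> soliton_point M \<kappa>s" unfolding soliton_point_def
      by (simp only:) (intro fls.span_add fls.span_sum fls.span_scale fls.span_base rangeI)
  qed
qed

section \<open>Membership in the Sato Grassmannian\<close>

definition pole_order_below :: "nat \<Rightarrow> 'k::field_char_0 fls set" where
  "pole_order_below k = {f. \<forall>i \<le> - int k. fls_nth f i = 0}"

lemma pole_order_below_iff: "f \<in> pole_order_below k \<longleftrightarrow> f = 0 \<or> 1 - int k \<le> fls_subdegree f"
proof
  assume f: "f \<in> pole_order_below k"
  show "f = 0 \<or> 1 - int k \<le> fls_subdegree f"
  proof (cases "f = 0")
    case False
    then have "1 - int k \<le> fls_subdegree f"
      using f by (intro fls_subdegree_geI) (auto simp: pole_order_below_def)
    then show ?thesis ..
  qed simp
next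
  assume "f = 0 \<or> 1 - int k \<le> fls_subdegree f"
  then show "f \<in> pole_order_below k" by (auto simp: pole_order_below_def)
qed

lemma fls_nth_polar_part: "fls_nth (polar_part f) n = (if n \<le> 0 then fls_nth f n else 0)"
  unfolding polar_part_def
  by (subst nth_Abs_fls_lower_bound[of "fls_subdegree f"]) auto

lemma polar_part_linear: "Vector_Spaces.linear fls_scale fls_scale polar_part"
  by (intro Vector_Spaces.linear.intro module_hom.intro module_hom_axioms.intro fls.vector_space_axioms
      fls.module_axioms module_hom_iff_linear[THEN iffD1])
    (auto simp: fls_eq_iff fls_nth_polar_part fls_scale_def)

lemma polar_part_pole_order: "polar_part f \<in> pole_order_below k \<longleftrightarrow> f \<in> pole_order_below k"
  by (auto simp: pole_order_below_def fls_nth_polar_part)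

lemma subspace_pole_order_below: "fls.subspace (pole_order_below k)"
  by (auto simp: fls.subspace_def pole_order_below_def fls_scale_def)

lemma polar_monomials:
  shows "inj_on (\<lambda>i. fls_X_intpow (- int i) :: 'k::field_char_0 fls) {..<k} \<and>
    fls.independent ((\<lambda>i. fls_X_intpow (- int i) :: 'k fls) ` {..<k})"
proof (rule fls.independent_family)
  fix c assume *: "(\<Sum>i<k. fls_scale (c i) (fls_X_intpow (- int i) :: 'k fls)) = 0"
  show "\<forall>j\<in>{..<k}. c j = 0"
  proof
    fix j assume j: "j \<in> {..<k}"
    have "fls_nth (\<Sum>i<k. fls_scale (c i) (fls_X_intpow (- int i) :: 'k fls)) (- int j) = (\<Sum>i<k. c i * of_bool (i = j))"
      unfolding fls_nth_sum by (intro sum.cong) (auto simp: fls_scale_def)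
    then show "c j = 0" using * j by simp
  qed
qed simp

lemma polar_span_monomials:
  assumes "f \<in> pole_order_below k"
  shows "polar_part f \<in> fls.span ((\<lambda>i. fls_X_intpow (- int i)) ` {..<k})"
proof -
  have "polar_part f = (\<Sum>i<k. fls_scale (fls_nth f (- int i)) (fls_X_intpow (- int i)))"
  proof (rule fls_eqI)
    fix n
    have "fls_nth (\<Sum>i<k. fls_scale (fls_nth f (- int i)) (fls_X_intpow (- int i))) n = 
      (\<Sum>i<k. if n = - int i then fls_nth f n else 0)"
      unfolding fls_nth_sum by (intro sum.cong) (auto simp: fls_scale_def)
    also have "\<dots> = fls_nth (polar_part f) n"
    proof (cases "n \<le> 0 \<and> - int k < n")
      case True
      then have "(\<Sum>i<k. if n = - int i then fls_nth f n else 0) = (\<Sum>i<k. if nat (- n) = i then fls_nth f n else 0)"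
        by (intro sum.cong) auto
      moreover have "nat (- n) < k" using True by linarith
      ultimately show ?thesis using True by (simp add: fls_nth_polar_part)
    next
      case False
      then have "(\<Sum>i<k. if n = - int i then fls_nth f n else 0) = 0"
        by (intro sum.neutral) auto
      then show ?thesis using False assms by (auto simp: fls_nth_polar_part pole_order_below_def)
    qed
    finally show "fls_nth (polar_part f) n = fls_nth (\<Sum>i<k. fls_scale (fls_nth f (- int i)) (fls_X_intpow (- int i))) n" by simp
  qed
  then show ?thesis by (simp only:) (intro fls.span_sum fls.span_scale fls.span_base imageI)
qed

text \<open>
  Let \<open>F\<close> be the space of series with poles of order less than \<open>k\<close>. Since \<open>U\<close> and \<open>F\<close> span everything,
  kernel and cokernel of the polar part on \<open>U\<close> are those of a map from \<open>U \<inter> F\<close> to the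
  polar parts of \<open>F\<close>. Both of these spaces have dimension \<open>k\<close>, so kernel and cokernel have the
  same dimension.
\<close>

lemma sato_grassmannian_criterion:
  fixes U :: "'k::field_char_0 fls set"
  assumes U: "fls.subspace U"
    and B0: "finite B0" "fls.independent B0" "fls.span B0 = U \<inter> pole_order_below k" "card B0 = k"
    and surj: "\<And>v. \<exists>u\<in>U. v - u \<in> pole_order_below k"
  shows "U \<in> sato_grassmannian"
proof -
  interpret p: Vector_Spaces.linear fls_scale fls_scale "polar_part :: 'k fls \<Rightarrow> _" by (rule polar_part_linear)
  let ?F = "pole_order_below k :: 'k fls set"
  let ?X = "(\<lambda>i. fls_X_intpow (- int i) :: 'k fls) ` {..<k}"
  let ?N = "{f \<in> U. polar_part f = 0}"
  let ?ker = "{f. polar_part f = (0 :: 'k fls)}"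
  have X: "finite ?X" "card ?X = k" "fls.independent ?X" 
    using polar_monomials[where ?'k = 'k, of k] card_image[OF conjunct1[OF polar_monomials[where ?'k = 'k, of k]]] by auto
  have subF: "fls.subspace (U \<inter> ?F)" using U subspace_pole_order_below by (rule fls.subspace_inter)
  have ker: "fls.subspace ?ker" by (auto simp: fls.subspace_def p.add p.scale)
  have N: "fls.subspace ?N" 
  proof -
    have "?N = U \<inter> ?ker" by auto
    then show ?thesis using fls.subspace_inter[OF U ker] by (simp only:)
  qed
  have NF: "?N \<subseteq> U \<inter> ?F"
  proof
    fix f assume f: "f \<in> ?N"
    have "polar_part f \<in> ?F" using f fls.subspace_0[OF subspace_pole_order_below] by simp
    then show "f \<in> U \<inter> ?F" using f unfolding polar_part_pole_order by simp
  qed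
  obtain B where B: "B \<subseteq> ?N" "fls.independent B" "?N \<subseteq> fls.span B"
    using fls.maximal_independent_subset[of ?N] by blast
  have spB: "fls.span B = ?N" using B fls.span_minimal[OF B(1) N] by blast
  obtain B1 where B1: "quotient_basis fls_scale (U \<inter> ?F) ?ker B1"
    using fls.quotient_basis_exists[OF ker] by blast
  have B1': "B1 \<subseteq> U \<inter> ?F" "fls.independent B1" "fls.span B1 \<inter> ?ker = {0}"
    using B1 unfolding quotient_basis_def by blast+
  have memker: "polar_part x = 0 \<longleftrightarrow> x \<in> ?ker" for x by (rule mem_Collect_eq[symmetric])
  note q = B1[unfolded fls.quotient_basis_iff_image[OF polar_part_linear memker ker]]
  note C1 = q[THEN conjunct2, THEN conjunct1] q[THEN conjunct2, THEN conjunct2, THEN conjunct1]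
    q[THEN conjunct2, THEN conjunct2, THEN conjunct2]
  have "B \<subseteq> fls.span B0" "B1 \<subseteq> fls.span B0" unfolding B0(3) using B(1) NF B1'(1) by auto
  then have fin: "finite B" "finite B1"
    using fls.independent_span_bound[OF B0(1) B(2)] fls.independent_span_bound[OF B0(1) B1'(2)] by simp_all
  have "fls.span B \<inter> fls.span B1 = {0}" using spB B1'(3) fls.span_zero by blast
  then have ind: "fls.independent (B \<union> B1)"
    by (rule fls.independent_Un_if_spans_disjoint[OF fin(2) B(2) B1'(2)])
  have disj: "B \<inter> B1 = {}"
  proof (rule ccontr)
    assume "B \<inter> B1 \<noteq> {}"
    then obtain x where x: "x \<in> B" "x \<in> B1" by blast
    have "x \<in> fls.span B \<inter> fls.span B1" by (intro IntI fls.span_base x)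
    then have "x = 0" unfolding \<open>fls.span B \<inter> fls.span B1 = {0}\<close> by simp
    then show False using B(2) fls.dependent_zero[of B] x(1) by simp
  qed
  have "U \<inter> ?F \<subseteq> fls.span (B \<union> B1)"
  proof
    fix x assume x: "x \<in> U \<inter> ?F"
    then have "polar_part x \<in> polar_part ` fls.span B1" using C1(3) by (auto simp: p.span_image)
    then obtain y where y: "y \<in> fls.span B1" "polar_part x = polar_part y" by auto
    have "y \<in> U" using y(1) fls.span_minimal[OF B1'(1) subF] by auto
    then have "x - y \<in> fls.span B" unfolding spB using x y(2) fls.subspace_diff[OF U] by (simp add: p.diff)
    then have "(x - y) + y \<in> fls.span (B \<union> B1)" unfolding fls.span_Un using y(1) by blast
    then show "x \<in> fls.span (B \<union> B1)" by simp
  qed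
  moreover have "fls.span (B \<union> B1) \<subseteq> U \<inter> ?F" using B(1) NF B1'(1) by (intro fls.span_minimal subF) auto
  ultimately have "fls.span (B \<union> B1) = fls.span B0" unfolding B0(3) by (intro equalityI)
  then have "card (B \<union> B1) = k" using fls.basis_card_unique[OF B0(2,1) ind] B0(4) by simp
  then have cardB: "card B + card B1 = k" using fin disj by (simp add: card_Un_disjoint)

  let ?G = "polar_part ` ?F"
  have pU: "fls.subspace (polar_part ` U)" using U by (rule p.subspace_image)
  obtain C where C: "quotient_basis fls_scale ?G (polar_part ` U) C"
    using fls.quotient_basis_exists[OF pU] by blast
  then have C': "C \<subseteq> ?G" "fls.independent C" "fls.span C \<inter> polar_part ` U = {0}" "?G \<subseteq> fls.span (C \<union> polar_part ` U)"
    unfolding quotient_basis_def by blast+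
  \<comment> \<open>rank and nullity: \<open>B\<close> and \<open>B1\<close> make up a basis of \<open>U \<inter> F\<close>, \<open>C1\<close> and \<open>C\<close> one of the polar parts of \<open>F\<close>\<close>
  let ?C1 = "polar_part ` B1"
  have GX: "?G \<subseteq> fls.span ?X" using polar_span_monomials by blast
  have subG: "fls.subspace ?G" using subspace_pole_order_below by (rule p.subspace_image)
  have XG: "?X \<subseteq> ?G"
  proof
    fix x assume "x \<in> ?X"
    then obtain i where i: "i < k" "x = fls_X_intpow (- int i)" by auto
    then have "polar_part x = x" by (intro fls_eqI) (auto simp: fls_nth_polar_part)
    moreover have "x \<in> ?F" using i by (auto simp: pole_order_below_def)
    ultimately show "x \<in> ?G" by force
  qed
  have spX: "fls.span ?X = ?G" using GX fls.span_minimal[OF XG subG] by blast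
  have finC: "finite C" using fls.independent_span_bound[OF X(1) C'(2)] C'(1) GX by auto
  have spC1: "fls.span ?C1 \<subseteq> polar_part ` U" using B1'(1) by (intro fls.span_minimal pU) auto
  have CC1: "fls.span ?C1 \<inter> fls.span C = {0}" using C'(3) spC1 fls.span_zero by blast
  have indC: "fls.independent (?C1 \<union> C)"
    by (rule fls.independent_Un_if_spans_disjoint[OF finC C1(2) C'(2) CC1])
  have disjC: "?C1 \<inter> C = {}"
  proof (rule ccontr)
    assume "?C1 \<inter> C \<noteq> {}"
    then obtain x where x: "x \<in> ?C1" "x \<in> C" by blast
    have "x \<in> fls.span ?C1 \<inter> fls.span C" by (intro IntI fls.span_base x)
    then have "x = 0" unfolding CC1 by simp
    then show False using C'(2) fls.dependent_zero[of C] x(2) by simp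
  qed
  have G_sub: "?G \<subseteq> fls.span (?C1 \<union> C)"
  proof
    fix g assume g: "g \<in> ?G"
    have pUs: "fls.span (polar_part ` U) = polar_part ` U" using pU by simp
    have "g \<in> fls.span (C \<union> polar_part ` U)" by (rule subsetD[OF C'(4) g])
    then obtain c w where cw: "g = c + w" "c \<in> fls.span C" "w \<in> polar_part ` U"
      unfolding fls.span_Un pUs by blast
    have "c \<in> ?G" using cw(2) fls.span_minimal[OF C'(1) subG] by blast
    then have "g - c \<in> ?G" using g fls.subspace_diff[OF subG] by blast
    then have wG: "w \<in> ?G" using cw(1) by simp
    obtain u where u: "w = polar_part u" "u \<in> U" using cw(3) by auto
    have "w \<in> ?F" using wG polar_part_pole_order by auto
    then have "u \<in> U \<inter> ?F" using u polar_part_pole_order by auto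
    then have "w \<in> fls.span ?C1" using C1(3) u(1) by blast
    then show "g \<in> fls.span (?C1 \<union> C)" 
      unfolding fls.span_Un using cw(1,2) by (intro CollectI exI[of _ w] exI[of _ c]) (simp add: add.commute)
  qed
  have "?C1 \<subseteq> ?G" using B1'(1) by auto
  then have "fls.span (?C1 \<union> C) \<subseteq> ?G" using C'(1) by (intro fls.span_minimal subG) auto
  then have "fls.span (?C1 \<union> C) = fls.span ?X" unfolding spX using G_sub by (rule equalityI)
  then have "card (?C1 \<union> C) = k" using fls.basis_card_unique[OF X(3,1) indC] X(2) by simp
  then have "card ?C1 + card C = k" using fin finC disjC by (simp add: card_Un_disjoint)
  then have cardC: "card C = card B" using cardB C1(1) by (simp add: card_image)

  have "quotient_basis fls_scale ?N {0} B"
    using B spB fls.span_zero fls.span_mono[of B "B \<union> {0}"] by (auto simp: quotient_basis_def)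
  moreover have "quotient_basis fls_scale (range polar_part) (polar_part ` U) C"
    unfolding quotient_basis_def
  proof (intro conjI)
    show "range polar_part \<subseteq> fls.span (C \<union> polar_part ` U)"
    proof
      fix x :: "'k fls" assume "x \<in> range polar_part"
      then obtain v where v: "x = polar_part v" by auto
      obtain u where u: "u \<in> U" "v - u \<in> ?F" using surj by blast
      have "polar_part (v - u) \<in> fls.span (C \<union> polar_part ` U)" using u(2) C'(4) by blast
      moreover have "polar_part u \<in> fls.span (C \<union> polar_part ` U)" using u(1) by (intro fls.span_base) auto
      ultimately have "polar_part (v - u) + polar_part u \<in> fls.span (C \<union> polar_part ` U)" by (rule fls.span_add)
      then show "x \<in> fls.span (C \<union> polar_part ` U)" unfolding v by (simp add: p.diff)
    qed
  qed (use C' in auto)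
  ultimately show ?thesis unfolding sato_grassmannian_def
    using U fin(1) finC cardC by (intro CollectI conjI exI[of _ B] exI[of _ C]) auto
qed

section \<open>Matrices with independent rows\<close>

text \<open>
  If the columns span less than the whole space, fewer than \<open>dim_row M\<close> of them span the same
  subspace. Written as rows and filled up with zero rows they form a singular matrix, whose kernel
  gives a relation between the rows of \<open>M\<close>.
\<close>

lemma rank_eq_dim_row_if_rows_independent:
  fixes M :: "'k::field mat"
  assumes rows: "\<And>c. (\<And>i. i < dim_col M \<Longrightarrow> (\<Sum>j<dim_row M. c j * M $$ (j, i)) = 0) \<Longrightarrow> \<forall>j<dim_row M. c j = 0"
  shows "vec_space.rank (dim_row M) M = dim_row M"
proof -
  let ?n = "dim_row M"
  interpret vec_space "TYPE('k)" ?n .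
  have cM: "M \<in> carrier_mat ?n (dim_col M)" by simp
  have colsC: "set (cols M) \<subseteq> carrier_vec ?n" using cols_dim by blast
  obtain S where S: "maximal S (\<lambda>T. T \<subseteq> set (cols M) \<and> lin_indpt T)" "finite S"
    using maximal_exists_superset[of "set (cols M)" "\<lambda>T. T \<subseteq> set (cols M) \<and> lin_indpt T" "{}"]
    by (auto simp: lin_dep_def)
  then have S': "S \<subseteq> set (cols M)" "lin_indpt S" by (auto simp: maximal_def)
  have SC: "S \<subseteq> carrier_vec ?n" by (rule subset_trans[OF S'(1) colsC])
  have rank: "rank M = card S" by (rule rank_card_indpt[OF cM S(1)])
  have le: "card S \<le> ?n" using li_le_dim(2)[OF fin_dim _ S'(2)] SC by (simp add: dim_is_n)
  have "\<not> card S < ?n"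
  proof
    assume lt: "card S < ?n"
    obtain ss where ss: "set ss = S" "distinct ss" using finite_distinct_list[OF S(2)] by blast
    then have len: "length ss = card S" using distinct_card by metis
    \<comment> \<open>the zero rows make the matrix square and singular\<close>
    let ?vs = "ss @ replicate (?n - card S) (0\<^sub>v ?n)"
    let ?N = "mat_of_rows ?n ?vs"
    have lenvs: "length ?vs = ?n" using len lt by simp
    have vsC: "set ?vs \<subseteq> carrier_vec ?n" using SC ss by auto
    have NC: "?N \<in> carrier_mat ?n ?n" using mat_of_rows_carrier(1)[of ?n ?vs] unfolding lenvs .
    have NC': "?N\<^sup>T \<in> carrier_mat ?n ?n" by (rule transpose_carrier_mat[THEN iffD2, OF NC])
    have "?N\<^sup>T *\<^sub>v unit_vec ?n (?n - 1) = 0\<^sub>v ?n"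
    proof (rule eq_vecI)
      fix i assume "i < dim_vec (0\<^sub>v ?n :: 'k vec)"
      then have i: "i < ?n" by simp
      have "\<not> ?n - 1 < length ss" "?n - 1 - length ss < ?n - card S" using len lt by linarith+
      then have "?vs ! (?n - 1) = 0\<^sub>v ?n" by (simp only: nth_append nth_replicate if_False)
      then have N0: "?N $$ (?n - 1, i) = 0" using i lt lenvs by (subst mat_of_rows_index) auto
      have n1: "?n - 1 < ?n" using lt by linarith
      have "(?N\<^sup>T *\<^sub>v unit_vec ?n (?n - 1)) $ i = col ?N i \<bullet> unit_vec ?n (?n - 1)"
        using i NC NC' by (subst index_mult_mat_vec) (auto simp del: length_append length_replicate)
      also have "\<dots> = col ?N i $ (?n - 1)"
        by (rule scalar_prod_right_unit[OF n1])
      also have "\<dots> = ?N $$ (?n - 1, i)" using i n1 NC by (intro index_col) (auto simp only: carrier_matD)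
      finally show "(?N\<^sup>T *\<^sub>v unit_vec ?n (?n - 1)) $ i = 0\<^sub>v ?n $ i" using N0 i by simp
    qed (use NC' in simp)
    moreover have "unit_vec ?n (?n - 1) \<noteq> (0\<^sub>v ?n :: 'k vec)" using lt by simp
    ultimately have "det ?N\<^sup>T = 0"
      unfolding det_0_iff_vec_prod_zero_field[OF NC'] by (intro exI[of _ "unit_vec ?n (?n - 1)"] conjI unit_vec_carrier)
    then have "det ?N = 0" using det_transpose[OF NC] by simp
    then obtain v where v: "v \<in> carrier_vec ?n" "v \<noteq> 0\<^sub>v ?n" "?N *\<^sub>v v = 0\<^sub>v ?n"
      using det_0_iff_vec_prod_zero_field[OF NC] by blast
    let ?W = "{w \<in> carrier_vec ?n. v \<bullet> w = 0}"
    have SW: "S \<subseteq> ?W"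
    proof
      fix s assume s: "s \<in> S"
      obtain i where i: "i < length ss" "ss ! i = s" using s ss by (auto simp: in_set_conv_nth)
      have "i < ?n" using i len lt by simp
      then have "row ?N i \<bullet> v = 0" 
      proof -
        have "dim_row ?N = ?n" using NC by (rule carrier_matD(1))
        then have "vec_index (?N *\<^sub>v v) i = row ?N i \<bullet> v" using \<open>i < ?n\<close> by (intro index_mult_mat_vec) simp
        then show ?thesis using \<open>i < ?n\<close> unfolding v(3) by simp
      qed
      moreover have "row ?N i = s"
      proof -
        have "?vs ! i = s" using i by (simp add: nth_append)
        then show ?thesis using mat_of_rows_row[of i ?vs ?n] lenvs \<open>i < ?n\<close> SC s by auto
      qed
      ultimately show "s \<in> ?W" using v SC s comm_scalar_prod[of s ?n v] by auto
    qed
    have subW: "submodule class_ring ?W V"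
    proof (rule submodule.intro)
      show "module class_ring V" by (rule module_axioms)
      show "?W \<subseteq> carrier V" by simp
      show "x \<oplus>\<^bsub>V\<^esub> y \<in> ?W" if "x \<in> ?W" "y \<in> ?W" for x y
        using that scalar_prod_add_distrib[OF v(1), of x y] by simp
      show "\<zero>\<^bsub>V\<^esub> \<in> ?W" using v(1) by simp
      show "c \<odot>\<^bsub>V\<^esub> x \<in> ?W" if "c \<in> carrier class_ring" "x \<in> ?W" for c x
        using that scalar_prod_smult_distrib[OF v(1), of x c] by simp
    qed
    have spanW: "span S \<subseteq> ?W" by (rule span_is_subset[OF SW subW])
    have "v \<bullet> w = 0" if w: "w \<in> set (cols M)" for w
    proof (cases "w \<in> S")
      case True
      then show ?thesis using SW by auto
    next
      case False
      have wC: "w \<in> carrier_vec ?n" by (rule subsetD[OF colsC w])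
      have "lin_dep (S \<union> {w})"
      proof (rule ccontr)
        assume "\<not> lin_dep (S \<union> {w})"
        then have "S \<subseteq> S \<union> {w} \<and> (S \<union> {w} \<subseteq> set (cols M) \<and> lin_indpt (S \<union> {w}))"
          using S'(1) w by (intro conjI) auto
        then have "S \<union> {w} = S" by (rule S(1)[unfolded maximal_def, THEN conjunct2, rule_format])
        with False show False by auto
      qed
      then have "w \<in> span S" using lin_dep_iff_in_span[of S w] SC S'(2) wC False by simp
      then show ?thesis using spanW by auto
    qed
    then have "v \<bullet> col M i = 0" if "i < dim_col M" for i using that by (simp add: cols_def)
    then have "(\<Sum>j<?n. v $ j * M $$ (j, i)) = 0" if "i < dim_col M" for i
      using that unfolding scalar_prod_def by (simp add: lessThan_atLeast0)
    then have "\<forall>j<?n. v $ j = 0" by (rule rows)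
    then have "v = 0\<^sub>v ?n" using v(1) by (intro eq_vecI) auto
    then show False using v(2) by simp
  qed
  then show ?thesis using rank le by simp
qed

section \<open>Splitting off the component of the marked point\<close>

lemma germs_cong:
  assumes "\<And>u. u \<in> x \<Longrightarrow> E u = E' u" shows "germs Y E x = germs Y E' x"
proof -
  have "(\<forall>(c, y)\<in>x. f c \<in> stalk (E (c, y)) y) \<longleftrightarrow> (\<forall>(c, y)\<in>x. f c \<in> stalk (E' (c, y)) y)" for f
    using assms by (intro ball_cong refl) (simp add: case_prod_unfold)
  then show ?thesis by (simp add: germs_def)
qed

text \<open>
  The curve \<open>X'\<close> consists of all components except the component \<open>0\<close> of the marked point. The
  nodes of \<open>X\<close> are nodes of \<open>X'\<close>, or nodes of the component \<open>0\<close>, or crossings of the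
  two, and a crossing gives a smooth point of \<open>X'\<close>.
\<close>

locale split_curve =
  fixes X X' :: "'k::field_char_0 curve" and r :: nat and D D' :: "'k divisor"
  assumes nodal: "nodal_curve X" and comps: "comps X = {0..r}"
    and marked: "(0, Infty) \<in> smooth_points X" and D: "divisor_on X D"
    and X'_def: "X' = subcurve X {1..r}" and D'_def: "D' = restrict_div D {1..r}"
begin

lemma comps': "comps X' = {1..r}" and nodes': "nodes X' = {x \<in> nodes X. fst ` x \<subseteq> {1..r}}"
  by (simp_all add: X'_def subcurve_def)

lemma nodal': "nodal_curve X'"
  using nodal unfolding nodal_curve_def comps' nodes' comps
  by (auto simp: pairwise_def subset_iff image_iff)

lemma node_cases:
  assumes x: "x \<in> nodes X"
  obtains (away) "x \<in> nodes X'" "\<And>c y. (c, y) \<in> x \<Longrightarrow> c \<noteq> 0"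
    | (crossing) y u where "x = {(0, y), u}" "fst u \<noteq> 0" "fst u \<in> {1..r}"
    | (inner) "x \<notin> nodes X'" "\<And>c y. (c, y) \<in> x \<Longrightarrow> c = 0"
proof -
  have sub: "c \<in> {0..r}" if "(c, y) \<in> x" for c y using nodal_curveD(4)[OF nodal x that] comps by simp
  obtain v w where vw: "x = {v, w}" "v \<noteq> w" using nodal_curveD(3)[OF nodal x] by (auto simp: card_2_iff)
  obtain c y where v: "v = (c, y)" by (cases v)
  obtain c' y' where w: "w = (c', y')" by (cases w)
  have cc: "c \<in> {0..r}" "c' \<in> {0..r}" using sub vw v w by auto
  show ?thesis
  proof (cases "c = 0")
    case True
    show ?thesis
    proof (cases "c' = 0")
      case True
      then show ?thesis using \<open>c = 0\<close> vw v w by (intro inner) (auto simp: nodes')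
    next
      case False
      then show ?thesis using \<open>c = 0\<close> vw v w cc by (intro crossing[of y w]) auto
    qed
  next
    case False
    show ?thesis
    proof (cases "c' = 0")
      case True
      then show ?thesis using \<open>c \<noteq> 0\<close> vw v w cc by (intro crossing[of y' v]) auto
    next
      case False
      then show ?thesis using \<open>c \<noteq> 0\<close> vw v w cc x by (intro away) (auto simp: nodes')
    qed
  qed
qed

lemma node'_away: "x \<in> nodes X' \<Longrightarrow> (c, y) \<in> x \<Longrightarrow> c \<noteq> 0 \<and> c \<in> {1..r}"
  unfolding nodes' by force

lemma node'_node: "x \<in> nodes X' \<Longrightarrow> x \<in> nodes X"
  unfolding nodes' by simp

lemma crossing_smooth':
  assumes x: "{(0, y), u} \<in> nodes X" and u: "fst u \<noteq> 0"
  shows "u \<in> smooth_points X'" "u \<notin> smooth_points X" "snd u \<in> rational_places" "fst u \<in> {1..r}"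
proof -
  obtain c z where cz: "u = (c, z)" by (cases u)
  have *: "c \<in> {0..r}" "z \<in> rational_places" using nodal_curveD(4)[OF nodal x, of c z] cz comps by auto
  show "snd u \<in> rational_places" "fst u \<in> {1..r}" using * cz u by auto
  show "u \<notin> smooth_points X" using node_not_smooth[OF x] by simp
  have "u \<notin> x'" if x': "x' \<in> nodes X'" for x'
  proof
    assume "u \<in> x'"
    then have "x' = {(0, y), u}" using nodal_curveD(5)[OF nodal node'_node[OF x'] x] by simp
    then show False using node'_away[OF x', of 0 y] by simp
  qed
  then show "u \<in> smooth_points X'" using * cz u rational_places_closed by (auto simp: smooth_points_def comps')
qed

lemma smooth_smooth': "u \<in> smooth_points X \<Longrightarrow> fst u \<noteq> 0 \<Longrightarrow> u \<in> smooth_points X'"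
  by (auto simp: smooth_points_def comps comps' nodes')

lemma smooth'_cases:
  assumes u: "u \<in> smooth_points X'"
  obtains (smooth) "u \<in> smooth_points X" "fst u \<noteq> 0" | (crossing) y where "{(0, y), u} \<in> nodes X" "fst u \<noteq> 0"
proof -
  have u0: "fst u \<noteq> 0" "u \<in> {1..r} \<times> closed_places" using u by (auto simp: smooth_points_def comps')
  show ?thesis
  proof (cases "u \<in> smooth_points X")
    case False
    then obtain x where x: "x \<in> nodes X" "u \<in> x" using u0 by (auto simp: smooth_points_def comps)
    from x(1) show ?thesis
    proof (cases rule: node_cases)
      case away
      then show ?thesis using u x node_not_smooth by blast
    next
      case (crossing y w)
      then show ?thesis using that(2)[of y] x u0 by auto
    next
      case inner
      then show ?thesis using x u0 by (cases u) auto
    qed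
  qed (use that(1) u0 in simp)
qed

lemma smooth'_closed: "u \<in> smooth_points X' \<Longrightarrow> snd u \<in> closed_places \<and> fst u \<in> {1..r} \<and> fst u \<noteq> 0"
  by (auto simp: smooth_points_def comps')

lemma D'_eq: "fst u \<noteq> 0 \<Longrightarrow> D' u = D u"
proof (cases "fst u \<in> {1..r}")
  case False
  assume "fst u \<noteq> 0"
  with False have "u \<notin> smooth_points X" by (auto simp: smooth_points_def comps)
  then have "D u = 0" using D by (auto simp: divisor_on_def)
  with False show ?thesis by (simp add: D'_def restrict_div_def)
qed (simp add: D'_def restrict_div_def)

lemma divisor_on': "divisor_on X' D'"
  unfolding divisor_on_def
proof
  have sub: "{u. D' u \<noteq> 0} \<subseteq> {u. D u \<noteq> 0}" by (auto simp: D'_def restrict_div_def)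
  then show "finite {u. D' u \<noteq> 0}" using D finite_subset by (auto simp: divisor_on_def)
  show "{u. D' u \<noteq> 0} \<subseteq> smooth_points X'"
  proof
    fix u assume u: "u \<in> {u. D' u \<noteq> 0}"
    then have "fst u \<noteq> 0" by (auto simp: D'_def restrict_div_def split: if_splits)
    moreover have "u \<in> smooth_points X" using sub u D by (auto simp: divisor_on_def)
    ultimately show "u \<in> smooth_points X'" by (rule smooth_smooth'[rotated])
  qed
qed

abbreviation Dn :: "nat \<Rightarrow> 'k divisor" where "Dn n \<equiv> add_multiple D n (0, Infty)"

lemma divisor_on_Dn: "divisor_on X (Dn n)"
proof -
  have "Dn n = shift_div D (int n) (0, Infty)" by (simp add: add_multiple_def shift_div_def)
  then show ?thesis using divisor_on_shift[OF D marked] by simp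
qed

lemma Dn_away: "c \<noteq> 0 \<Longrightarrow> Dn n (c, y) = D' (c, y)"
  using D'_eq[of "(c, y)"] by (simp add: add_multiple_def)

lemma crossing_divisor_0:
  assumes "{(0, y), u} \<in> nodes X" "fst u \<noteq> 0" shows "D' u = 0"
  using divisor_on_node[OF D assms(1), of u] D'_eq[OF assms(2)] by simp

text \<open>
  A repartition on \<open>X'\<close> is extended by zero to the component \<open>0\<close>. What solves the extended problem
  also solves the given one after restriction, since at a crossing \<open>X'\<close> imposes fewer
  conditions than \<open>X\<close>.
\<close>

lemma H1_vanishes_restrict:
  assumes "H1_vanishes X (Dn n)"
  shows "H1_vanishes X' D'"
  unfolding H1_vanishes_def
proof
  fix s assume s: "s \<in> adeles X'"
  define t where "t = (\<lambda>x c. if c = 0 then 0 else s (x \<inter> {u. fst u \<noteq> 0}) c)"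
  have t_away: "t x c = s x c" if "c \<noteq> 0" "\<And>c y. (c, y) \<in> x \<Longrightarrow> c \<noteq> 0" for x c
  proof -
    have "x \<inter> {u. fst u \<noteq> 0} = x" using that(2) by auto
    then show ?thesis using that(1) by (simp add: t_def)
  qed
  have "{x \<in> points X. t x \<notin> germs X (\<lambda>_. 0) x} \<subseteq> nodes X \<union> {x \<in> points X'. s x \<notin> germs X' (\<lambda>_. 0) x}"
  proof
    fix x assume x: "x \<in> {x \<in> points X. t x \<notin> germs X (\<lambda>_. 0) x}"
    have "x \<in> {x \<in> points X'. s x \<notin> germs X' (\<lambda>_. 0) x}" if not_node: "x \<notin> nodes X"
    proof -
      obtain u where u: "x = {u}" "u \<in> smooth_points X" using x not_node by (auto simp: points_def)
      obtain c y where cy: "u = (c, y)" by (cases u)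
      have y: "y \<in> closed_places" using u cy by (auto simp: smooth_points_def)
      have tx: "t x c \<notin> local_ring y" using x u cy not_node by (auto simp: germs_def)
      have c: "c \<noteq> 0"
      proof
        assume "c = 0"
        then have "t x c = 0" by (simp add: t_def)
        then show False using tx local_ring_0[OF y] by simp
      qed
      have "u \<in> smooth_points X'" using smooth_smooth'[OF u(2)] c cy by simp
      then have "x \<in> points X'" using u smooth_point_in_points by blast
      moreover have "s x c \<notin> local_ring y" using tx t_away[of c x] c u cy by simp
      ultimately show ?thesis using u cy by (auto simp: germs_def)
    qed
    then show "x \<in> nodes X \<union> {x \<in> points X'. s x \<notin> germs X' (\<lambda>_. 0) x}" by blast
  qed
  moreover have "finite (nodes X \<union> {x \<in> points X'. s x \<notin> germs X' (\<lambda>_. 0) x})"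
    using nodal_curveD(2)[OF nodal] s by (simp add: adeles_def)
  ultimately have "t \<in> adeles X" unfolding adeles_def using finite_subset by blast
  then have "t \<in> coboundaries X (Dn n)" using assms unfolding H1_vanishes_def by (rule subsetD[rotated])
  then obtain f a where fa: "t = (\<lambda>x. f) + a" "a \<in> adeles_bounded X (Dn n)"
    and f_rat: "f \<in> rational_functions X"
    unfolding coboundaries_def by blast
  have ta: "a x c = t x c - f c" for x c unfolding fa(1) by simp
  define f' where "f' c = (if c = 0 then 0 else f c)" for c
  have "f' \<in> rational_functions X'"
    using f_rat by (auto simp: rational_functions_def f'_def comps comps')
  moreover have "s - (\<lambda>x. f') \<in> adeles_bounded X' D'"
    unfolding adeles_bounded_def
  proof (intro CollectI ballI)
    fix x assume x: "x \<in> points X'"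
    show "(s - (\<lambda>x. f')) x \<in> germs X' D' x"
    proof (cases "x \<in> nodes X'")
      case True
      have xX: "x \<in> nodes X" by (rule node'_node[OF True])
      have eq: "(s - (\<lambda>x. f')) x c = a x c" if "(c, y) \<in> x" for c y
        using node'_away[OF True] that ta[of x c] t_away[of c x] by (auto simp: f'_def)
      have "a x \<in> germs X (Dn n) x" using fa(2) xX by (simp add: adeles_bounded_def points_def)
      then have "\<forall>(c, y)\<in>x. a x c \<in> stalk (Dn n (c, y)) y" "\<exists>v. \<forall>(c, y)\<in>x. has_value y (a x c) v"
        using xX by (auto simp: germs_def)
      moreover have "Dn n (c, y) = D' (c, y)" if "(c, y) \<in> x" for c y
        using Dn_away node'_away[OF True that] by simp
      ultimately show ?thesis unfolding germs_def using eq by (simp add: case_prod_unfold) (metis prod.collapse)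
    next
      case False
      then obtain u where u: "x = {u}" "u \<in> smooth_points X'" using x by (auto simp: points_def)
      obtain c y where cy: "u = (c, y)" by (cases u)
      have c: "c \<noteq> 0" using smooth'_closed[OF u(2)] cy by simp
      have "s x c - f' c \<in> stalk (D' u) y"
        using u(2)
      proof (cases rule: smooth'_cases)
        case smooth
        then have "a x \<in> germs X (Dn n) x"
          using fa(2) u smooth_point_in_points[OF smooth(1)] by (simp add: adeles_bounded_def)
        then have "a x c \<in> stalk (D' u) y" using u cy Dn_away[OF c] by (auto simp: germs_def)
        then show ?thesis using ta[of x c] t_away[of c x] c u cy by (simp add: f'_def)
      next
        case (crossing z)
        let ?x = "{(0, z), u}"
        have "a ?x \<in> germs X (Dn n) ?x" using fa(2) crossing by (auto simp: adeles_bounded_def points_def)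
        then have "a ?x c \<in> stalk (D' u) y" using cy Dn_away[OF c] by (auto simp: germs_def)
        moreover have "t ?x c = s x c"
        proof -
          have "?x \<inter> {u. fst u \<noteq> 0} = x" using crossing u by auto
          then show ?thesis using c by (simp add: t_def)
        qed
        ultimately show ?thesis using ta[of ?x c] c by (simp add: f'_def)
      qed
      then show ?thesis using u cy False by (simp add: germs_def)
    qed
  qed
  moreover have "s = (\<lambda>x. f') + (s - (\<lambda>x. f'))" by (simp add: fun_eq_iff)
  ultimately show "s \<in> coboundaries X' D'" unfolding coboundaries_def by blast
qed

lemma value_at_crossing:
  assumes x: "{(0, y), u} \<in> nodes X" "fst u \<noteq> 0" and f: "f \<in> stalk (D' u) (snd u)"
  shows "\<exists>v. has_value (snd u) f v"
  using has_value_exists[OF crossing_smooth'(3)[OF x]] f crossing_divisor_0[OF x] by simp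

text \<open>
  The problem is first solved on \<open>X'\<close>. The errors at the crossings then have values there, and the large degree
  on the component \<open>0\<close> allows a solution whose errors have the same values.
\<close>

lemma H1_vanishes_extend:
  assumes H1: "H1_vanishes X' D'" 
    and n: "place_div_degree (\<lambda>y. Dn n (0, y)) \<ge> int (card (branches X 0)) - 1"
  shows "H1_vanishes X (Dn n)"
  unfolding H1_vanishes_def
proof
  fix t assume t: "t \<in> adeles X"
  \<comment> \<open>the point of \<open>X\<close> under a point of \<open>X'\<close>, which is a crossing or the same point\<close>
  define over where "over x = (if x \<in> points X then x else SOME x'. x' \<in> nodes X \<and> x \<subseteq> x')" for x :: "'k pnt set"
  have over_points: "over x = x" if "x \<in> points X" for x using that by (simp add: over_def)
  have over_crossing: "over {u} = {(0, y), u}" if x: "{(0, y), u} \<in> nodes X" "fst u \<noteq> 0" for y u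
  proof -
    have "{u} \<notin> points X"
      using crossing_smooth'(2)[OF x] singleton_not_node[OF nodal, of u] by (auto simp: points_def)
    then have *: "over {u} = (SOME x'. x' \<in> nodes X \<and> {u} \<subseteq> x')" by (simp add: over_def)
    have "over {u} \<in> nodes X \<and> {u} \<subseteq> over {u}" unfolding * by (rule someI[of _ "{(0, y), u}"]) (use x in auto)
    then show ?thesis using nodal_curveD(5)[OF nodal _ x(1), of "over {u}" u] by simp
  qed
  define s where "s x = t (over x)" for x
  have fin_nodes: "finite (\<Union>(nodes X))"
  proof -
    have "finite x" if "x \<in> nodes X" for x using nodal_curveD(3)[OF nodal that] card.infinite by fastforce
    then show ?thesis using nodal_curveD(2)[OF nodal] by blast
  qed
  have point'_cases: "x \<in> points X \<or> x \<in> (\<lambda>u. {u}) ` \<Union>(nodes X)" if x: "x \<in> points X'" for x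
  proof (cases "x \<in> nodes X'")
    case False
    then obtain u where u: "x = {u}" "u \<in> smooth_points X'" using x by (auto simp: points_def)
    from u(2) show ?thesis by (cases rule: smooth'_cases) (use u in \<open>auto simp: points_def\<close>)
  qed (use node'_node in \<open>auto simp: points_def\<close>)
  have "{x \<in> points X'. s x \<notin> germs X' (\<lambda>_. 0) x} \<subseteq> (\<lambda>u. {u}) ` \<Union>(nodes X) \<union> {x \<in> points X. t x \<notin> germs X (\<lambda>_. 0) x}"
  proof
    fix x assume x: "x \<in> {x \<in> points X'. s x \<notin> germs X' (\<lambda>_. 0) x}"
    have "x \<in> {x \<in> points X. t x \<notin> germs X (\<lambda>_. 0) x}" if xX: "x \<in> points X"
    proof -
      have "x \<in> nodes X' \<longleftrightarrow> x \<in> nodes X"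
      proof
        assume "x \<in> nodes X"
        then show "x \<in> nodes X'" using x singleton_not_node[OF nodal] by (auto simp: points_def)
      qed (rule node'_node)
      then show ?thesis using x xX over_points[OF xX] by (simp add: s_def germs_def)
    qed
    then show "x \<in> (\<lambda>u. {u}) ` \<Union>(nodes X) \<union> {x \<in> points X. t x \<notin> germs X (\<lambda>_. 0) x}"
      using point'_cases[of x] x by blast
  qed
  moreover have "finite ((\<lambda>u. {u}) ` \<Union>(nodes X) \<union> {x \<in> points X. t x \<notin> germs X (\<lambda>_. 0) x})"
    using fin_nodes t by (simp add: adeles_def)
  ultimately have "s \<in> adeles X'" unfolding adeles_def using finite_subset by blast
  then have "s \<in> coboundaries X' D'" using H1 unfolding H1_vanishes_def by (rule subsetD[rotated])
  then obtain f a where fa: "s = (\<lambda>x. f) + a" "f \<in> rational_functions X'" "a \<in> adeles_bounded X' D'" 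
    unfolding coboundaries_def by blast
  have sa: "a x c = s x c - f c" for x c unfolding fa(1) by simp
  have val: "\<exists>v. has_value (snd u) (f (fst u) - t {(0, y), u} (fst u)) v" if x: "{(0, y), u} \<in> nodes X" "fst u \<noteq> 0" for y u
  proof -
    have u: "u \<in> smooth_points X'" by (rule crossing_smooth'(1)[OF x])
    then have "a {u} \<in> germs X' D' {u}" using fa(3) smooth_point_in_points[OF u] by (simp add: adeles_bounded_def)
    then have "a {u} (fst u) \<in> stalk (D' u) (snd u)" by (cases u) (auto simp: germs_def)
    then have "- a {u} (fst u) \<in> stalk (D' u) (snd u)" using smooth'_closed[OF u] stalk_uminus by blast
    then show ?thesis using value_at_crossing[OF x] sa[of "{u}" "fst u"] over_crossing[OF x] by (simp add: s_def)
  qed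
  \<comment> \<open>the value, at the crossing through \<open>(0, y)\<close>, of the error on \<open>X'\<close>\<close>
  define v where "v y = (if \<exists>u. {(0, y), u} \<in> nodes X \<and> fst u \<noteq> 0 then 
    (let u = SOME u. {(0, y), u} \<in> nodes X \<and> fst u \<noteq> 0 in value_at (snd u) (f (fst u) - t {(0, y), u} (fst u))) else 0)" for y
  have v: "has_value (snd u) (f (fst u) - t {(0, y), u} (fst u)) (v y)" if x: "{(0, y), u} \<in> nodes X" "fst u \<noteq> 0" for y u
  proof -
    have wu: "w = u" if w: "{(0, y), w} \<in> nodes X \<and> fst w \<noteq> 0" for w
      using nodal_curveD(5)[OF nodal conjunct1[OF w] x(1), of "(0, y)"] w x(2) by (auto simp: doubleton_eq_iff)
    have some: "(SOME u. {(0, y), u} \<in> nodes X \<and> fst u \<noteq> 0) = u"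
      by (rule some_equality) (use x in simp, rule wu)
    have ex: "\<exists>u. {(0, y), u} \<in> nodes X \<and> fst u \<noteq> 0" using x by blast
    have "v y = value_at (snd u) (f (fst u) - t {(0, y), u} (fst u))"
      by (simp only: v_def Let_def if_P[OF ex] some)
    moreover have "snd u \<in> closed_places" using smooth'_closed[OF crossing_smooth'(1)[OF x]] by simp
    moreover obtain w where "has_value (snd u) (f (fst u) - t {(0, y), u} (fst u)) w" using val[OF x] ..
    ultimately show ?thesis by (metis value_at_eqI)
  qed
  have v_inner: "v y = 0" if "x \<in> nodes X" "(0, y) \<in> x" "\<And>c z. (c, z) \<in> x \<Longrightarrow> c = 0" for x y
  proof -
    have no: "\<not> (\<exists>u. {(0, y), u} \<in> nodes X \<and> fst u \<noteq> 0)"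
    proof
      assume "\<exists>u. {(0, y), u} \<in> nodes X \<and> fst u \<noteq> 0"
      then obtain u where u: "{(0, y), u} \<in> nodes X" "fst u \<noteq> 0" by blast
      then have "x = {(0, y), u}" using nodal_curveD(5)[OF nodal that(1) u(1), of "(0, y)"] that(2) by simp
      then show False using that(3)[of "fst u" "snd u"] u by simp
    qed
    show ?thesis unfolding v_def by (rule if_not_P[OF no])
  qed
  have "0 \<in> comps X" using comps by simp
  from component_approximation[OF nodal divisor_on_Dn t this n, of v] obtain f0 where
    f0: "\<And>y. (0, y) \<in> smooth_points X \<Longrightarrow> f0 - t {(0, y)} 0 \<in> stalk (Dn n (0, y)) y"
      "\<And>x y. x \<in> nodes X \<Longrightarrow> (0, y) \<in> x \<Longrightarrow> has_value y (f0 - t x 0) (v y)" by blast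
  define g where "g c = (if c = 0 then f0 else f c)" for c
  have "g \<in> rational_functions X" using fa(2) by (auto simp: rational_functions_def g_def comps comps')
  moreover have "t - (\<lambda>x. g) \<in> adeles_bounded X (Dn n)"
    unfolding adeles_bounded_def
  proof (intro CollectI ballI)
    fix x assume x: "x \<in> points X"
    show "(t - (\<lambda>x. g)) x \<in> germs X (Dn n) x"
    proof (cases "x \<in> nodes X")
      case False
      then obtain u where u: "x = {u}" "u \<in> smooth_points X" using x by (auto simp: points_def)
      obtain c y where cy: "u = (c, y)" by (cases u)
      have y: "y \<in> closed_places" using u cy by (auto simp: smooth_points_def)
      have "t x c - g c \<in> stalk (Dn n (c, y)) y"
      proof (cases "c = 0")
        case True
        then show ?thesis using f0(1)[of y] u cy stalk_uminus[OF y, of "f0 - t x 0"] by (simp add: g_def)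
      next
        case c: False
        have u': "u \<in> smooth_points X'" using smooth_smooth'[OF u(2)] c cy by simp
        have "a x \<in> germs X' D' x" using fa(3) u smooth_point_in_points[OF u'] by (simp add: adeles_bounded_def)
        then have "a x c \<in> stalk (D' (c, y)) y" using u cy by (auto simp: germs_def)
        then show ?thesis using Dn_away[OF c] sa[of x c] over_points[OF x] c by (simp add: s_def g_def)
      qed
      then show ?thesis using u cy False by (simp add: germs_def)
    next
      case xn: True
      have cl: "y \<in> closed_places" if "(c, y) \<in> x" for c y using points_closed[OF nodal x that] by simp
      have "\<exists>w. \<forall>(c, y)\<in>x. has_value y (t x c - g c) w"
        using xn
      proof (cases rule: node_cases)
        case away
        then have "a x \<in> germs X' D' x" using fa(3) by (auto simp: adeles_bounded_def points_def)
        then obtain w where w: "\<forall>(c, y)\<in>x. has_value y (a x c) w" using away by (auto simp: germs_def)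
        have "a x c = t x c - g c" if "(c, y) \<in> x" for c y
          using sa[of x c] over_points[OF x] away(2)[OF that] by (simp add: s_def g_def)
        then show ?thesis using w by (intro exI[of _ w]) auto
      next
        case (crossing y u)
        have x': "{(0, y), u} \<in> nodes X" using xn crossing by simp
        have vu: "has_value (snd u) (f (fst u) - t x (fst u)) (v y)" using v[OF x' crossing(2)] crossing by simp
        have vy: "has_value y (f0 - t x 0) (v y)" using f0(2)[OF xn] crossing by simp
        have neg: "has_value z (q - p) (- w)" if "has_value z (p - q) w" "z \<in> closed_places"
          for z and p q :: "'k poly fract" and w
          using has_value_const_mult[OF that(2,1), of "-1"] by (simp add: const_uminus)
        have "(fst u, snd u) \<in> x" "(0, y) \<in> x" using crossing by simp_all
        then have "has_value (snd u) (t x (fst u) - f (fst u)) (- v y)" "has_value y (t x 0 - f0) (- v y)"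
          using neg[OF vu] neg[OF vy] cl by blast+
        then have "\<forall>(c, z)\<in>{(0, y), u}. has_value z (t x c - g c) (- v y)"
          using crossing(2) by (cases u) (simp add: g_def)
        then have "\<forall>(c, z)\<in>x. has_value z (t x c - g c) (- v y)" using crossing(1) by (simp only:)
        then show ?thesis by blast
      next
        case inner
        have "has_value z (t x c - g c) 0" if "(c, z) \<in> x" for c z
        proof -
          have c: "c = 0" using inner(2)[OF that] .
          then have z: "(0, z) \<in> x" using that by simp
          then have "v z = 0" using inner(2) by (rule v_inner[OF xn])
          then have "f0 - t x 0 \<in> stalk (-1) z" using f0(2)[OF xn z] by (simp add: has_value_0_iff)
          then show ?thesis using stalk_uminus[OF cl[OF that], of "f0 - t x 0"] c by (simp add: has_value_0_iff g_def)
        qed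
        then show ?thesis by auto
      qed
      then obtain w where w: "\<forall>(c, y)\<in>x. has_value y (t x c - g c) w" ..
      have "t x c - g c \<in> stalk (Dn n (c, y)) y" if "(c, y) \<in> x" for c y
        using has_value_in_local_ring[OF cl[OF that], of "t x c - g c" w] w that divisor_on_node[OF divisor_on_Dn xn that]
        by auto
      then show ?thesis using w by (auto simp: germs_def)
    qed
  qed
  moreover have "t = (\<lambda>x. g) + (t - (\<lambda>x. g))" by (simp add: fun_eq_iff)
  ultimately show "t \<in> coboundaries X (Dn n)" unfolding coboundaries_def by blast
qed

lemma place_div_degree_Dn: "place_div_degree (\<lambda>y. Dn n (0, y)) = place_div_degree (\<lambda>y. D (0, y)) + int n"
proof -
  let ?d = "\<lambda>y :: 'k poly place. if y = Infty then int n else 0"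
  have sub: "{y. ?d y \<noteq> 0} \<subseteq> {Infty}" by auto
  then have "place_divisor ?d" by (auto simp: place_divisor_def intro: finite_subset)
  moreover have "place_div_degree ?d = int n" using place_div_degree_superset[OF _ sub] by simp
  moreover have "(\<lambda>y. Dn n (0, y)) = (\<lambda>y. D (0, y) + ?d y)" by (auto simp: add_multiple_def)
  ultimately show ?thesis using place_div_degree_add[OF divisor_on_place_divisor[OF D, of 0], of ?d] by simp
qed

lemma eventually_nonspecial_iff: "eventually_nonspecial X D \<longleftrightarrow> H1_vanishes X' D'"
proof
  assume "eventually_nonspecial X D"
  then obtain n where "H1_vanishes X (Dn n)" unfolding eventually_nonspecial_def eventually_sequentially by blast
  then show "H1_vanishes X' D'" by (rule H1_vanishes_restrict)
next
  assume H1: "H1_vanishes X' D'"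
  show "eventually_nonspecial X D" unfolding eventually_nonspecial_def eventually_sequentially
  proof (intro exI allI impI)
    fix n assume "nat (int (card (branches X 0)) - 1 - place_div_degree (\<lambda>y. D (0, y))) \<le> n"
    then show "H1_vanishes X (Dn n)" by (intro H1_vanishes_extend[OF H1]) (simp add: place_div_degree_Dn)
  qed
qed

section \<open>Determination by the Laurent expansion\<close>

lemma H0_restrict:
  assumes f: "f \<in> H0 X (Dn n)"
  shows "(\<lambda>c. if c = 0 then 0 else f c) \<in> H0 X' D'"
proof -
  let ?f = "\<lambda>c. if c = 0 then 0 else f c"
  have fr: "f \<in> rational_functions X" and fg: "\<And>x. x \<in> points X \<Longrightarrow> f \<in> germs X (Dn n) x"
    using f by (auto simp: H0_def)
  have "?f \<in> germs X' D' x" if x: "x \<in> points X'" for x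
  proof (cases "x \<in> nodes X'")
    case True
    have xX: "x \<in> nodes X" by (rule node'_node[OF True])
    have away: "c \<noteq> 0" if "(c, y) \<in> x" for c y using node'_away[OF True that] by simp
    have "f \<in> germs X (Dn n) x" using fg xX by (simp add: points_def)
    then obtain v where *: "\<forall>(c, y)\<in>x. f c \<in> stalk (Dn n (c, y)) y" "\<forall>(c, y)\<in>x. has_value y (f c) v"
      using xX by (auto simp: germs_def)
    have "\<forall>(c, y)\<in>x. has_value y (?f c) v" using *(2) away by fastforce
    moreover have "\<forall>(c, y)\<in>x. ?f c \<in> stalk (D' (c, y)) y" using *(1) away Dn_away by fastforce
    ultimately show ?thesis unfolding germs_def by blast
  next
    case False
    then obtain u where u: "x = {u}" "u \<in> smooth_points X'" using x by (auto simp: points_def)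
    obtain c y where cy: "u = (c, y)" by (cases u)
    have c: "c \<noteq> 0" using smooth'_closed[OF u(2)] cy by simp
    have "f c \<in> stalk (Dn n (c, y)) y"
      using u(2)
    proof (cases rule: smooth'_cases)
      case smooth
      then show ?thesis using fg[OF smooth_point_in_points[OF smooth(1)]] cy by (simp add: germs_def)
    next
      case (crossing z)
      then have "f \<in> germs X (Dn n) {(0, z), u}" using fg by (simp add: points_def)
      then show ?thesis using cy by (simp add: germs_def)
    qed
    then show ?thesis using u cy False c Dn_away[OF c] by (simp add: germs_def)
  qed
  then show ?thesis using fr by (auto simp: H0_def rational_functions_def comps comps')
qed

text \<open>
  The divisor subtracted from \<open>D'\<close> is \<open>Z\<close>, written without a numbering of the crossings.
\<close>

lemma vanishing_sections_iff:
  "h \<in> H0 X' (\<lambda>u. D' u - (if \<exists>y. {(0, y), u} \<in> nodes X \<and> fst u \<noteq> 0 then 1 else 0)) \<longleftrightarrow>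
    h \<in> H0 X' D' \<and> (\<forall>y u. {(0, y), u} \<in> nodes X \<and> fst u \<noteq> 0 \<longrightarrow> has_value (snd u) (h (fst u)) 0)"
  (is "h \<in> H0 X' ?E \<longleftrightarrow> ?R")
proof -
  have not_crossing: "?E u = D' u" if "x \<in> nodes X'" "u \<in> x" for x u
  proof -
    have "\<not> (\<exists>y. {(0, y), u} \<in> nodes X \<and> fst u \<noteq> 0)"
      using node_not_smooth[OF that] crossing_smooth'(1)[of _ u] by blast
    then show ?thesis by simp
  qed
  have node: "h \<in> germs X' ?E x \<longleftrightarrow> h \<in> germs X' D' x" if x: "x \<in> nodes X'" for x
    using germs_cong[of x ?E D' X'] not_crossing[OF x] by simp
  have smooth: "h \<in> germs X' ?E {u} \<longleftrightarrow> h \<in> germs X' D' {u} \<and>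
      (\<forall>y. {(0, y), u} \<in> nodes X \<and> fst u \<noteq> 0 \<longrightarrow> has_value (snd u) (h (fst u)) 0)"
    if u: "u \<in> smooth_points X'" for u
  proof -
    have g: "h \<in> germs X' E {u} \<longleftrightarrow> h (fst u) \<in> stalk (E u) (snd u)" for E
      using singleton_not_node[OF nodal'] by (cases u) (auto simp: germs_def)
    show ?thesis
    proof (cases "\<exists>y. {(0, y), u} \<in> nodes X \<and> fst u \<noteq> 0")
      case True
      then obtain y where y: "{(0, y), u} \<in> nodes X" "fst u \<noteq> 0" by blast
      have "stalk (-1) (snd u) \<subseteq> stalk 0 (snd u)" using smooth'_closed[OF u] by (intro stalk_mono) auto
      then show ?thesis unfolding g using y crossing_divisor_0[OF y] by (auto simp: has_value_0_iff)
    next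
      case False
      then show ?thesis unfolding g by auto
    qed
  qed
  have split: "(\<forall>x\<in>points X'. P x) \<longleftrightarrow> (\<forall>x\<in>nodes X'. P x) \<and> (\<forall>u\<in>smooth_points X'. P {u})" for P
    by (auto simp: points_def)
  have "h \<in> H0 X' ?E \<longleftrightarrow> h \<in> H0 X' D' \<and>
      (\<forall>u\<in>smooth_points X'. \<forall>y. {(0, y), u} \<in> nodes X \<and> fst u \<noteq> 0 \<longrightarrow> has_value (snd u) (h (fst u)) 0)"
    unfolding H0_def mem_Collect_eq split using node smooth by auto
  then show ?thesis using crossing_smooth'(1) by auto
qed

text \<open>
  A section that is zero on the component \<open>0\<close> has the value zero at the crossings, and a section on \<open>X'\<close>
  with zeros at the crossings extends by zero. Expansion at the marked point is injective on rational
  functions of the component.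
\<close>

lemma determined_by_laurent_iff:
  assumes Z: "Z = (\<lambda>u. if \<exists>y. {(0, y), u} \<in> nodes X \<and> fst u \<noteq> 0 then 1 else 0)"
  shows "determined_by_laurent X D \<longleftrightarrow> H0 X' (\<lambda>u. D' u - Z u) = {0}"
proof
  assume det: "determined_by_laurent X D"
  have "h = 0" if h: "h \<in> H0 X' (\<lambda>u. D' u - Z u)" for h
  proof -
    have hD: "h \<in> H0 X' D'" and hv: "\<And>y u. {(0, y), u} \<in> nodes X \<Longrightarrow> fst u \<noteq> 0 \<Longrightarrow> has_value (snd u) (h (fst u)) 0"
      using h unfolding Z vanishing_sections_iff by auto
    have h0: "h 0 = 0" using hD by (simp add: H0_def rational_functions_def comps')
    have "h \<in> germs X (Dn 0) x" if x: "x \<in> points X" for x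
    proof (cases "x \<in> nodes X")
      case False
      then obtain u where u: "x = {u}" "u \<in> smooth_points X" using x by (auto simp: points_def)
      obtain c y where cy: "u = (c, y)" by (cases u)
      have y: "y \<in> closed_places" using u cy by (auto simp: smooth_points_def)
      have "h c \<in> stalk (Dn 0 (c, y)) y"
      proof (cases "c = 0")
        case True
        then show ?thesis using h0 stalk_zero[OF y] by simp
      next
        case c: False
        then have "h \<in> germs X' D' {u}"
          using hD smooth_point_in_points[OF smooth_smooth'[OF u(2)]] cy by (simp add: H0_def)
        then show ?thesis using cy Dn_away[OF c] by (simp add: germs_def)
      qed
      then show ?thesis using u cy False by (simp add: germs_def)
    next
      case xn: True
      have cl: "y \<in> closed_places" if "(c, y) \<in> x" for c y using points_closed[OF nodal x that] by simp
      have "\<exists>w. \<forall>(c, y)\<in>x. has_value y (h c) w"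
        using xn
      proof (cases rule: node_cases)
        case away
        then have "h \<in> germs X' D' x" using hD by (simp add: H0_def points_def)
        then show ?thesis using away by (simp add: germs_def)
      next
        case (crossing y u)
        then have "has_value (snd u) (h (fst u)) 0" using hv xn by blast
        then have "\<forall>(c, z)\<in>x. has_value z (h c) 0"
          using crossing h0 cl[of 0 y] by (cases u) (auto simp: has_value_0_iff stalk_zero)
        then show ?thesis by blast
      next
        case inner
        have "has_value z (h c) 0" if "(c, z) \<in> x" for c z
          using inner(2)[OF that] h0 cl[OF that] by (simp add: has_value_0_iff stalk_zero)
        then show ?thesis by auto
      qed
      then obtain w where w: "\<forall>(c, y)\<in>x. has_value y (h c) w" ..
      have "h c \<in> stalk (Dn 0 (c, y)) y" if "(c, y) \<in> x" for c y
        using has_value_in_local_ring[OF cl[OF that], of "h c" w] w that divisor_on_node[OF divisor_on_Dn xn that]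
        by auto
      then show ?thesis using w by (auto simp: germs_def)
    qed
    then have "h \<in> H0 X (Dn 0)" using hD by (auto simp: H0_def rational_functions_def comps comps')
    moreover have "0 \<in> H0 X (Dn 0)" using sec.subspace_0[OF subspace_H0[OF nodal]] .
    moreover have "laurent_at_inf (h 0) = laurent_at_inf ((0 :: nat \<Rightarrow> 'k poly fract) 0)" using h0 by simp
    ultimately show "h = 0" using det unfolding determined_by_laurent_def inj_on_def by blast
  qed
  then show "H0 X' (\<lambda>u. D' u - Z u) = {0}" using sec.subspace_0[OF subspace_H0[OF nodal']] by blast
next
  assume zero: "H0 X' (\<lambda>u. D' u - Z u) = {0}"
  show "determined_by_laurent X D" unfolding determined_by_laurent_def
  proof (intro allI inj_onI)
    fix n f g assume fg: "f \<in> H0 X (Dn n)" "g \<in> H0 X (Dn n)" "laurent_at_inf (f 0) = laurent_at_inf (g 0)"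
    let ?h = "f - g"
    have hH: "?h \<in> H0 X (Dn n)" using sec.subspace_diff[OF subspace_H0[OF nodal] fg(1,2)] .
    have h0: "?h 0 = 0" using fg(3) by (simp add: laurent_inject)
    have eq: "(\<lambda>c. if c = 0 then 0 else ?h c) = ?h" using h0 by auto
    have hD: "?h \<in> H0 X' D'" using H0_restrict[OF hH] unfolding eq .
    have "has_value (snd u) (?h (fst u)) 0" if u: "{(0, y), u} \<in> nodes X" "fst u \<noteq> 0" for y u
    proof -
      let ?x = "{(0, y), u}"
      have "?h \<in> germs X (Dn n) ?x" using hH u by (simp add: H0_def points_def)
      then obtain v where "\<forall>(c, z)\<in>?x. has_value z (?h c) v" using u by (auto simp: germs_def)
      then have v: "has_value y (?h 0) v" "has_value (snd u) (?h (fst u)) v" by (cases u, auto)+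
      have y: "y \<in> closed_places" using points_closed(2)[OF nodal, of ?x 0 y] u by (simp add: points_def)
      have "has_value y (?h 0) 0" unfolding h0 by (simp add: has_value_0_iff stalk_zero y)
      then have "v = 0" using has_value_unique[OF v(1) y] by simp
      then show ?thesis using v(2) by simp
    qed
    then have "?h \<in> H0 X' (\<lambda>u. D' u - Z u)" unfolding Z vanishing_sections_iff using hD by blast
    then have "?h = 0" unfolding zero by simp
    then show "f = g" by simp
  qed
qed

end

section \<open>Gauge transforms of soliton points\<close>

lemma polynomial_part_exists:
  fixes g :: "'k::field_char_0 fls"
  shows "\<exists>w. \<forall>i\<le>0. fls_nth (g - poly_at_inf w) i = 0"
proof -
  let ?m = "nat (- fls_subdegree g)"
  define w where "w = (\<Sum>j\<le>?m. monom (fls_nth g (- int j)) j)"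
  have "coeff w j = fls_nth g (- int j)" for j
  proof -
    have "coeff w j = (if j \<le> ?m then fls_nth g (- int j) else 0)"
      by (simp add: w_def coeff_sum)
    then show ?thesis by auto
  qed
  then have "fls_nth (g - poly_at_inf w) i = 0" if "i \<le> 0" for i
    using fls_nth_poly_at_inf[of w "nat (- i)"] that by simp
  then show ?thesis by blast
qed

lemma times_power_series_unit_pole_order:
  assumes "fps_nth h 0 \<noteq> (0 :: 'k::field_char_0)"
  shows "fps_to_fls h * f \<in> pole_order_below k \<longleftrightarrow> f \<in> pole_order_below k"
proof (cases "f = 0")
  case False
  have h0: "fps_to_fls h \<noteq> 0" using assms by auto
  have "fls_subdegree (fps_to_fls h) = 0" using assms by (simp add: fls_subdegree_fls_to_fps)
  then show ?thesis using False h0 by (simp add: pole_order_below_iff)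
qed simp

definition rows_independent :: "'k::field mat \<Rightarrow> bool" where
  "rows_independent M \<longleftrightarrow> (\<forall>c. (\<forall>i<dim_col M. (\<Sum>j<dim_row M. c j * M $$ (j, i)) = 0) \<longrightarrow> (\<forall>j<dim_row M. c j = 0))"

lemma soliton_embed_pole_order:
  "soliton_embed M \<kappa>s u \<in> pole_order_below (dim_row M) \<longleftrightarrow> u = 0 \<or> degree u < length \<kappa>s"
  using subdegree_soliton_embed[of u M \<kappa>s] soliton_embed_eq_0_iff[of M \<kappa>s u]
  by (auto simp: pole_order_below_iff)

lemma subspace_times: "fls.subspace U \<Longrightarrow> fls.subspace ((*) h ` U)"
proof (rule fls.subspaceI)
  assume U: "fls.subspace U"
  show "0 \<in> (*) h ` U" using fls.subspace_0[OF U] by force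
  fix x y assume "x \<in> (*) h ` U" "y \<in> (*) h ` U"
  then obtain u v where "x = h * u" "y = h * v" "u \<in> U" "v \<in> U" by auto
  then show "x + y \<in> (*) h ` U" using fls.subspace_add[OF U, of u v] by (auto simp: distrib_left[symmetric])
next
  fix a x assume U: "fls.subspace U" and "x \<in> (*) h ` U"
  then obtain u where "x = h * u" "u \<in> U" by auto
  moreover have "fls_scale a (h * u) = h * fls_scale a u" by (simp add: fls_scale_def mult_ac)
  ultimately show "fls_scale a x \<in> (*) h ` U" using fls.subspace_scale[OF U, of u a] by auto
qed

text \<open>
  The elements of pole order less than \<open>k\<close> are the images of the polynomials of degree less than
  that of \<open>K\<close>. They are the combinations of the \<open>k\<close> rows, while the multiples of \<open>K\<close> supply all
  higher poles. A power series unit does not change pole orders.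
\<close>

lemma gauge_transform_of_soliton_point_in_sato_grassmannian:
  fixes M :: "'k::field_char_0 mat"
  assumes h: "fps_nth h 0 \<noteq> 0" and \<kappa>: "distinct \<kappa>s" "length \<kappa>s = dim_col M" and M: "rows_independent M"
  shows "(\<lambda>f. fps_to_fls h * f) ` soliton_point M \<kappa>s \<in> sato_grassmannian"
proof -
  let ?k = "dim_row M" and ?H = "fps_to_fls h" and ?T = "soliton_polys M \<kappa>s" and ?K = "param_poly \<kappa>s"
  have H0: "?H \<noteq> 0" using h by auto
  let ?U = "(\<lambda>f. ?H * f) ` soliton_embed M \<kappa>s ` ?T"
  let ?b = "\<lambda>j. ?H * soliton_embed M \<kappa>s (soliton_poly M \<kappa>s j)"
  let ?comb = "\<lambda>c. \<Sum>j<?k. Polynomial.smult (c j) (soliton_poly M \<kappa>s j)"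
  have sub: "fls.subspace ?U" using subspace_times[OF subspace_soliton_embed] by simp
  have comb: "(\<Sum>j<?k. fls_scale (c j) (?b j)) = ?H * soliton_embed M \<kappa>s (?comb c)" for c
    by (simp add: soliton_embed_sum soliton_embed_smult fls_scale_def sum_distrib_left mult_ac)
  have comb_deg: "?comb c = 0 \<or> degree (?comb c) < dim_col M" for c
  proof (cases "?comb c = 0")
    case False
    have "degree (Polynomial.smult (c j) (soliton_poly M \<kappa>s j)) \<le> dim_col M - 1" for j
      using degree_soliton_poly[OF \<kappa>(2), of j] degree_smult_le[of "c j" "soliton_poly M \<kappa>s j"]
      by (cases "soliton_poly M \<kappa>s j = 0") auto
    then have "degree (?comb c) \<le> dim_col M - 1" by (intro degree_sum_le) auto
    moreover have "dim_col M \<noteq> 0"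
    proof
      assume "dim_col M = 0"
      then have "?comb c = 0" by (simp add: soliton_poly_def)
      with False show False by simp
    qed
    ultimately show ?thesis by (intro disjI2) linarith
  qed simp
  have indep: "inj_on ?b {..<?k} \<and> fls.independent (?b ` {..<?k})"
  proof (rule fls.independent_family)
    fix c assume "(\<Sum>j<?k. fls_scale (c j) (?b j)) = 0"
    then have z: "?comb c = 0" unfolding comb using H0 by (simp add: soliton_embed_eq_0_iff)
    have "(\<Sum>j<?k. c j * M $$ (j, i)) = 0" if i: "i < dim_col M" for i
    proof -
      have "poly (?comb c) (\<kappa>s ! i) = poly (pderiv ?K) (\<kappa>s ! i) * (\<Sum>j<?k. c j * M $$ (j, i))"
        by (simp add: poly_sum poly_soliton_poly[OF \<kappa> i] sum_distrib_left mult_ac)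
      then show ?thesis unfolding z using pderiv_param_poly_nonzero[OF \<kappa>(1), of i] i \<kappa>(2) by simp
    qed
    then show "\<forall>j\<in>{..<?k}. c j = 0" using M unfolding rows_independent_def by auto
  qed simp
  have basis_sub: "?b j \<in> ?U \<inter> pole_order_below ?k" if "j < ?k" for j
  proof
    have "soliton_poly M \<kappa>s j \<in> ?T"
      using soliton_polys_compose[OF \<kappa>, of "\<lambda>i. of_bool (i = j)" 0] that by (simp add: of_bool_def if_distrib[of "\<lambda>c. Polynomial.smult c _"] cong: if_cong)
    then show "?b j \<in> ?U" by blast
    show "?b j \<in> pole_order_below ?k"
      unfolding times_power_series_unit_pole_order[OF h] soliton_embed_pole_order
      using degree_soliton_poly[OF \<kappa>(2), of j] \<kappa>(2) by auto
  qed
  have subI: "fls.subspace (?U \<inter> pole_order_below ?k)"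
    using sub subspace_pole_order_below by (rule fls.subspace_inter)
  have span: "fls.span (?b ` {..<?k}) = ?U \<inter> pole_order_below ?k"
  proof
    show "fls.span (?b ` {..<?k}) \<subseteq> ?U \<inter> pole_order_below ?k"
      using basis_sub by (intro fls.span_minimal subI) auto
    show "?U \<inter> pole_order_below ?k \<subseteq> fls.span (?b ` {..<?k})"
    proof
      fix f assume "f \<in> ?U \<inter> pole_order_below ?k"
      then obtain u where u: "f = ?H * soliton_embed M \<kappa>s u" "u \<in> ?T" "f \<in> pole_order_below ?k" by auto
      then have deg: "u = 0 \<or> degree u < dim_col M"
        unfolding u(1) times_power_series_unit_pole_order[OF h] soliton_embed_pole_order \<kappa>(2) by simp
      obtain c w where cw: "u = ?comb c + ?K * w" using soliton_polys_decompose[OF \<kappa> u(2)] by blast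
      have "w = 0"
      proof (rule ccontr)
        assume w: "w \<noteq> 0"
        have "?K * w = u - ?comb c" using cw by simp
        then have "degree (?K * w) < dim_col M \<or> ?K * w = 0"
          using deg comb_deg[of c] degree_diff_less[of u "dim_col M" "?comb c"] by auto
        moreover have "degree (?K * w) = dim_col M + degree w"
          using w by (simp add: degree_mult_eq degree_param_poly \<kappa>(2))
        ultimately show False using w by simp
      qed
      then have "f = (\<Sum>j<?k. fls_scale (c j) (?b j))" unfolding comb u(1) cw by simp
      then show "f \<in> fls.span (?b ` {..<?k})"
        by (simp only:) (intro fls.span_sum fls.span_scale fls.span_base imageI)
    qed
  qed
  have card: "card (?b ` {..<?k}) = ?k" using card_image[OF conjunct1[OF indep]] by simp
  have surj: "\<exists>u\<in>?U. v - u \<in> pole_order_below ?k" for v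
  proof -
    let ?Xk = "fls_X_intpow (- int ?k) :: 'k fls" and ?Xi = "fls_X_intpow (int ?k) :: 'k fls"
    have X1: "?Xk * ?Xi = 1" unfolding fls_X_intpow_times_fls_X_intpow by simp
    \<comment> \<open>the multiple \<open>K w\<close> cancels all poles of \<open>v\<close> of order at least \<open>k\<close>\<close>
    obtain w where w: "\<forall>i\<le>0. fls_nth (v * ?Xi / ?H - poly_at_inf w) i = 0"
      using polynomial_part_exists by blast
    let ?d = "v * ?Xi / ?H - poly_at_inf w"
    let ?u = "?H * soliton_embed M \<kappa>s (?K * w)"
    have "?K * w \<in> ?T" using soliton_polys_compose[OF \<kappa>, of "\<lambda>_. 0" w] by simp
    then have uU: "?u \<in> ?U" by blast
    have "?H * (?Xk * ?d) = ?H * ?Xk * (v * ?Xi / ?H) - ?H * (?Xk * poly_at_inf w)"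
      by (simp only: right_diff_distrib mult.assoc)
    also have "?H * ?Xk * (v * ?Xi / ?H) = v * (?Xk * ?Xi)" using H0 by (simp add: field_simps)
    finally have "v - ?u = ?H * (?Xk * ?d)" unfolding X1 soliton_embed_param_mult by simp
    moreover have "?Xk * ?d \<in> pole_order_below ?k"
      unfolding pole_order_below_def fls_X_intpow_times_conv_shift(1) using w by simp
    ultimately have "v - ?u \<in> pole_order_below ?k" using times_power_series_unit_pole_order[OF h] by simp
    then show ?thesis using uU by blast
  qed
  have "?U \<in> sato_grassmannian"
    by (rule sato_grassmannian_criterion[OF sub _ conjunct2[OF indep] span card surj]) simp
  then show ?thesis unfolding soliton_point_eq[OF \<kappa>] .
qed

section \<open>Values of the finite part function\<close>

lemma has_value_aff_powi:
  assumes "poly q t \<noteq> 0"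
  shows "has_value (aff t) (Fract q 1 powi k) (poly q t powi k)"
proof -
  have pw: "Fract q 1 ^ j = Fract (q ^ j) 1" for j by (induction j) (auto simp: One_fract_def)
  show ?thesis
  proof (cases "k \<ge> 0")
    case True
    then show ?thesis using has_value_aff[of 1 t "q ^ nat k"] by (simp add: power_int_def pw)
  next
    case False
    have "Fract 1 q ^ j = Fract 1 (q ^ j)" for j by (induction j) (auto simp: One_fract_def)
    then have "Fract q 1 powi k = Fract 1 (q ^ nat (- k))" using False by (simp add: power_int_def)
    moreover have "poly q t powi k = 1 / poly (q ^ nat (- k)) t"
      using False by (simp add: power_int_def divide_inverse power_inverse)
    moreover have "poly (q ^ nat (- k)) t \<noteq> 0" using assms by simp
    ultimately show ?thesis
      using has_value_aff[of "q ^ nat (- k)" t 1] by simp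
  qed
qed

lemma has_value_prod:
  assumes "y \<in> closed_places" "\<And>i. i \<in> I \<Longrightarrow> has_value y (f i) (c i)"
  shows "has_value y (\<Prod>i\<in>I. f i) (\<Prod>i\<in>I. c i)"
  using assms(2)
proof (induction I rule: infinite_finite_induct)
  case (insert i I)
  then show ?case by (simp add: has_value_mult assms(1))
qed (use has_value_const[OF assms(1), of 1] in auto)

lemma monic_irreducible_root:
  assumes "irreducible q" "lead_coeff q = 1" "poly q t = 0"
  shows "Fin q = aff t"
proof -
  have "[:- t, 1:] dvd q" using assms(3) by (simp add: poly_eq_0_iff_dvd)
  then show ?thesis
    using monic_irreducible_dvd_imp_eq[OF irreducible_linear, of t q] assms(1,2) by (simp add: aff_def)
qed

text \<open>
  A place where \<open>D\<close> does not vanish is not the place of \<open>t\<close>, so the polynomials in the product are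
  nonzero at \<open>t\<close>.
\<close>

lemma finite_part_function_value:
  assumes D: "divisor_on Y D" and t: "D (0, aff t) = 0"
  shows "has_value (aff t) (finite_part_function (\<lambda>y. D (0, y))) (div_fun D t)"
    "has_value (aff t) (inverse (finite_part_function (\<lambda>y. D (0, y)))) (inverse (div_fun D t))"
    "div_fun D t \<noteq> 0"
proof -
  have nz: "poly q t \<noteq> 0" if q: "D (0, Fin q) \<noteq> 0" for q
  proof
    assume z: "poly q t = 0"
    have "Fin q \<in> closed_places" using divisor_on_place_divisor[OF D, of 0] q by (auto simp: place_divisor_def)
    then have "Fin q = aff t" using monic_irreducible_root[of q t] z by (simp add: closed_places_Fin)
    then show False using t q by simp
  qed
  show "has_value (aff t) (finite_part_function (\<lambda>y. D (0, y))) (div_fun D t)"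
    unfolding finite_part_function_def div_fun_def
    using nz by (intro has_value_prod has_value_aff_powi) auto
  have "inverse (finite_part_function (\<lambda>y. D (0, y))) = (\<Prod>q | D (0, Fin q) \<noteq> 0. Fract q 1 powi (- D (0, Fin q)))"
    unfolding finite_part_function_def by (simp add: power_int_minus prod_inversef[symmetric] comp_def)
  moreover have "inverse (div_fun D t) = (\<Prod>q | D (0, Fin q) \<noteq> 0. poly q t powi (- D (0, Fin q)))"
    unfolding div_fun_def by (simp add: power_int_minus prod_inversef[symmetric] comp_def)
  ultimately show "has_value (aff t) (inverse (finite_part_function (\<lambda>y. D (0, y)))) (inverse (div_fun D t))"
    using nz by (simp only:) (intro has_value_prod has_value_aff_powi, auto)
  show "div_fun D t \<noteq> 0" unfolding div_fun_def
    using finite_fin_part[OF divisor_on_place_divisor[OF D, of 0]] nz by auto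
qed

lemma subdegree_laurent_finite_part_function:
  assumes e: "place_divisor e"
  shows "fls_subdegree (laurent_at_inf (finite_part_function e)) = e Infty - place_div_degree e"
proof -
  let ?S = "{q. e (Fin q) \<noteq> 0}"
  have q0: "q \<noteq> 0" if "q \<in> ?S" for q using that e by (auto simp: place_divisor_def closed_places_def)
  have L: "laurent_at_inf (finite_part_function e) = (\<Prod>q\<in>?S. poly_at_inf q powi e (Fin q))"
    unfolding finite_part_function_def by (simp add: laurent_prod laurent_power_int laurent_at_inf_Fract)
  have *: "fls_subdegree (\<Prod>q\<in>S. poly_at_inf q powi m q) = - (\<Sum>q\<in>S. m q * int (degree q)) \<and> (\<Prod>q\<in>S. poly_at_inf q powi m q) \<noteq> 0"
    if "finite S" "0 \<notin> S" for S and m :: "'a poly \<Rightarrow> int"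
    using that
  proof (induction S rule: finite_induct)
    case (insert q S)
    have nz: "poly_at_inf q \<noteq> 0" using insert by (auto simp: poly_at_inf_eq_0_iff)
    have "fls_subdegree (poly_at_inf q powi m q) = - (m q * int (degree q))"
      using insert by (simp add: subdegree_poly_at_inf)
    then show ?case using insert nz by (simp add: fls_subdegree_mult)
  qed simp
  have "fls_subdegree (\<Prod>q\<in>?S. poly_at_inf q powi e (Fin q)) = - (\<Sum>q\<in>?S. e (Fin q) * int (degree q))"
    by (rule conjunct1[OF *]) (use finite_fin_part[OF e] q0 in auto)
  then show ?thesis unfolding L place_div_degree_split[OF e]
    by simp
qed

section \<open>The soliton data of a curve\<close>

lemma sum_lessThan_add: "(\<Sum>j<m + n. f j) = (\<Sum>j<m. f j) + (\<Sum>t<n. f (m + t))" for f :: "nat \<Rightarrow> 'b::comm_monoid_add"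
  by (induction n) (simp_all add: add.assoc)

lemma concat_pairs:
  "length (concat (map (\<lambda>j. [f j, g j]) [0..<b])) = 2 * b"
  "t < b \<Longrightarrow> concat (map (\<lambda>j. [f j, g j]) [0..<b]) ! (2 * t) = f t"
  "t < b \<Longrightarrow> concat (map (\<lambda>j. [f j, g j]) [0..<b]) ! Suc (2 * t) = g t"
proof -
  show len: "length (concat (map (\<lambda>j. [f j, g j]) [0..<b])) = 2 * b" for b by (induction b) auto
  show "t < b \<Longrightarrow> concat (map (\<lambda>j. [f j, g j]) [0..<b]) ! (2 * t) = f t"
    by (induction b) (auto simp: nth_append len less_Suc_eq)
  show "t < b \<Longrightarrow> concat (map (\<lambda>j. [f j, g j]) [0..<b]) ! Suc (2 * t) = g t"
    by (induction b) (auto simp: nth_append len less_Suc_eq)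
qed

lemma length_soliton_params: "length (soliton_params a b \<kappa> \<mu> \<nu>) = a + 2 * b"
  by (simp add: soliton_params_def concat_pairs(1) del: length_concat)

lemma nth_soliton_params:
  "i < a \<Longrightarrow> soliton_params a b \<kappa> \<mu> \<nu> ! i = \<kappa> i"
  "t < b \<Longrightarrow> soliton_params a b \<kappa> \<mu> \<nu> ! (a + 2 * t) = \<mu> t"
  "t < b \<Longrightarrow> soliton_params a b \<kappa> \<mu> \<nu> ! Suc (a + 2 * t) = \<nu> t"
  using concat_pairs(2,3)[of t b \<mu> \<nu>]
  by (simp_all add: soliton_params_def nth_append del: length_concat)

lemma soliton_index_cases:
  assumes "i < a + 2 * (b::nat)"
  obtains "i < a" | t where "t < b" "i = a + 2 * t" | t where "t < b" "i = Suc (a + 2 * t)"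
proof (cases "i < a")
  case False
  let ?t = "(i - a) div 2"
  have "?t < b" using assms False by linarith
  moreover have "i = a + 2 * ?t \<or> i = Suc (a + 2 * ?t)" using False by presburger
  ultimately show ?thesis using that by blast
qed (use that in blast)

lemma param_poly_soliton_params: "param_poly (soliton_params a b \<kappa> \<mu> \<nu>) = node_poly a b \<kappa> \<mu> \<nu>"
proof -
  have "param_poly xs = prod_list (map (\<lambda>c. [:- c, 1:]) xs)" for xs :: "'a list"
    unfolding param_poly_def by (simp add: prod.list_conv_set_nth atLeast0LessThan)
  moreover have "prod_list (map (\<lambda>c. [:- c, 1:]) (concat (map (\<lambda>j. [\<mu> j, \<nu> j]) [0..<b]))) =
      (\<Prod>j<b. [:- \<mu> j, 1:] * [:- \<nu> j, 1:])"
    by (induction b) (simp_all only: upt_Suc_append map_append concat_append prod_list.append prod.lessThan_Suc, simp_all)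
  moreover have "prod_list (map (\<lambda>c. [:- c, 1:]) (map \<kappa> [0..<a])) = (\<Prod>j<a. [:- \<kappa> j, 1:])"
    by (simp add: prod.list_conv_set_nth atLeast0LessThan)
  ultimately show ?thesis unfolding soliton_params_def node_poly_def by (simp only: map_append prod_list.append)
qed

text \<open>
  The branches at the nodes and the basis \<open>Q\<close> are numbered as in the input of the algorithm.
\<close>

locale soliton_curve = split_curve X X' r D D'
  for X X' :: "'k::field_char_0 curve" and r and D D' :: "'k divisor" +
  fixes a b :: nat and \<kappa> \<mu> \<nu> :: "nat \<Rightarrow> 'k" and q :: "nat \<Rightarrow> 'k pnt" and Q :: "(nat \<Rightarrow> 'k poly fract) list"
  assumes q_away: "\<And>j. j < a \<Longrightarrow> fst (q j) \<noteq> 0"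
    and crossing_nodes: "bij_betw (\<lambda>j. {(0, aff (\<kappa> j)), q j}) {..<a}
           {x \<in> nodes X. 0 \<in> fst ` x \<and> \<not> fst ` x \<subseteq> {0}}"
    and inner_nodes: "bij_betw (\<lambda>j. {(0, aff (\<mu> j)), (0, aff (\<nu> j))}) {..<b}
           {x \<in> nodes X. fst ` x \<subseteq> {0}}"
    and Q_distinct: "distinct Q" and Q_independent: "sec.independent (set Q)"
    and Q_span: "sec.span (set Q) = H0 X' D'"
begin

lemma crossing_node: "j < a \<Longrightarrow> {(0, aff (\<kappa> j)), q j} \<in> nodes X"
  using bij_betwE[OF crossing_nodes] by auto

lemma inner_node: "j < b \<Longrightarrow> {(0, aff (\<mu> j)), (0, aff (\<nu> j))} \<in> nodes X"
  using bij_betwE[OF inner_nodes] by auto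

lemma crossing_node_iff:
  "{(0, y), u} \<in> nodes X \<and> fst u \<noteq> 0 \<longleftrightarrow> (\<exists>j<a. y = aff (\<kappa> j) \<and> u = q j)"
proof
  assume x: "{(0, y), u} \<in> nodes X \<and> fst u \<noteq> 0"
  then have "{(0, y), u} \<in> {x \<in> nodes X. 0 \<in> fst ` x \<and> \<not> fst ` x \<subseteq> {0}}" by auto
  then have "{(0, y), u} \<in> (\<lambda>j. {(0, aff (\<kappa> j)), q j}) ` {..<a}"
    using bij_betw_imp_surj_on[OF crossing_nodes] by (simp only:)
  then obtain j where j: "j < a" "{(0, y), u} = {(0, aff (\<kappa> j)), q j}" by auto
  then show "\<exists>j<a. y = aff (\<kappa> j) \<and> u = q j"
    using x q_away[OF j(1)] by (intro exI[of _ j]) (auto simp: doubleton_eq_iff)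
next
  assume "\<exists>j<a. y = aff (\<kappa> j) \<and> u = q j"
  then show "{(0, y), u} \<in> nodes X \<and> fst u \<noteq> 0" using crossing_node q_away by auto
qed

lemma inner_node_obtain:
  assumes "x \<in> nodes X" "\<And>c y. (c, y) \<in> x \<Longrightarrow> c = 0"
  obtains t where "t < b" "x = {(0, aff (\<mu> t)), (0, aff (\<nu> t))}"
proof -
  have "x \<in> {x \<in> nodes X. fst ` x \<subseteq> {0}}" using assms by auto
  then have "x \<in> (\<lambda>j. {(0, aff (\<mu> j)), (0, aff (\<nu> j))}) ` {..<b}"
    using bij_betw_imp_surj_on[OF inner_nodes] by (simp only:)
  then show ?thesis using that by auto
qed

abbreviation "params \<equiv> soliton_params a b \<kappa> \<mu> \<nu>"
abbreviation "Mat \<equiv> soliton_matrix Q q D a b \<kappa> \<mu> \<nu>"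
abbreviation "F0 \<equiv> finite_part_function (\<lambda>y. D (0, y))"
abbreviation "val j i \<equiv> value_at (snd (q i)) ((Q ! j) (fst (q i)))"

lemma inner_branches_distinct: "j < b \<Longrightarrow> \<mu> j \<noteq> \<nu> j"
  using nodal_curveD(3)[OF nodal inner_node] by fastforce

text \<open>
  A parameter determines a branch on the component \<open>0\<close>, hence a node, hence its index in the numbering.
\<close>

lemma params_distinct: "distinct params"
proof -
  have same: "x = x'" if "x \<in> nodes X" "x' \<in> nodes X" "(0, aff s) \<in> x" "(0, aff s) \<in> x'" for x x' s
    using nodal_curveD(5)[OF nodal that] .
  have cross_inj: "i = j" if "i < a" "j < a" "{(0, aff (\<kappa> i)), q i} = {(0, aff (\<kappa> j)), q j}" for i j
    using bij_betw_imp_inj_on[OF crossing_nodes] that by (auto dest: inj_onD)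
  have inner_inj: "i = j" if "i < b" "j < b" 
    "{(0, aff (\<mu> i)), (0, aff (\<nu> i))} = {(0, aff (\<mu> j)), (0, aff (\<nu> j))}" for i j
    using bij_betw_imp_inj_on[OF inner_nodes] that by (auto dest: inj_onD)
  have kk: "i = j" if "i < a" "j < a" "\<kappa> i = \<kappa> j" for i j
    using cross_inj[OF that(1,2)] same[OF crossing_node[OF that(1)] crossing_node[OF that(2)], of "\<kappa> i"] that(3) by simp
  have ii: "i = j" if "i < b" "j < b" "s \<in> {\<mu> i, \<nu> i}" "s \<in> {\<mu> j, \<nu> j}" for i j s
    using inner_inj[OF that(1,2)] same[OF inner_node[OF that(1)] inner_node[OF that(2)], of s] that(3,4) by auto
  have ki: False if "i < a" "j < b" "\<kappa> i \<in> {\<mu> j, \<nu> j}" for i j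
  proof -
    have "{(0, aff (\<kappa> i)), q i} = {(0, aff (\<mu> j)), (0, aff (\<nu> j))}"
      by (rule same[OF crossing_node[OF that(1)] inner_node[OF that(2)], of "\<kappa> i"]) (use that(3) in auto)
    then have "q i \<in> {(0, aff (\<mu> j)), (0, aff (\<nu> j))}" by blast
    then show False using q_away[OF that(1)] by auto
  qed
  show ?thesis unfolding distinct_conv_nth length_soliton_params
  proof (intro allI impI)
    fix i j assume i: "i < a + 2 * b" and j: "j < a + 2 * b" and ij: "i \<noteq> j"
    show "params ! i \<noteq> params ! j"
      using i
    proof (cases rule: soliton_index_cases)
      case 1
      note i1 = this
      from j show ?thesis
      proof (cases rule: soliton_index_cases)
        case 1
        then show ?thesis using i1 kk ij by (auto simp: nth_soliton_params)
      next
        case (2 t)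
        then show ?thesis using i1 ki[of i t] by (auto simp: nth_soliton_params)
      next
        case (3 t)
        then show ?thesis using i1 ki[of i t] by (auto simp: nth_soliton_params)
      qed
    next
      case (2 t)
      note i2 = this
      from j show ?thesis
      proof (cases rule: soliton_index_cases)
        case 1
        then show ?thesis using i2 ki[of j t] by (auto simp: nth_soliton_params)
      next
        case (2 t')
        then show ?thesis using i2 ii[of t t' "\<mu> t"] ij by (auto simp: nth_soliton_params)
      next
        case (3 t')
        then show ?thesis using i2 ii[of t t' "\<mu> t"] inner_branches_distinct[of t] by (auto simp: nth_soliton_params)
      qed
    next
      case (3 t)
      note i3 = this
      from j show ?thesis
      proof (cases rule: soliton_index_cases)
        case 1
        then show ?thesis using i3 ki[of j t] by (auto simp: nth_soliton_params)
      next
        case (2 t')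
        then show ?thesis using i3 ii[of t t' "\<nu> t"] inner_branches_distinct[of t] by (auto simp: nth_soliton_params)
      next
        case (3 t')
        then show ?thesis using i3 ii[of t t' "\<nu> t"] ij by (auto simp: nth_soliton_params)
      qed
    qed
  qed
qed

lemma dim_Mat: "dim_row Mat = length Q + b" "dim_col Mat = a + 2 * b"
  by (simp_all add: soliton_matrix_def Let_def matA_def matB_def)

lemma row_combination:
  defines "K' \<equiv> pderiv (param_poly params)"
  shows "i < a \<Longrightarrow> (\<Sum>j<dim_row Mat. c j * Mat $$ (j, i)) =
      (\<Sum>j<length Q. c j * val j i) * div_fun D (\<kappa> i) / poly K' (\<kappa> i)"
    and "t < b \<Longrightarrow> (\<Sum>j<dim_row Mat. c j * Mat $$ (j, a + 2 * t)) =
      c (length Q + t) * div_fun D (\<mu> t) / poly K' (\<mu> t)"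
    and "t < b \<Longrightarrow> (\<Sum>j<dim_row Mat. c j * Mat $$ (j, Suc (a + 2 * t))) =
      c (length Q + t) * div_fun D (\<nu> t) / poly K' (\<nu> t)"
proof -
  note M = soliton_matrix_def Let_def matA_def matB_def K'_def param_poly_soliton_params
  show "(\<Sum>j<dim_row Mat. c j * Mat $$ (j, i)) =
      (\<Sum>j<length Q. c j * val j i) * div_fun D (\<kappa> i) / poly K' (\<kappa> i)" if "i < a"
    unfolding dim_Mat sum_lessThan_add using that
    by (simp add: M sum_distrib_right sum_divide_distrib mult.assoc)
  show "(\<Sum>j<dim_row Mat. c j * Mat $$ (j, a + 2 * t)) =
      c (length Q + t) * div_fun D (\<mu> t) / poly K' (\<mu> t)" if t: "t < b"
  proof -
    have parity: "2 * t \<noteq> Suc (2 * s)" for s by presburger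
    have top: "Mat $$ (j, a + 2 * t) = 0" if "j < length Q" for j using that t by (simp add: M)
    have bottom: "Mat $$ (length Q + s, a + 2 * t) = (if s = t then div_fun D (\<mu> t) / poly K' (\<mu> t) else 0)"
      if "s < b" for s using that t parity[of s] by (simp add: M)
    have "(\<Sum>j<dim_row Mat. c j * Mat $$ (j, a + 2 * t)) =
       (\<Sum>s<b. if s = t then c (length Q + t) * (div_fun D (\<mu> t) / poly K' (\<mu> t)) else 0)"
      unfolding dim_Mat sum_lessThan_add using top bottom by (simp add: mult_delta_right t)
    then show ?thesis using t by simp
  qed
  show "(\<Sum>j<dim_row Mat. c j * Mat $$ (j, Suc (a + 2 * t))) =
      c (length Q + t) * div_fun D (\<nu> t) / poly K' (\<nu> t)" if t: "t < b"
  proof -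
    have parity: "Suc (2 * t) \<noteq> 2 * s" for s by presburger
    have top: "Mat $$ (j, Suc (a + 2 * t)) = 0" if "j < length Q" for j using that t by (simp add: M)
    have bottom: "Mat $$ (length Q + s, Suc (a + 2 * t)) = (if s = t then div_fun D (\<nu> t) / poly K' (\<nu> t) else 0)"
      if "s < b" for s using that t parity[of s] by (simp add: M Suc_diff_le)
    have "(\<Sum>j<dim_row Mat. c j * Mat $$ (j, Suc (a + 2 * t))) =
       (\<Sum>s<b. if s = t then c (length Q + t) * (div_fun D (\<nu> t) / poly K' (\<nu> t)) else 0)"
      unfolding dim_Mat sum_lessThan_add using top bottom by (simp add: mult_delta_right t)
    then show ?thesis using t by simp
  qed
qed

lemma K'_nonzero:
  "i < a \<Longrightarrow> poly (pderiv (param_poly params)) (\<kappa> i) \<noteq> 0"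
  "t < b \<Longrightarrow> poly (pderiv (param_poly params)) (\<mu> t) \<noteq> 0"
  "t < b \<Longrightarrow> poly (pderiv (param_poly params)) (\<nu> t) \<noteq> 0"
  using pderiv_param_poly_nonzero[OF params_distinct, of i] pderiv_param_poly_nonzero[OF params_distinct, of "a + 2 * t"]
    pderiv_param_poly_nonzero[OF params_distinct, of "Suc (a + 2 * t)"]
  by (auto simp: nth_soliton_params length_soliton_params)

text \<open>
  The factor \<open>P / K'\<close> in the entries of the matrix cancels the factor \<open>K'\<close> in
  \<open>soliton_polys\<close>.
\<close>

lemma soliton_polys_Mat:
  "u \<in> soliton_polys Mat params \<longleftrightarrow> (\<exists>c.
     (\<forall>i<a. poly u (\<kappa> i) = div_fun D (\<kappa> i) * (\<Sum>j<length Q. c j * val j i)) \<and>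
     (\<forall>t<b. poly u (\<mu> t) = div_fun D (\<mu> t) * c (length Q + t) \<and> poly u (\<nu> t) = div_fun D (\<nu> t) * c (length Q + t)))"
proof -
  let ?K' = "pderiv (param_poly params)"
  have "(\<forall>i<dim_col Mat. poly u (params ! i) = poly ?K' (params ! i) * (\<Sum>j<dim_row Mat. c j * Mat $$ (j, i))) \<longleftrightarrow>
     (\<forall>i<a. poly u (\<kappa> i) = div_fun D (\<kappa> i) * (\<Sum>j<length Q. c j * val j i)) \<and>
     (\<forall>t<b. poly u (\<mu> t) = div_fun D (\<mu> t) * c (length Q + t) \<and> poly u (\<nu> t) = div_fun D (\<nu> t) * c (length Q + t))" for c
  proof -
    let ?P = "\<lambda>i. poly u (params ! i) = poly ?K' (params ! i) * (\<Sum>j<dim_row Mat. c j * Mat $$ (j, i))"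
    have 1: "?P i \<longleftrightarrow> poly u (\<kappa> i) = div_fun D (\<kappa> i) * (\<Sum>j<length Q. c j * val j i)" if "i < a" for i
      unfolding row_combination(1)[OF that] nth_soliton_params(1)[OF that] using K'_nonzero(1)[OF that] by (simp add: mult.commute)
    have 2: "?P (a + 2 * t) \<longleftrightarrow> poly u (\<mu> t) = div_fun D (\<mu> t) * c (length Q + t)" if "t < b" for t
      unfolding row_combination(2)[OF that] nth_soliton_params(2)[OF that] using K'_nonzero(2)[OF that] by (simp add: mult.commute)
    have 3: "?P (Suc (a + 2 * t)) \<longleftrightarrow> poly u (\<nu> t) = div_fun D (\<nu> t) * c (length Q + t)" if "t < b" for t
      unfolding row_combination(3)[OF that] nth_soliton_params(3)[OF that] using K'_nonzero(3)[OF that] by (simp add: mult.commute)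
    have "(\<forall>i<dim_col Mat. ?P i) \<longleftrightarrow> (\<forall>i<a. ?P i) \<and> (\<forall>t<b. ?P (a + 2 * t) \<and> ?P (Suc (a + 2 * t)))"
    proof
      assume *: "\<forall>i<dim_col Mat. ?P i"
      show "(\<forall>i<a. ?P i) \<and> (\<forall>t<b. ?P (a + 2 * t) \<and> ?P (Suc (a + 2 * t)))"
        using * unfolding dim_Mat(2) by simp
    next
      assume *: "(\<forall>i<a. ?P i) \<and> (\<forall>t<b. ?P (a + 2 * t) \<and> ?P (Suc (a + 2 * t)))"
      show "\<forall>i<dim_col Mat. ?P i"
      proof (intro allI impI)
        fix i assume "i < dim_col Mat"
        then have "i < a + 2 * b" unfolding dim_Mat .
        then show "?P i" by (cases rule: soliton_index_cases) (use * in blast)+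
      qed
    qed
    then show ?thesis using 1 2 3 by (simp only:) auto
  qed
  then show ?thesis unfolding soliton_polys_def by simp
qed

section \<open>The sections of the curve as a space of polynomials\<close>

lemma span_Q_iff: "g \<in> H0 X' D' \<longleftrightarrow> (\<exists>c. g = (\<Sum>j<length Q. sec_scale (c j) (Q ! j)))"
proof -
  have re: "(\<Sum>v\<in>set Q. sec_scale (w v) v) = (\<Sum>j<length Q. sec_scale (w (Q ! j)) (Q ! j))" for w
    using sum.reindex_bij_betw[OF bij_betw_nth[OF Q_distinct refl refl], of "\<lambda>v. sec_scale (w v) v"] by simp
  have "g \<in> H0 X' D' \<longleftrightarrow> (\<exists>w. g = (\<Sum>v\<in>set Q. sec_scale (w v) v))"
    unfolding Q_span[symmetric] sec.span_finite[OF finite_set] by auto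
  also have "\<dots> \<longleftrightarrow> (\<exists>c. g = (\<Sum>j<length Q. sec_scale (c j) (Q ! j)))"
  proof
    assume "\<exists>w. g = (\<Sum>v\<in>set Q. sec_scale (w v) v)"
    then obtain w where "g = (\<Sum>j<length Q. sec_scale (w (Q ! j)) (Q ! j))" unfolding re ..
    then show "\<exists>c. g = (\<Sum>j<length Q. sec_scale (c j) (Q ! j))" by (rule exI[of _ "\<lambda>j. w (Q ! j)"])
  next
    assume "\<exists>c. g = (\<Sum>j<length Q. sec_scale (c j) (Q ! j))"
    then obtain c where c: "g = (\<Sum>j<length Q. sec_scale (c j) (Q ! j))" ..
    have "g \<in> sec.span (set Q)" unfolding c by (intro sec.span_sum sec.span_scale sec.span_base) simp
    then show "\<exists>w. g = (\<Sum>v\<in>set Q. sec_scale (w v) v)" unfolding sec.span_finite[OF finite_set] by auto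
  qed
  finally show ?thesis .
qed

lemma Q_coefficients_zero:
  assumes "(\<Sum>j<length Q. sec_scale (c j) (Q ! j)) = 0" "j < length Q"
  shows "c j = 0"
proof -
  let ?w = "\<lambda>v. c (the_inv_into {..<length Q} ((!) Q) v)"
  have bij: "bij_betw ((!) Q) {..<length Q} (set Q)" by (rule bij_betw_nth[OF Q_distinct refl refl])
  have inv: "?w (Q ! j) = c j" if "j < length Q" for j
    using the_inv_into_f_f[OF bij_betw_imp_inj_on[OF bij]] that by simp
  have "(\<Sum>v\<in>set Q. sec_scale (?w v) v) = (\<Sum>j<length Q. sec_scale (?w (Q ! j)) (Q ! j))"
    using sum.reindex_bij_betw[OF bij, of "\<lambda>v. sec_scale (?w v) v"] by simp
  also have "\<dots> = (\<Sum>j<length Q. sec_scale (c j) (Q ! j))" using inv by (intro sum.cong) auto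
  finally have "(\<Sum>v\<in>set Q. sec_scale (?w v) v) = 0" using assms(1) by simp
  then have "?w (Q ! j) = 0"
    using sec.independentD[OF Q_independent finite_set subset_refl, of ?w "Q ! j"] assms(2) by simp
  then show ?thesis using inv[OF assms(2)] by simp
qed

text \<open>
  The values in the matrix are those of the \<open>Q ! j\<close> at the crossings; they exist because \<open>D'\<close> is zero
  there.
\<close>

lemma has_value_combination:
  assumes "i < a"
  shows "has_value (snd (q i)) ((\<Sum>j<length Q. sec_scale (c j) (Q ! j)) (fst (q i))) (\<Sum>j<length Q. c j * val j i)"
proof -
  note x = crossing_node[OF assms] q_away[OF assms]
  note sm = crossing_smooth'(1)[OF x]
  have cl: "snd (q i) \<in> closed_places" using smooth'_closed[OF sm] by simp
  have "has_value (snd (q i)) ((Q ! j) (fst (q i))) (val j i)" if "j < length Q" for j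
  proof -
    have "Q ! j \<in> H0 X' D'" unfolding Q_span[symmetric] using that by (intro sec.span_base) simp
    then have "Q ! j \<in> germs X' D' {q i}" using smooth_point_in_points[OF sm] by (simp add: H0_def)
    then have "(Q ! j) (fst (q i)) \<in> stalk (D' (q i)) (snd (q i))" by (cases "q i") (auto simp: germs_def)
    then obtain v where v: "has_value (snd (q i)) ((Q ! j) (fst (q i))) v" using value_at_crossing[OF x] by blast
    then show ?thesis using value_at_eqI[OF cl v] by simp
  qed
  then have "has_value (snd (q i)) (\<Sum>j<length Q. const (c j) * (Q ! j) (fst (q i))) (\<Sum>j<length Q. c j * val j i)"
    by (intro has_value_sum has_value_const_mult cl) simp
  then show ?thesis by (simp add: sum_apply sec_scale_def)
qed

lemma branch_divisor_0:
  "x \<in> nodes X \<Longrightarrow> (0, y) \<in> x \<Longrightarrow> D (0, y) = 0"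
  using divisor_on_node[OF D] by blast

lemma branch_value:
  assumes x: "x \<in> nodes X" "(0, aff t) \<in> x" and f: "f * F0 = Fract u 1"
  shows "has_value (aff t) f v \<longleftrightarrow> poly u t = div_fun D t * v"
proof -
  note P = finite_part_function_value[OF D branch_divisor_0[OF x]]
  have hv: "has_value (aff t) f v \<Longrightarrow> poly u t = v * div_fun D t" for v
  proof -
    assume "has_value (aff t) f v"
    then have "has_value (aff t) (f * F0) (v * div_fun D t)" using P(1) by (rule has_value_mult[OF aff_closed])
    moreover have "has_value (aff t) (Fract u 1) (poly u t)" using has_value_aff[of 1 t u] by simp
    ultimately show "poly u t = v * div_fun D t" unfolding f using has_value_unique aff_closed by blast
  qed
  have F0: "F0 \<noteq> 0" by (rule finite_part_function_nonzero[OF divisor_on_place_divisor[OF D]])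
  have "has_value (aff t) (Fract u 1 * inverse F0) (poly u t * inverse (div_fun D t))"
    using has_value_aff[of 1 t u] P(2) by (intro has_value_mult aff_closed) simp_all
  moreover have "Fract u 1 * inverse F0 = f" unfolding f[symmetric] using F0 by simp
  ultimately have "has_value (aff t) f (poly u t * inverse (div_fun D t))" by simp
  then show ?thesis using hv[of v] P(3) by (auto simp: field_simps)
qed

text \<open>
  A section of \<open>D + n p\<close> restricts to a function \<open>u / P\<close> on the component \<open>0\<close> and to a
  combination \<open>\<Sum>c\<^sub>j Q\<^sub>j\<close> on \<open>X'\<close>. Gluing at the crossings is the condition on \<open>u\<close> from the block
  \<open>A\<close> of the matrix, and gluing at the nodes of the component is the one from the block \<open>B\<close>, where the
  remaining coefficients are the values at those nodes. Conversely, such a pair is a section once \<open>n\<close> is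
  large enough for the pole of \<open>u / P\<close> at the marked point.
\<close>

lemma component_sections_eq:
  "(\<lambda>f. f 0) ` (\<Union>n. H0 X (Dn n)) = (\<lambda>u. Fract u 1 * inverse F0) ` soliton_polys Mat params"
proof (intro equalityI subsetI)
  note pD = divisor_on_place_divisor[OF D, of 0]
  have F0: "F0 \<noteq> 0" by (rule finite_part_function_nonzero[OF pD])
  fix g assume "g \<in> (\<lambda>f. f 0) ` (\<Union>n. H0 X (Dn n))"
  then obtain f n where f: "g = f 0" "f \<in> H0 X (Dn n)" by auto
  have germ: "f \<in> germs X (Dn n) x" if "x \<in> points X" for x using f that by (simp add: H0_def)
  have node_val: "\<exists>v. \<forall>(c, y)\<in>x. has_value y (f c) v" if "x \<in> nodes X" for x
    using germ[of x] that by (simp add: germs_def points_def)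
  have "f 0 * F0 \<in> local_ring (Fin p)" if p: "Fin p \<in> closed_places" for p
  proof -
    have "f 0 \<in> stalk (Dn n (0, Fin p)) (Fin p)"
    proof (cases "(0, Fin p) \<in> smooth_points X")
      case True
      then show ?thesis using germ[OF smooth_point_in_points[OF True]] by (simp add: germs_def)
    next
      case False
      then obtain x where x: "x \<in> nodes X" "(0, Fin p) \<in> x" using p comps by (auto simp: smooth_points_def)
      then have "f \<in> germs X (Dn n) x" using germ by (simp add: points_def)
      then show ?thesis using x(2) by (auto simp: germs_def)
    qed
    then have "f 0 \<in> stalk (D (0, Fin p)) (Fin p)" by (simp add: add_multiple_def)
    then show ?thesis using stalk_times_finite_part_function[OF pD p, of "f 0"] by simp
  qed
  then obtain u where u: "f 0 * F0 = Fract u 1" using polynomial_if_regular_at_finite_places by blast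
  obtain c where c: "(\<lambda>c. if c = 0 then 0 else f c) = (\<Sum>j<length Q. sec_scale (c j) (Q ! j))"
    using H0_restrict[OF f(2)] span_Q_iff by blast
  have "\<forall>t. \<exists>v. t < b \<longrightarrow> has_value (aff (\<mu> t)) (f 0) v \<and> has_value (aff (\<nu> t)) (f 0) v"
    using node_val[OF inner_node] by fastforce
  from choice[OF this] obtain d where d: "\<And>t. t < b \<Longrightarrow> has_value (aff (\<mu> t)) (f 0) (d t) \<and> has_value (aff (\<nu> t)) (f 0) (d t)" by blast
  let ?c = "\<lambda>j. if j < length Q then c j else d (j - length Q)"
  have "poly u (\<kappa> i) = div_fun D (\<kappa> i) * (\<Sum>j<length Q. ?c j * val j i)" if i: "i < a" for i
  proof -
    obtain v where v: "\<forall>(c, y)\<in>{(0, aff (\<kappa> i)), q i}. has_value y (f c) v" using node_val[OF crossing_node[OF i]] ..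
    have v1: "has_value (aff (\<kappa> i)) (f 0) v" and v2: "has_value (snd (q i)) (f (fst (q i))) v"
      using v by (cases "q i", auto)+
    have cl: "snd (q i) \<in> closed_places"
      using smooth'_closed[OF crossing_smooth'(1)[OF crossing_node[OF i] q_away[OF i]]] by simp
    have "f (fst (q i)) = (\<Sum>j<length Q. sec_scale (c j) (Q ! j)) (fst (q i))"
      using fun_cong[OF c, of "fst (q i)"] q_away[OF i] by simp
    then have "has_value (snd (q i)) (f (fst (q i))) (\<Sum>j<length Q. c j * val j i)"
      using has_value_combination[OF i, of c] by simp
    then have "v = (\<Sum>j<length Q. c j * val j i)" using has_value_unique[OF v2 cl] by simp
    moreover have "poly u (\<kappa> i) = div_fun D (\<kappa> i) * v"
      using branch_value[OF crossing_node[OF i] _ u] v1 by simp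
    ultimately show ?thesis by simp
  qed
  moreover have "poly u (\<mu> t) = div_fun D (\<mu> t) * ?c (length Q + t) \<and> poly u (\<nu> t) = div_fun D (\<nu> t) * ?c (length Q + t)"
    if t: "t < b" for t
    using branch_value[OF inner_node[OF t] _ u] d[OF t] by simp
  ultimately have "u \<in> soliton_polys Mat params" unfolding soliton_polys_Mat by (intro exI[of _ ?c]) blast
  moreover have "g = Fract u 1 * inverse F0" unfolding u[symmetric] f(1) using F0 by simp
  ultimately show "g \<in> (\<lambda>u. Fract u 1 * inverse F0) ` soliton_polys Mat params" by blast
next
  note pD = divisor_on_place_divisor[OF D, of 0]
  have F0: "F0 \<noteq> 0" by (rule finite_part_function_nonzero[OF pD])
  fix g assume "g \<in> (\<lambda>u. Fract u 1 * inverse F0) ` soliton_polys Mat params"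
  then obtain u where u: "g = Fract u 1 * inverse F0" "u \<in> soliton_polys Mat params" by auto
  have gF: "g * F0 = Fract u 1" unfolding u(1) using F0 by simp
  obtain c where c: "\<And>i. i < a \<Longrightarrow> poly u (\<kappa> i) = div_fun D (\<kappa> i) * (\<Sum>j<length Q. c j * val j i)"
    "\<And>t. t < b \<Longrightarrow> poly u (\<mu> t) = div_fun D (\<mu> t) * c (length Q + t)"
    "\<And>t. t < b \<Longrightarrow> poly u (\<nu> t) = div_fun D (\<nu> t) * c (length Q + t)"
    using u(2) unfolding soliton_polys_Mat by blast
  let ?s = "\<Sum>j<length Q. sec_scale (c j) (Q ! j)"
  have sH: "?s \<in> H0 X' D'" using span_Q_iff by blast
  have g_fin: "g \<in> stalk (D (0, Fin p)) (Fin p)" if p: "Fin p \<in> closed_places" for p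
    using stalk_times_finite_part_function[OF pD p, of g] local_ring_Fin_polynomial[OF p, of u] gF by simp
  obtain k where k: "g \<in> stalk (int k) Infty"
  proof -
    obtain n d where nd: "g = Fract n d" "d \<noteq> 0" by (cases g) auto
    have "g \<in> stalk (int (degree n)) Infty"
    proof (cases "n = 0")
      case True
      then have "g = 0" using nd by (simp add: fract_collapse)
      then show ?thesis using stalk_zero[OF Infty_closed] by (simp only:)
    next
      case False
      then show ?thesis using nd Fract_in_stalk_Infty[OF False nd(2)] by simp
    qed
    then show ?thesis using that by blast
  qed
  \<comment> \<open>large enough for the pole of \<open>g\<close> at the marked point\<close>
  let ?n = "nat (int k - D (0, Infty))"
  define f where "f x = (if x = 0 then g else ?s x)" for x
  have g_stalk: "g \<in> stalk (Dn ?n (0, y)) y" if y: "y \<in> closed_places" for y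
  proof (cases y)
    case (Fin p)
    then show ?thesis using g_fin y by (simp add: add_multiple_def)
  next
    case Infty
    have "stalk (int k) Infty \<subseteq> stalk (Dn ?n (0, Infty)) (Infty :: 'k poly place)"
      by (intro stalk_mono Infty_closed) (simp add: add_multiple_def)
    then show ?thesis using k Infty by blast
  qed
  have "f \<in> germs X (Dn ?n) x" if x: "x \<in> points X" for x
  proof (cases "x \<in> nodes X")
    case False
    then obtain p where p: "x = {p}" "p \<in> smooth_points X" using x by (auto simp: points_def)
    obtain e y where ey: "p = (e, y)" by (cases p)
    have y: "y \<in> closed_places" using p ey by (auto simp: smooth_points_def)
    have "f e \<in> stalk (Dn ?n (e, y)) y"
    proof (cases "e = 0")
      case True
      then show ?thesis using g_stalk[OF y] by (simp add: f_def)
    next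
      case e: False
      have "?s \<in> germs X' D' {p}"
        using sH smooth_point_in_points[OF smooth_smooth'[OF p(2)]] ey e by (simp add: H0_def)
      then show ?thesis using ey e Dn_away[OF e] by (simp add: germs_def f_def)
    qed
    then show ?thesis using p ey False by (simp add: germs_def)
  next
    case xn: True
    have cl: "y \<in> closed_places" if "(e, y) \<in> x" for e y using points_closed[OF nodal x that] by simp
    have "\<exists>w. \<forall>(e, y)\<in>x. has_value y (f e) w"
      using xn
    proof (cases rule: node_cases)
      case away
      then have "?s \<in> germs X' D' x" using sH by (simp add: H0_def points_def)
      then obtain w where w: "\<forall>(e, y)\<in>x. has_value y (?s e) w" using away(1) by (auto simp: germs_def)
      have "\<forall>(e, y)\<in>x. has_value y (f e) w"
      proof (rule ballI, rule case_prodI2)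
        fix p e y assume "p \<in> x" "p = (e, y)"
        then show "has_value y (f e) w" using w away(2)[of e y] by (auto simp: f_def)
      qed
      then show ?thesis ..
    next
      case (crossing y p)
      then obtain i where i: "i < a" "y = aff (\<kappa> i)" "p = q i" using xn crossing_node_iff by blast
      let ?v = "\<Sum>j<length Q. c j * val j i"
      have "has_value (aff (\<kappa> i)) g ?v" using branch_value[OF crossing_node[OF i(1)] _ gF] c(1)[OF i(1)] by simp
      moreover have "has_value (snd (q i)) (?s (fst (q i))) ?v" by (rule has_value_combination[OF i(1)])
      ultimately have "\<forall>(e, z)\<in>{(0, y), p}. has_value z (f e) ?v"
        using q_away[OF i(1)] unfolding i(2,3) by (cases "q i") (simp add: f_def)
      then show ?thesis unfolding crossing(1)[symmetric] ..
    next
      case inner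
      obtain t where t: "t < b" "x = {(0, aff (\<mu> t)), (0, aff (\<nu> t))}" using inner_node_obtain[OF xn inner(2)] .
      have "has_value (aff (\<mu> t)) g (c (length Q + t))" "has_value (aff (\<nu> t)) g (c (length Q + t))"
        using branch_value[OF inner_node[OF t(1)] _ gF] c(2,3)[OF t(1)] by simp_all
      then have "\<forall>(e, z)\<in>x. has_value z (f e) (c (length Q + t))" unfolding t(2) by (simp add: f_def)
      then show ?thesis ..
    qed
    then obtain w where w: "\<forall>(e, y)\<in>x. has_value y (f e) w" ..
    have "f e \<in> stalk (Dn ?n (e, y)) y" if "(e, y) \<in> x" for e y
      using has_value_in_local_ring[OF cl[OF that], of "f e" w] w that divisor_on_node[OF divisor_on_Dn xn that]
      by auto
    then show ?thesis using w by (auto simp: germs_def)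
  qed
  moreover have "f \<in> rational_functions X"
    using sH by (auto simp: H0_def rational_functions_def f_def comps comps')
  ultimately have "f \<in> H0 X (Dn ?n)" by (simp add: H0_def)
  moreover have "g = f 0" by (simp add: f_def)
  ultimately show "g \<in> (\<lambda>f. f 0) ` (\<Union>n. H0 X (Dn n))" by blast
qed

text \<open>
  The coefficients of the rows of \<open>B\<close> vanish because \<open>P\<close> is nonzero at the branches. A relation
  between the rows of \<open>A\<close> gives a combination of \<open>Q\<close> that vanishes at all crossings.
\<close>

lemma Mat_rows_independent:
  assumes zero: "H0 X' (\<lambda>u. D' u - (if \<exists>y. {(0, y), u} \<in> nodes X \<and> fst u \<noteq> 0 then 1 else 0)) = {0}"
  shows "rows_independent Mat"
  unfolding rows_independent_def
proof (rule allI, rule impI)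
  fix c assume *: "\<forall>i<dim_col Mat. (\<Sum>j<dim_row Mat. c j * Mat $$ (j, i)) = 0"
  have P: "div_fun D t \<noteq> 0" if "x \<in> nodes X" "(0, aff t) \<in> x" for x t
    by (rule finite_part_function_value(3)[OF D branch_divisor_0[OF that]])
  have inner: "c (length Q + t) = 0" if t: "t < b" for t
  proof -
    have "(\<Sum>j<dim_row Mat. c j * Mat $$ (j, a + 2 * t)) = 0" using * t by (simp add: dim_Mat)
    then show ?thesis unfolding row_combination(2)[OF t] using K'_nonzero(2)[OF t] P[OF inner_node[OF t]] by simp
  qed
  let ?s = "\<Sum>j<length Q. sec_scale (c j) (Q ! j)"
  have cross: "(\<Sum>j<length Q. c j * val j i) = 0" if i: "i < a" for i
  proof -
    have "(\<Sum>j<dim_row Mat. c j * Mat $$ (j, i)) = 0" using * i by (simp add: dim_Mat)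
    then show ?thesis unfolding row_combination(1)[OF i] using K'_nonzero(1)[OF i] P[OF crossing_node[OF i]] by simp
  qed
  have "has_value (snd u) (?s (fst u)) 0" if u: "{(0, y), u} \<in> nodes X \<and> fst u \<noteq> 0" for y u
  proof -
    obtain i where i: "i < a" "u = q i" using u crossing_node_iff by blast
    show ?thesis using has_value_combination[OF i(1), of c] unfolding cross[OF i(1)] i(2) .
  qed
  moreover have "?s \<in> H0 X' D'" using span_Q_iff by blast
  ultimately have "?s \<in> {0}" unfolding zero[symmetric] vanishing_sections_iff by blast
  then have "c j = 0" if "j < length Q" for j using Q_coefficients_zero[OF _ that, of c] by simp
  then show "\<forall>j<dim_row Mat. c j = 0"
    unfolding dim_Mat using inner by (metis add_diff_inverse_nat nat_add_left_cancel_less)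
qed

lemma sato_point_eq:
  "sato_point X D = (\<lambda>u. fls_X_intpow (D (0, Infty) + 1) * (poly_at_inf u / laurent_at_inf F0)) ` soliton_polys Mat params"
proof -
  have "sato_point X D = (\<lambda>g. fls_X_intpow (D (0, Infty) + 1) * laurent_at_inf g) ` (\<lambda>f. f 0) ` (\<Union>n. H0 X (Dn n))"
    unfolding sato_point_def image_image ..
  then show ?thesis unfolding component_sections_eq image_image
    by (simp add: laurent_mult laurent_inverse laurent_at_inf_Fract divide_inverse)
qed

text \<open>
  The points consist of the series \<open>z\<^bsup>m + 1\<^esup> u / P\<close> and \<open>x\<^sup>k u / K\<close> for the same polynomials \<open>u\<close>, so their quotient
  is \<open>z\<^bsup>m + 1 + k\<^esup> K / P\<close>. The assumption on the degree says that its order is zero.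
\<close>

lemma represents_soliton_if_degree:
  assumes deg: "place_div_degree (\<lambda>y. D (0, y)) = int a + int b - 1 - int (length Q)"
    and zero: "H0 X' (\<lambda>u. D' u - (if \<exists>y. {(0, y), u} \<in> nodes X \<and> fst u \<noteq> 0 then 1 else 0)) = {0}"
  shows "represents_soliton Mat params (sato_point X D)"
proof -
  let ?m = "D (0, Infty)" and ?k = "dim_row Mat"
  let ?K = "poly_at_inf (param_poly params)" and ?L = "laurent_at_inf F0"
  note pD = divisor_on_place_divisor[OF D, of 0]
  have L0: "?L \<noteq> 0" using finite_part_function_nonzero[OF pD] by (simp add: laurent_eq_0_iff)
  have K0: "?K \<noteq> 0" by (simp add: poly_at_inf_eq_0_iff)
  define g where "g = fls_X_intpow (?m + 1 + int ?k) * ?K / ?L"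
  have g0: "g \<noteq> 0" using L0 K0 by (simp add: g_def)
  have "fls_subdegree g = fls_subdegree (fls_X_intpow (?m + 1 + int ?k) * ?K) - fls_subdegree ?L"
    unfolding g_def using L0 K0 by (intro fls_divide_subdegree) simp_all
  also have "\<dots> = (?m + 1 + int ?k - int (a + 2 * b)) - (?m - place_div_degree (\<lambda>y. D (0, y)))"
    using K0 by (subst fls_subdegree_mult)
      (simp_all add: subdegree_poly_at_inf degree_param_poly length_soliton_params subdegree_laurent_finite_part_function[OF pD])
  also have "\<dots> = 0" using deg by (simp add: dim_Mat)
  finally have sub: "fls_subdegree g = 0" .
  define h where "h = fls_regpart g"
  have hg: "fps_to_fls h = g" unfolding h_def using sub by simp
  have h0: "fps_nth h 0 \<noteq> 0" using nth_fls_subdegree_nonzero[OF g0] unfolding sub h_def by simp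
  have len: "length params = dim_col Mat" by (simp add: length_soliton_params dim_Mat)
  have point: "sato_point X D = (\<lambda>f. fps_to_fls h * f) ` soliton_point Mat params"
    unfolding sato_point_eq soliton_point_eq[OF params_distinct len] image_image
  proof (intro image_cong refl)
    fix u
    have X: "fls_X_intpow (?m + 1) = fls_X_intpow (?m + 1 + int ?k) * (fls_X_intpow (- int ?k) :: 'k fls)"
      unfolding fls_X_intpow_times_fls_X_intpow by simp
    show "fls_X_intpow (?m + 1) * (poly_at_inf u / ?L) = fps_to_fls h * soliton_embed Mat params u"
      unfolding hg g_def soliton_embed_def X using L0 K0 by (simp add: field_simps)
  qed
  note rows = Mat_rows_independent[OF zero]
  have "vec_space.rank ?k Mat = ?k"
    by (rule rank_eq_dim_row_if_rows_independent) (use rows in \<open>simp add: rows_independent_def\<close>)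
  moreover have "sato_point X D \<in> sato_grassmannian"
    unfolding point by (rule gauge_transform_of_soliton_point_in_sato_grassmannian[OF h0 params_distinct len rows])
  moreover have "gauge_equivalent (sato_point X D) (soliton_point Mat params)"
    unfolding gauge_equivalent_def using point h0 by (intro exI[of _ h]) simp
  ultimately show ?thesis unfolding represents_soliton_def using len params_distinct by blast
qed

lemma card_nodes: "card (nodes X) = card (nodes X') + a + b"
proof -
  let ?C = "{x \<in> nodes X. 0 \<in> fst ` x \<and> \<not> fst ` x \<subseteq> {0}}" and ?I = "{x \<in> nodes X. fst ` x \<subseteq> {0}}"
  have fin: "finite (nodes X)" "finite (nodes X')" using nodal_curveD(2) nodal nodal' by blast+
  have nonempty: "x \<noteq> {}" if "x \<in> nodes X" for x using nodal_curveD(3)[OF nodal that] by auto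
  have cover: "x \<in> nodes X' \<union> ?C \<union> ?I" if x: "x \<in> nodes X" for x
    using x
  proof (cases rule: node_cases)
    case (crossing y u)
    then show ?thesis using x by auto
  next
    case inner
    then have "fst ` x \<subseteq> {0}" by force
    then show ?thesis using x by blast
  qed simp
  have eq: "nodes X = nodes X' \<union> ?C \<union> ?I"
  proof (intro equalityI subsetI)
    fix x assume "x \<in> nodes X' \<union> ?C \<union> ?I"
    then show "x \<in> nodes X" using node'_node[of x] by blast
  qed (rule cover)
  have d1: "nodes X' \<inter> ?C = {}" unfolding nodes' by auto
  have d2: "(nodes X' \<union> ?C) \<inter> ?I = {}"
  proof -
    have False if x: "x \<in> nodes X'" "x \<in> ?I" for x
    proof -
      obtain u where "u \<in> x" using nonempty x by blast
      then show False using x node'_away[OF x(1), of "fst u" "snd u"] by auto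
    qed
    then show ?thesis by auto
  qed
  have "card (nodes X) = card (nodes X' \<union> ?C) + card ?I"
    by (subst eq, rule card_Un_disjoint) (use fin d2 in auto)
  also have "card (nodes X' \<union> ?C) = card (nodes X') + card ?C"
    by (rule card_Un_disjoint) (use fin d1 in auto)
  finally show ?thesis using bij_betw_same_card[OF crossing_nodes] bij_betw_same_card[OF inner_nodes] by simp
qed

lemma div_degree_split: "div_degree D = place_div_degree (\<lambda>y. D (0, y)) + div_degree D'"
proof -
  have "{0..r} = insert 0 {1..r}" by auto
  then have "div_degree D = place_div_degree (\<lambda>y. D (0, y)) + (\<Sum>c\<in>{1..r}. place_div_degree (\<lambda>y. D (c, y)))"
    unfolding div_degree_eq_sum_components[OF nodal D] comps by simp
  also have "(\<Sum>c\<in>{1..r}. place_div_degree (\<lambda>y. D (c, y))) = div_degree D'"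
    unfolding div_degree_eq_sum_components[OF nodal' divisor_on'] comps'
    by (intro sum.cong refl) (simp add: D'_def restrict_div_def)
  finally show ?thesis .
qed

end

theorem proposition28:
  fixes X X' :: "'k::field_char_0 curve"
    and r g a b :: nat
    and D D' Z :: "'k divisor"
    and \<kappa> \<mu> \<nu> :: "nat \<Rightarrow> 'k"
    and q :: "nat \<Rightarrow> nat \<times> 'k poly place"
    and Q :: "(nat \<Rightarrow> 'k poly fract) list"
  assumes "nodal_curve X" and "connected_curve X" and "comps X = {0..r}"
    and "arith_genus X = int g"
    and "(0, Infty) \<in> smooth_points X"
    and "divisor_on X D" and "div_degree D = int g - 1"
    and X'_def: "X' = subcurve X {1..r}"
    and D'_def: "D' = restrict_div D {1..r}"
    and "\<And>j. j < a \<Longrightarrow> fst (q j) \<noteq> 0"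
    and "bij_betw (\<lambda>j. {(0, aff (\<kappa> j)), q j}) {..<a}
           {x \<in> nodes X. 0 \<in> fst ` x \<and> \<not> fst ` x \<subseteq> {0}}"
    and Z_def: "Z = (\<lambda>u. if u \<in> q ` {..<a} then 1 else 0)"
    and "bij_betw (\<lambda>j. {(0, aff (\<mu> j)), (0, aff (\<nu> j))}) {..<b}
           {x \<in> nodes X. fst ` x \<subseteq> {0}}"
    and "distinct Q" and "sec.independent (set Q)" and "sec.span (set Q) = H0 X' D'"
  shows "(int (length Q) = div_degree D' + 1 - arith_genus X' \<longleftrightarrow> eventually_nonspecial X D) \<and>
    (H0 X' (\<lambda>u. D' u - Z u) = {0} \<longleftrightarrow> determined_by_laurent X D) \<and>
    (int (length Q) = div_degree D' + 1 - arith_genus X' \<and> H0 X' (\<lambda>u. D' u - Z u) = {0} \<longrightarrow>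
      represents_soliton (soliton_matrix Q q D a b \<kappa> \<mu> \<nu>) (soliton_params a b \<kappa> \<mu> \<nu>)
        (sato_point X D))"
proof -
  interpret soliton_curve X X' r D D' a b \<kappa> \<mu> \<nu> q Q
    using assms by unfold_locales
  have Z: "Z = (\<lambda>u. if \<exists>y. {(0, y), u} \<in> nodes X \<and> fst u \<noteq> 0 then 1 else 0)"
    unfolding Z_def crossing_node_iff by (auto simp: fun_eq_iff)
  have "h0 X' D' = length Q"
    unfolding h0_def Q_span[symmetric] sec.dim_span_eq_card_independent[OF Q_independent] by (rule distinct_card[OF Q_distinct])
  then have RR': "int (length Q) - int (h1 X' D') = div_degree D' + int r - int (card (nodes X'))"
    using riemann_roch_h0_h1(1)[OF nodal' divisor_on'] by (simp add: comps')
  have genus': "arith_genus X' = 1 - int r + int (card (nodes X'))"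
    using arith_genus_eq[OF nodal'] by (simp add: comps')
  have genus: "int g = - int r + int (card (nodes X))"
    using arith_genus_eq[OF nodal] assms(4) by (simp add: comps)
  have nonspecial: "int (length Q) = div_degree D' + 1 - arith_genus X' \<longleftrightarrow> eventually_nonspecial X D"
    unfolding eventually_nonspecial_iff riemann_roch_h0_h1(2)[OF nodal' divisor_on', symmetric] genus'
    using RR' by auto
  have "represents_soliton Mat params (sato_point X D)"
    if l: "int (length Q) = div_degree D' + 1 - arith_genus X'" and z: "H0 X' (\<lambda>u. D' u - Z u) = {0}"
  proof (rule represents_soliton_if_degree)
    show "place_div_degree (\<lambda>y. D (0, y)) = int a + int b - 1 - int (length Q)"
      using l genus genus' div_degree_split assms(7) card_nodes by simp
  qed (use z in \<open>simp only: Z\<close>)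
  then show ?thesis using nonspecial determined_by_laurent_iff[OF Z] by blast
qed

end
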